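(* Let $\varphi_1:X(\mathfrak{so}_4,\mathfrak{so}_4)^{tw}\hookrightarrow Y^-(2)\otimes Y^-(2)$ be the algebra embedding $S(u)\mapsto S^\circ(u-1/2)\,S^\bullet(u-1/2)$, and let $\mathrm{Pr}_1$ and $\mathrm{Pr}_2$ denote the natural projection $Y^-(2)\to SY^-(2)$ applied to the first and to the second tensor factor, respectively. The compositions $\chi_1^{(1)}=\mathrm{Pr}_1\circ\varphi_1$ and $\chi_1^{(2)}=\mathrm{Pr}_2\circ\varphi_1$ define algebra isomorphisms $$X(\mathfrak{so}_4,\mathfrak{so}_4)^{tw}\cong SY^-(2)\otimes Y^-(2)\qquad\text{and}\qquad X(\mathfrak{so}_4,\mathfrak{so}_4)^{tw}\cong Y^-(2)\otimes SY^-(2),$$ respectively.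
   Context: All algebras are unital associative over $\mathbb C$; $P=\sum E_{ij}\otimes E_{ji}$. $2\times2$ notation: indices in $\{-1,1\}$, $(E_{ij})^{t_-}=\mathrm{sign}(i)\,\mathrm{sign}(j)E_{-j,-i}$, $R^\circ(u)=I-\frac Pu$. $Y(2)$ is generated by the coefficients of $T^\circ(u)=I+O(u^{-1})$ with relation $R^\circ(u-v)T^\circ_1(u)T^\circ_2(v)=T^\circ_2(v)T^\circ_1(u)R^\circ(u-v)$. The series $\mathrm{qdet}\,T^\circ(u)=t^\circ_{-1,-1}(u-1)t^\circ_{11}(u)-t^\circ_{-1,1}(u-1)t^\circ_{1,-1}(u)$ has central coefficients; $SY(2)=Y(2)/(\mathrm{qdet}\,T^\circ(u)-1)$, and $\mathcal T^\circ(u)$ is the image of $T^\circ(u)$. $Y^-(2)\subset Y(2)$ is the subalgebra generated by the coefficients of its generating matrix $T^\circ(u)T^\circ(-u)^{t_-}$; $SY^-(2)\subset SY(2)$ is generated by the coefficients of $\mathcal T^\circ(u)\mathcal T^\circ(-u)^{t_-}$; the natural projection $Y^-(2)\to SY^-(2)$ is the restriction of $Y(2)\to SY(2)$. $S^\circ(u)$ and $S^\bullet(u)$ denote the generating matrices of the first and second copy of $Y^-(2)$. $\mathfrak{so}_4$: $4\times4$ matrices are indexed by $\{-2,-1,1,2\}$, $(E_{ij})^t=E_{-j,-i}$, $Q=\sum E_{ij}\otimes E_{-i,-j}$, $R(u)=I-\frac Pu+\frac Q{u-1}$. $X(\mathfrak{so}_4)$ is generated by the coefficients of the $4\times4$ matrix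 $T(u)=I+O(u^{-1})$ with relation $R(u-v)T_1(u)T_2(v)=T_2(v)T_1(u)R(u-v)$. $X(\mathfrak{so}_4,\mathfrak{so}_4)^{tw}\subset X(\mathfrak{so}_4)$ is the subalgebra generated by the coefficients of $S(u)=T(u-\frac12)\,T(-u+\frac12)^t$. Identification: $\mathbb C^4=\mathbb C^2\otimes\mathbb C^2$ via $v_{-2}=e_{-1}\otimes e_{-1}$, $v_{-1}=e_{-1}\otimes e_1$, $v_1=e_1\otimes e_{-1}$, $v_2=-e_1\otimes e_1$. In the formula for $\varphi_1$, $S^\circ$ acts on the first factor, $S^\bullet$ on the second, and $s_{ij}(u)$ is sent to the $(i,j)$ entry of the right-hand side in the basis $v_{-2},v_{-1},v_1,v_2$. *)

theory Defs
  imports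
    "HOL-Analysis.Analysis"
    "HOL-Computational_Algebra.Formal_Laurent_Series"
    "HOL-Library.Poly_Mapping"
begin

notation fls_nth (infixl \<open>$$\<close> 75)

section \<open>Unital associative algebras over the complex numbers\<close>

class calgebra_1 = ring_1 +
  fixes scaleC :: "complex \<Rightarrow> 'a \<Rightarrow> 'a"  (infixr \<open>*\<^sub>C\<close> 75)
  assumes scaleC_add_right: "c *\<^sub>C (x + y) = c *\<^sub>C x + c *\<^sub>C y"
    and scaleC_add_left: "(c + d) *\<^sub>C x = c *\<^sub>C x + d *\<^sub>C x"
    and scaleC_scaleC: "c *\<^sub>C d *\<^sub>C x = (c * d) *\<^sub>C x"
    and scaleC_one: "1 *\<^sub>C x = x"
    and mult_scaleC_left: "(c *\<^sub>C x) * y = c *\<^sub>C (x * y)"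
    and mult_scaleC_right: "x * (c *\<^sub>C y) = c *\<^sub>C (x * y)"

global_interpretation cvec: vector_space "scaleC :: complex \<Rightarrow> 'a::calgebra_1 \<Rightarrow> 'a"
  by unfold_locales (rule scaleC_add_right scaleC_add_left scaleC_scaleC scaleC_one)+

instantiation complex :: calgebra_1
begin

definition scaleC_complex :: "complex \<Rightarrow> complex \<Rightarrow> complex"
  where "scaleC_complex c x = c * x"

instance
  by standard (simp_all add: scaleC_complex_def algebra_simps)

end

definition calg_hom :: "('a::calgebra_1 \<Rightarrow> 'b::calgebra_1) \<Rightarrow> bool" where
  "calg_hom f \<longleftrightarrow> f 1 = 1 \<and> (\<forall>x y. f (x + y) = f x + f y) \<and> (\<forall>x y. f (x * y) = f x * f y) \<and>
     (\<forall>c x. f (c *\<^sub>C x) = c *\<^sub>C f x)"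

definition calg_iso :: "('a::calgebra_1 \<Rightarrow> 'b::calgebra_1) \<Rightarrow> bool" where
  "calg_iso f \<longleftrightarrow> calg_hom f \<and> bij f"

definition subalgebra :: "'a::calgebra_1 set \<Rightarrow> bool" where
  "subalgebra S \<longleftrightarrow> 1 \<in> S \<and> (\<forall>x\<in>S. \<forall>y\<in>S. x + y \<in> S \<and> x * y \<in> S) \<and> (\<forall>c. \<forall>x\<in>S. c *\<^sub>C x \<in> S)"

definition two_sided_ideal :: "'a::ring_1 set \<Rightarrow> bool" where
  "two_sided_ideal I \<longleftrightarrow> 0 \<in> I \<and> (\<forall>x\<in>I. \<forall>y\<in>I. x + y \<in> I) \<and> (\<forall>a. \<forall>x\<in>I. a * x \<in> I \<and> x * a \<in> I)"

abbreviation ideal_gen :: "'a::ring_1 set \<Rightarrow> 'a set"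
  where "ideal_gen G \<equiv> two_sided_ideal hull G"

abbreviation subalgebra_gen :: "'a::calgebra_1 set \<Rightarrow> 'a set"
  where "subalgebra_gen G \<equiv> subalgebra hull G"

lemma calg_homD:
  assumes "calg_hom f"
  shows "f 1 = 1" "f (x + y) = f x + f y" "f (x * y) = f x * f y" "f (c *\<^sub>C x) = c *\<^sub>C f x"
    "f 0 = 0" "f (- x) = - f x" "f (x - y) = f x - f y" "f (sum g A) = (\<Sum>a\<in>A. f (g a))"
proof -
  have add: "f (x + y) = f x + f y" for x y using assms by (simp add: calg_hom_def)
  then show "f (x + y) = f x + f y" .
  show z: "f 0 = 0" using add[of 0 0] by simp
  show "f (- x) = - f x" using add[of x "- x"] z by (simp add: eq_neg_iff_add_eq_0 add.commute)
  show "f (x - y) = f x - f y" using add[of "x - y" y] by (simp add: algebra_simps)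
  show "f (sum g A) = (\<Sum>a\<in>A. f (g a))"
    by (induction A rule: infinite_finite_induct) (simp_all add: z add)
qed (use assms in \<open>simp_all add: calg_hom_def\<close>)

lemma two_sided_ideal_ideal_gen: "two_sided_ideal (ideal_gen G)"
  by (rule hull_in) (auto simp: two_sided_ideal_def)

lemma subalgebra_subalgebra_gen: "subalgebra (subalgebra_gen G)"
  by (rule hull_in) (auto simp: subalgebra_def)

lemma subalgebra_closed:
  assumes "subalgebra S"
  shows "1 \<in> S" "0 \<in> S" "x \<in> S \<Longrightarrow> y \<in> S \<Longrightarrow> x + y \<in> S" "x \<in> S \<Longrightarrow> y \<in> S \<Longrightarrow> x * y \<in> S"
    "x \<in> S \<Longrightarrow> - x \<in> S" "x \<in> S \<Longrightarrow> y \<in> S \<Longrightarrow> x - y \<in> S" "x \<in> S \<Longrightarrow> c *\<^sub>C x \<in> S"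
proof -
  have neg: "- x \<in> S" if "x \<in> S" for x
  proof -
    have "(- 1) *\<^sub>C x \<in> S" using assms that unfolding subalgebra_def by blast
    then show ?thesis by (metis cvec.scale_minus_left scaleC_one)
  qed
  then show "x \<in> S \<Longrightarrow> - x \<in> S" .
  have "0 *\<^sub>C (1 :: 'a) \<in> S" using assms unfolding subalgebra_def by blast
  then show "0 \<in> S" by simp
  show "x \<in> S \<Longrightarrow> y \<in> S \<Longrightarrow> x - y \<in> S"
    using assms neg[of y] unfolding subalgebra_def by (metis diff_conv_add_uminus)
qed (use assms in \<open>auto simp: subalgebra_def\<close>)

lemma ideal_closed:
  assumes "two_sided_ideal I"
  shows "0 \<in> I" "x \<in> I \<Longrightarrow> y \<in> I \<Longrightarrow> x + y \<in> I" "x \<in> I \<Longrightarrow> a * x \<in> I" "x \<in> I \<Longrightarrow> x * a \<in> I"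
    "x \<in> I \<Longrightarrow> - x \<in> I" "x \<in> I \<Longrightarrow> y \<in> I \<Longrightarrow> x - y \<in> I"
proof -
  have neg: "- x \<in> I" if "x \<in> I" for x
  proof -
    have "(- 1) * x \<in> I" using assms that unfolding two_sided_ideal_def by blast
    then show ?thesis by simp
  qed
  then show "x \<in> I \<Longrightarrow> - x \<in> I" .
  show "x \<in> I \<Longrightarrow> y \<in> I \<Longrightarrow> x - y \<in> I"
    using assms neg[of y] unfolding two_sided_ideal_def by (metis diff_conv_add_uminus)
qed (use assms in \<open>auto simp: two_sided_ideal_def\<close>)

lemma ideal_equivp:
  assumes "two_sided_ideal I"
  shows "equivp (\<lambda>x y. x - y \<in> I)"
proof (rule equivpI)
  show "reflp (\<lambda>x y. x - y \<in> I)" using ideal_closed(1)[OF assms] by (simp add: reflp_def)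
  show "symp (\<lambda>x y. x - y \<in> I)"
    using ideal_closed(5)[OF assms] by (metis minus_diff_eq sympI)
  show "transp (\<lambda>x y. x - y \<in> I)"
  proof (rule transpI)
    fix x y z assume "x - y \<in> I" "y - z \<in> I"
    then have "(x - y) + (y - z) \<in> I" by (rule ideal_closed(2)[OF assms])
    then show "x - z \<in> I" by simp
  qed
qed

lemma ideal_cong:
  assumes "two_sided_ideal I"
  shows "x - x' \<in> I \<Longrightarrow> y - y' \<in> I \<Longrightarrow> (x + y) - (x' + y') \<in> I"
    and "x - x' \<in> I \<Longrightarrow> y - y' \<in> I \<Longrightarrow> (x - y) - (x' - y') \<in> I"
    and "x - x' \<in> I \<Longrightarrow> - x - - x' \<in> I"
    and "x - x' \<in> I \<Longrightarrow> y - y' \<in> I \<Longrightarrow> x * y - x' * y' \<in> I"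
proof -
  note cl = ideal_closed[OF assms]
  show "x - x' \<in> I \<Longrightarrow> y - y' \<in> I \<Longrightarrow> (x + y) - (x' + y') \<in> I"
    using cl(2)[of "x - x'" "y - y'"] by (simp add: algebra_simps)
  show "x - x' \<in> I \<Longrightarrow> y - y' \<in> I \<Longrightarrow> (x - y) - (x' - y') \<in> I"
    using cl(6)[of "x - x'" "y - y'"] by (simp add: algebra_simps)
  show "x - x' \<in> I \<Longrightarrow> - x - - x' \<in> I"
    using cl(5)[of "x - x'"] by (simp add: algebra_simps)
  show "x - x' \<in> I \<Longrightarrow> y - y' \<in> I \<Longrightarrow> x * y - x' * y' \<in> I"
    using cl(2)[OF cl(4)[of "x - x'" y] cl(3)[of "y - y'" x']] by (simp add: algebra_simps)
qed

lemma ideal_cong_scaleC: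
  fixes I :: "'a::calgebra_1 set"
  assumes "two_sided_ideal I" "x - x' \<in> I"
  shows "c *\<^sub>C x - c *\<^sub>C x' \<in> I"
proof -
  have "(c *\<^sub>C 1) * (x - x') \<in> I" by (rule ideal_closed(3)[OF assms])
  then show ?thesis by (simp add: mult_scaleC_left cvec.scale_right_diff_distrib)
qed


section \<open>Monoid algebras and free algebras\<close>

typedef 'm monalg = "UNIV :: ('m \<Rightarrow>\<^sub>0 complex) set"
  morphisms coeffs_of Abs_monalg ..

setup_lifting type_definition_monalg

lemma poly_mapping_sum_single:
  "(\<Sum>k\<in>Poly_Mapping.keys p. Poly_Mapping.single k (Poly_Mapping.lookup p k)) = p"
  by (rule poly_mapping_eqI)
    (simp add: lookup_sum lookup_single when_def sum.delta' in_keys_iff)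

lemma single_0_commute:
  "p * Poly_Mapping.single 0 (c::complex) = Poly_Mapping.single 0 c * (p :: 'm::monoid_add \<Rightarrow>\<^sub>0 complex)"
proof -
  let ?q = "\<Sum>k\<in>Poly_Mapping.keys p. Poly_Mapping.single k (Poly_Mapping.lookup p k)"
  have "?q * Poly_Mapping.single 0 c = Poly_Mapping.single 0 c * ?q"
    by (simp add: sum_distrib_left sum_distrib_right mult_single mult.commute)
  then show ?thesis by (simp only: poly_mapping_sum_single)
qed

instantiation monalg :: (monoid_add) calgebra_1
begin

lift_definition zero_monalg :: "'a monalg" is 0 .
lift_definition one_monalg :: "'a monalg" is 1 .
lift_definition plus_monalg :: "'a monalg \<Rightarrow> 'a monalg \<Rightarrow> 'a monalg" is "(+)" .
lift_definition minus_monalg :: "'a monalg \<Rightarrow> 'a monalg \<Rightarrow> 'a monalg" is "(-)" .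
lift_definition uminus_monalg :: "'a monalg \<Rightarrow> 'a monalg" is uminus .
lift_definition times_monalg :: "'a monalg \<Rightarrow> 'a monalg \<Rightarrow> 'a monalg" is "(*)" .
lift_definition scaleC_monalg :: "complex \<Rightarrow> 'a monalg \<Rightarrow> 'a monalg"
  is "\<lambda>c p. Poly_Mapping.single 0 c * p" .

instance
proof
  fix c d :: complex and x y :: "'a monalg"
  show "(c + d) *\<^sub>C x = c *\<^sub>C x + d *\<^sub>C x"
    by transfer (simp add: single_add distrib_right)
  show "c *\<^sub>C d *\<^sub>C x = (c * d) *\<^sub>C x"
    by transfer (simp add: mult_single flip: mult.assoc)
  show "x * (c *\<^sub>C y) = c *\<^sub>C (x * y)"
    by transfer (metis mult.assoc single_0_commute)
qed (transfer; simp add: algebra_simps)+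

end

lift_definition monom_of :: "'m \<Rightarrow> 'm monalg" is "\<lambda>m. Poly_Mapping.single m 1" .

definition monalg_lift :: "('m \<Rightarrow> 'b::calgebra_1) \<Rightarrow> 'm monalg \<Rightarrow> 'b" where
  "monalg_lift f x =
     (\<Sum>m\<in>Poly_Mapping.keys (coeffs_of x). Poly_Mapping.lookup (coeffs_of x) m *\<^sub>C f m)"

lemma monalg_lift_superset:
  assumes "finite A" "Poly_Mapping.keys (coeffs_of x) \<subseteq> A"
  shows "monalg_lift f x = (\<Sum>m\<in>A. Poly_Mapping.lookup (coeffs_of x) m *\<^sub>C f m)"
  unfolding monalg_lift_def by (rule sum.mono_neutral_left) (use assms in \<open>auto simp: in_keys_iff\<close>)

lemma monalg_lift_add: "monalg_lift f (x + y) = monalg_lift f x + monalg_lift f y"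
proof -
  let ?A = "Poly_Mapping.keys (coeffs_of x) \<union> Poly_Mapping.keys (coeffs_of y)"
  have "Poly_Mapping.keys (coeffs_of (x + y)) \<subseteq> ?A"
    by (simp add: plus_monalg.rep_eq keys_add)
  then show ?thesis
    by (simp add: monalg_lift_superset[of ?A] plus_monalg.rep_eq lookup_add scaleC_add_left sum.distrib)
qed

lemma monom_of_zero: "monom_of 0 = 1"
  by transfer simp

lemma monom_of_add: "monom_of (m + n) = monom_of m * monom_of n"
  by transfer (simp add: mult_single)

lemma coeffs_of_scaleC_monom: "coeffs_of (c *\<^sub>C monom_of m) = Poly_Mapping.single m c"
  by (simp add: scaleC_monalg.rep_eq monom_of.rep_eq mult_single)

lemma monalg_lift_scaleC_monom: "monalg_lift f (c *\<^sub>C monom_of m) = c *\<^sub>C f m"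
  by (subst monalg_lift_superset[of "{m}"]) (auto simp: coeffs_of_scaleC_monom)

lemma coeffs_of_sum: "coeffs_of (sum g A) = (\<Sum>a\<in>A. coeffs_of (g a))"
  by (induction A rule: infinite_finite_induct) (simp_all add: zero_monalg.rep_eq plus_monalg.rep_eq)

lemma monalg_expand:
  "(\<Sum>m\<in>Poly_Mapping.keys (coeffs_of x). Poly_Mapping.lookup (coeffs_of x) m *\<^sub>C monom_of m) = x"
  unfolding coeffs_of_inject[symmetric] coeffs_of_sum coeffs_of_scaleC_monom
  by (rule poly_mapping_sum_single)

lemma monalg_lift_zero: "monalg_lift f 0 = 0"
  by (simp add: monalg_lift_def zero_monalg.rep_eq)

lemma monalg_lift_sum: "monalg_lift f (sum g A) = (\<Sum>a\<in>A. monalg_lift f (g a))"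
  by (induction A rule: infinite_finite_induct) (simp_all add: monalg_lift_zero monalg_lift_add)

lemma monalg_lift_monom: "monalg_lift f (monom_of (m::'m::monoid_add)) = f m"
  using monalg_lift_scaleC_monom[of f 1 m] by (simp only: scaleC_one)

lemma monalg_lift_scaleC: "monalg_lift f (c *\<^sub>C x) = c *\<^sub>C monalg_lift f x"
proof -
  have 1: "monalg_lift f (c *\<^sub>C d *\<^sub>C monom_of m) = c *\<^sub>C d *\<^sub>C f m" for d m
    by (simp only: scaleC_scaleC monalg_lift_scaleC_monom)
  have "monalg_lift f (c *\<^sub>C x) = monalg_lift f (c *\<^sub>C
      (\<Sum>m\<in>Poly_Mapping.keys (coeffs_of x). Poly_Mapping.lookup (coeffs_of x) m *\<^sub>C monom_of m))"
    by (simp only: monalg_expand)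
  also have "\<dots> = c *\<^sub>C monalg_lift f x"
    unfolding cvec.scale_sum_right monalg_lift_sum 1 monalg_lift_def[of f x] ..
  finally show ?thesis .
qed

lemma monalg_lift_mult:
  fixes f :: "'m::monoid_add \<Rightarrow> 'b::calgebra_1"
  assumes "\<And>m n. f (m + n) = f m * f n"
  shows "monalg_lift f (x * y) = monalg_lift f x * monalg_lift f y"
proof -
  have 1: "monalg_lift f ((c *\<^sub>C monom_of m) * (d *\<^sub>C monom_of n)) = (c *\<^sub>C f m) * (d *\<^sub>C f n)"
    for c d m n
    by (simp only: mult_scaleC_left mult_scaleC_right monalg_lift_scaleC monom_of_add[symmetric]
        monalg_lift_monom assms)
  have "monalg_lift f (x * y) = monalg_lift f
     ((\<Sum>m\<in>Poly_Mapping.keys (coeffs_of x). Poly_Mapping.lookup (coeffs_of x) m *\<^sub>C monom_of m) *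
      (\<Sum>m\<in>Poly_Mapping.keys (coeffs_of y). Poly_Mapping.lookup (coeffs_of y) m *\<^sub>C monom_of m))"
    by (simp only: monalg_expand)
  also have "\<dots> = monalg_lift f x * monalg_lift f y"
    unfolding sum_distrib_left sum_distrib_right monalg_lift_sum 1 monalg_lift_def[of f x]
      monalg_lift_def[of f y] ..
  finally show ?thesis .
qed

lemma calg_hom_monalg_lift:
  fixes f :: "'m::monoid_add \<Rightarrow> 'b::calgebra_1"
  assumes "f 0 = 1" "\<And>m n. f (m + n) = f m * f n"
  shows "calg_hom (monalg_lift f)"
  using assms monalg_lift_monom[of f 0]
  by (simp add: calg_hom_def monalg_lift_add monalg_lift_scaleC monalg_lift_mult monom_of_zero)


datatype 'g word = Word (letters: "'g list")

instantiation word :: (type) monoid_add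
begin

definition zero_word :: "'a word" where "0 = Word []"
definition plus_word :: "'a word \<Rightarrow> 'a word \<Rightarrow> 'a word"
  where "v + w = Word (letters v @ letters w)"

instance
  by standard (simp_all add: zero_word_def plus_word_def)

end

type_synonym 'g free_alg = "'g word monalg"

definition free_gen :: "'g \<Rightarrow> 'g free_alg"
  where "free_gen g = monom_of (Word [g])"

definition free_lift :: "('g \<Rightarrow> 'b::calgebra_1) \<Rightarrow> 'g free_alg \<Rightarrow> 'b"
  where "free_lift f = monalg_lift (\<lambda>w. prod_list (map f (letters w)))"

lemma calg_hom_free_lift: "calg_hom (free_lift f)"
  unfolding free_lift_def by (rule calg_hom_monalg_lift) (simp_all add: zero_word_def plus_word_def)

lemma free_lift_gen: "free_lift f (free_gen g) = f g"
  unfolding free_lift_def free_gen_def by (simp add: monalg_lift_monom)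


section \<open>Tensor products of algebras\<close>

datatype ('a, 'b) pure = Pure 'a 'b

instantiation pure :: (monoid_mult, monoid_mult) monoid_add
begin

definition zero_pure :: "('a, 'b) pure" where "0 = Pure 1 1"
fun plus_pure :: "('a, 'b) pure \<Rightarrow> ('a, 'b) pure \<Rightarrow> ('a, 'b) pure"
  where "plus_pure (Pure a b) (Pure a' b') = Pure (a * a') (b * b')"

instance
proof
  fix x y z :: "('a, 'b) pure"
  show "x + y + z = x + (y + z)" by (cases x; cases y; cases z) (simp add: mult.assoc)
  show "0 + x = x" by (cases x) (simp add: zero_pure_def)
  show "x + 0 = x" by (cases x) (simp add: zero_pure_def)
qed

end

inductive_set bilinear_relators :: "('a::calgebra_1, 'b::calgebra_1) pure monalg set" where
  "monom_of (Pure (a + a') b) - (monom_of (Pure a b) + monom_of (Pure a' b)) \<in> bilinear_relators"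
| "monom_of (Pure a (b + b')) - (monom_of (Pure a b) + monom_of (Pure a b')) \<in> bilinear_relators"
| "monom_of (Pure (c *\<^sub>C a) b) - c *\<^sub>C monom_of (Pure a b) \<in> bilinear_relators"
| "monom_of (Pure a (c *\<^sub>C b)) - c *\<^sub>C monom_of (Pure a b) \<in> bilinear_relators"

text \<open>
  As a vector space, the monoid algebra of the multiplicative monoid \<open>A \<times> B\<close> is free on the set
  \<open>A \<times> B\<close>.  A bilinearity relator multiplied by a monomial is again a bilinearity relator, so the
  ideal below is just the linear span of the relators, and the quotient is the usual tensor product
  of vector spaces with \<open>(a \<otimes> b) (a' \<otimes> b') = a a' \<otimes> b b'\<close>.
\<close>

quotient_type (overloaded) ('a, 'b) tensor = "('a::calgebra_1, 'b::calgebra_1) pure monalg" /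
    "\<lambda>x y. x - y \<in> ideal_gen bilinear_relators"
  by (rule ideal_equivp[OF two_sided_ideal_ideal_gen])

lemma linear_functional_one:
  obtains f :: "'a::calgebra_1 \<Rightarrow> complex"
  where "f 1 = 1" "\<And>x y. f (x + y) = f x + f y" "\<And>c x. f (c *\<^sub>C x) = c * f x"
proof -
  interpret vector_space_pair "scaleC :: complex \<Rightarrow> 'a \<Rightarrow> 'a" "scaleC :: complex \<Rightarrow> complex \<Rightarrow> complex" ..
  have "\<not> cvec.dependent {1 :: 'a}" by (simp add: cvec.dependent_single)
  then obtain g :: "'a \<Rightarrow> complex" where "Vector_Spaces.linear scaleC scaleC g" "\<forall>x\<in>{1}. g x = 1"
    using linear_independent_extend[of "{1}" "\<lambda>_. 1"] by blast
  then have "g 1 = 1" "g (x + y) = g x + g y" "g (c *\<^sub>C x) = c * g x" for x y c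
    by (auto simp: Vector_Spaces.linear_iff scaleC_complex_def)
  then show thesis by (rule that)
qed

lemma one_notin_bilinear_ideal:
  "1 \<notin> ideal_gen (bilinear_relators :: ('a::calgebra_1, 'b::calgebra_1) pure monalg set)"
proof
  obtain f :: "'a \<Rightarrow> complex" where f: "f 1 = 1" "\<And>x y. f (x + y) = f x + f y" "\<And>c x. f (c *\<^sub>C x) = c * f x"
    using linear_functional_one by blast
  obtain g :: "'b \<Rightarrow> complex" where g: "g 1 = 1" "\<And>x y. g (x + y) = g x + g y" "\<And>c x. g (c *\<^sub>C x) = c * g x"
    using linear_functional_one by blast
  define F where "F = monalg_lift (\<lambda>p. case p of Pure a b \<Rightarrow> f a * g b)"
  note lift = monalg_lift_add monalg_lift_scaleC monalg_lift_sum monalg_lift_zero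
  have F_minus: "F (x - y) = F x - F y" for x y
    using monalg_lift_add[of "\<lambda>p. case p of Pure a b \<Rightarrow> f a * g b" "x - y" y] by (simp add: F_def)
  have F_monom: "F (monom_of (Pure a b)) = f a * g b" for a b
    by (simp add: F_def monalg_lift_monom)
  define J where "J = {x. \<forall>u w. F (u * x * w) = 0}"
  have "two_sided_ideal J"
    unfolding two_sided_ideal_def J_def
    by (auto simp: F_def lift algebra_simps) (simp_all flip: mult.assoc)
  moreover have "bilinear_relators \<subseteq> J"
  proof
    fix r :: "('a, 'b) pure monalg" assume r: "r \<in> bilinear_relators"
    have distr: "m * (x - (y + z)) * n = m * x * n - (m * y * n + m * z * n)"
      "m * (x - c *\<^sub>C y) * n = m * x * n - c *\<^sub>C (m * y * n)"
      for m n x y z :: "('a, 'b) pure monalg" and c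
      by (simp_all add: left_diff_distrib right_diff_distrib distrib_left distrib_right
          mult_scaleC_left mult_scaleC_right)
    have F_lin: "F (x + y) = F x + F y" "F (c *\<^sub>C x) = c * F x" for x y c
      by (simp_all add: F_def lift scaleC_complex_def)
    have mon: "F (monom_of p * r * monom_of q) = 0" for p q
      using r
      by (cases p; cases q; elim bilinear_relators.cases; hypsubst_thin)
        (simp_all only: distr monom_of_add[symmetric] plus_pure.simps F_minus F_lin F_monom,
         simp_all add: distrib_left distrib_right mult_scaleC_left mult_scaleC_right f g)
    have "F (u * r * w) = 0" for u w
    proof -
      have 1: "F ((c *\<^sub>C monom_of p) * r * (d *\<^sub>C monom_of q)) = 0" for c d p q
        using mon[of p q] by (simp add: mult_scaleC_left mult_scaleC_right F_def lift)
      have "F (u * r * w) = F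
          ((\<Sum>m\<in>Poly_Mapping.keys (coeffs_of u). Poly_Mapping.lookup (coeffs_of u) m *\<^sub>C monom_of m) * r *
           (\<Sum>m\<in>Poly_Mapping.keys (coeffs_of w). Poly_Mapping.lookup (coeffs_of w) m *\<^sub>C monom_of m))"
        by (simp only: monalg_expand)
      also have "\<dots> = 0"
        unfolding sum_distrib_left sum_distrib_right F_def lift 1[unfolded F_def] by simp
      finally show ?thesis .
    qed
    then show "r \<in> J" by (simp add: J_def)
  qed
  ultimately have "ideal_gen bilinear_relators \<subseteq> J" by (intro hull_minimal)
  moreover assume "1 \<in> ideal_gen (bilinear_relators :: ('a, 'b) pure monalg set)"
  ultimately have "F (1 * 1 * 1) = 0" unfolding J_def by blast
  moreover have "F 1 = 1"
    using F_monom[of 1 1] f(1) g(1) by (simp add: monom_of_zero flip: zero_pure_def)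
  ultimately show False by simp
qed

instantiation tensor :: (calgebra_1, calgebra_1) calgebra_1
begin

lift_definition zero_tensor :: "('a, 'b) tensor" is 0 .
lift_definition one_tensor :: "('a, 'b) tensor" is 1 .
lift_definition plus_tensor :: "('a, 'b) tensor \<Rightarrow> ('a, 'b) tensor \<Rightarrow> ('a, 'b) tensor" is "(+)"
  by (rule ideal_cong[OF two_sided_ideal_ideal_gen])
lift_definition minus_tensor :: "('a, 'b) tensor \<Rightarrow> ('a, 'b) tensor \<Rightarrow> ('a, 'b) tensor" is "(-)"
  by (rule ideal_cong[OF two_sided_ideal_ideal_gen])
lift_definition uminus_tensor :: "('a, 'b) tensor \<Rightarrow> ('a, 'b) tensor" is uminus
  by (rule ideal_cong[OF two_sided_ideal_ideal_gen])
lift_definition times_tensor :: "('a, 'b) tensor \<Rightarrow> ('a, 'b) tensor \<Rightarrow> ('a, 'b) tensor" is "(*)"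
  by (rule ideal_cong[OF two_sided_ideal_ideal_gen])
lift_definition scaleC_tensor :: "complex \<Rightarrow> ('a, 'b) tensor \<Rightarrow> ('a, 'b) tensor" is "(*\<^sub>C)"
  by (rule ideal_cong_scaleC[OF two_sided_ideal_ideal_gen])

instance
proof
  show "(0 :: ('a, 'b) tensor) \<noteq> 1"
    by transfer (use one_notin_bilinear_ideal ideal_closed(5)[OF two_sided_ideal_ideal_gen] in fastforce)
qed (transfer; simp add: algebra_simps scaleC_add_right scaleC_add_left scaleC_scaleC scaleC_one
      mult_scaleC_left mult_scaleC_right ideal_closed(1)[OF two_sided_ideal_ideal_gen])+

end

lift_definition tens :: "'a::calgebra_1 \<Rightarrow> 'b::calgebra_1 \<Rightarrow> ('a, 'b) tensor"  (infixl \<open>\<otimes>\<close> 75)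
  is "\<lambda>a b. monom_of (Pure a b)" .

lemma tens_simps:
  "(a + a') \<otimes> b = a \<otimes> b + a' \<otimes> b" "a \<otimes> (b + b') = a \<otimes> b + a \<otimes> b'"
  "(c *\<^sub>C a) \<otimes> b = c *\<^sub>C (a \<otimes> b)" "a \<otimes> (c *\<^sub>C b) = c *\<^sub>C (a \<otimes> b)"
  "(a \<otimes> b) * (a' \<otimes> b') = (a * a') \<otimes> (b * b')"
proof -
  show "(a + a') \<otimes> b = a \<otimes> b + a' \<otimes> b" by transfer (rule hull_inc, rule bilinear_relators.intros)
  show "a \<otimes> (b + b') = a \<otimes> b + a \<otimes> b'" by transfer (rule hull_inc, rule bilinear_relators.intros)
  show "(c *\<^sub>C a) \<otimes> b = c *\<^sub>C (a \<otimes> b)" by transfer (rule hull_inc, rule bilinear_relators.intros)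
  show "a \<otimes> (c *\<^sub>C b) = c *\<^sub>C (a \<otimes> b)" by transfer (rule hull_inc, rule bilinear_relators.intros)
  show "(a \<otimes> b) * (a' \<otimes> b') = (a * a') \<otimes> (b * b')"
    by transfer (simp add: ideal_closed(1)[OF two_sided_ideal_ideal_gen] flip: monom_of_add)
qed

lemma tens_one: "1 \<otimes> 1 = 1"
  by transfer (simp add: ideal_closed(1)[OF two_sided_ideal_ideal_gen] monom_of_zero flip: zero_pure_def)

text \<open>
  The map \<open>f \<otimes> g\<close>, computed on a representative; it does not depend on the representative if
  \<open>f\<close> and \<open>g\<close> are algebra homomorphisms, see \<open>tensor_map_tens\<close>.
\<close>

definition tensor_map :: "('a::calgebra_1 \<Rightarrow> 'c::calgebra_1) \<Rightarrow> ('b::calgebra_1 \<Rightarrow> 'd::calgebra_1) \<Rightarrow>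
    ('a, 'b) tensor \<Rightarrow> ('c, 'd) tensor" where
  "tensor_map f g t = monalg_lift (\<lambda>p. case p of Pure a b \<Rightarrow> f a \<otimes> g b) (rep_tensor t)"

lemma
  fixes f :: "'a::calgebra_1 \<Rightarrow> 'c::calgebra_1" and g :: "'b::calgebra_1 \<Rightarrow> 'd::calgebra_1"
  assumes f: "calg_hom f" and g: "calg_hom g"
  shows calg_hom_tensor_map: "calg_hom (tensor_map f g)"
    and tensor_map_tens: "tensor_map f g (a \<otimes> b) = f a \<otimes> g b"
proof -
  define H where "H = monalg_lift (\<lambda>p. case p of Pure a b \<Rightarrow> f a \<otimes> g b)"
  have H: "calg_hom H"
    unfolding H_def
  proof (rule calg_hom_monalg_lift)
    fix m n show "(case m + n of Pure a b \<Rightarrow> f a \<otimes> g b) =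
        (case m of Pure a b \<Rightarrow> f a \<otimes> g b) * (case n of Pure a b \<Rightarrow> f a \<otimes> g b)"
      by (cases m; cases n) (simp add: calg_homD[OF f] calg_homD[OF g] tens_simps)
  qed (simp add: zero_pure_def calg_homD[OF f] calg_homD[OF g] tens_one)
  have "bilinear_relators \<subseteq> {x. H x = 0}"
  proof
    fix x assume "x \<in> (bilinear_relators :: ('a, 'b) pure monalg set)"
    then show "x \<in> {x. H x = 0}"
      by cases (simp_all only: calg_homD[OF H] mem_Collect_eq, simp_all add: H_def monalg_lift_monom
          calg_homD[OF f] calg_homD[OF g] tens_simps)
  qed
  moreover have "two_sided_ideal {x. H x = 0}"
    by (simp add: two_sided_ideal_def calg_homD[OF H])
  ultimately have "ideal_gen bilinear_relators \<subseteq> {x. H x = 0}" by (intro hull_minimal)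
  then have resp: "H x = H y" if "x - y \<in> ideal_gen bilinear_relators" for x y
    using that calg_homD(7)[OF H, of x y] by auto
  have tm: "tensor_map f g (abs_tensor x) = H x" for x
  proof -
    have "rep_tensor (abs_tensor x) - x \<in> ideal_gen bilinear_relators"
      using Quotient3_rep_abs[OF Quotient3_tensor, where r = x] ideal_closed(1)[OF two_sided_ideal_ideal_gen]
      by auto
    then show ?thesis unfolding tensor_map_def H_def[symmetric] by (rule resp)
  qed
  show "tensor_map f g (a \<otimes> b) = f a \<otimes> g b"
    unfolding tens.abs_eq[of a b] tm by (simp add: H_def monalg_lift_monom)
  have ex: "\<exists>p. x = abs_tensor p" for x :: "('a, 'b) tensor"
    by (metis Quotient3_abs_rep[OF Quotient3_tensor])
  show "calg_hom (tensor_map f g)"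
    unfolding calg_hom_def
  proof (intro conjI allI)
    show "tensor_map f g 1 = 1" by (simp add: one_tensor.abs_eq tm calg_homD[OF H])
    fix x y :: "('a, 'b) tensor" and c
    obtain p q where [simp]: "x = abs_tensor p" "y = abs_tensor q"
      using ex[of x] ex[of y] by blast
    show "tensor_map f g (x + y) = tensor_map f g x + tensor_map f g y"
      by (simp add: plus_tensor.abs_eq tm calg_homD[OF H])
    show "tensor_map f g (x * y) = tensor_map f g x * tensor_map f g y"
      by (simp add: times_tensor.abs_eq tm calg_homD[OF H])
    show "tensor_map f g (c *\<^sub>C x) = c *\<^sub>C tensor_map f g x"
      by (simp add: scaleC_tensor.abs_eq tm calg_homD[OF H])
  qed
qed


section \<open>Matrices and formal series\<close>

definition unit_matrix :: "'m \<Rightarrow> 'n \<Rightarrow> 'a::zero_neq_one^'n^'m" where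
  "unit_matrix i j = (\<chi> a b. if a = i \<and> b = j then 1 else 0)"

definition kron :: "'a::times^'n^'m \<Rightarrow> 'a^'q^'p \<Rightarrow> 'a^('n \<times> 'q)^('m \<times> 'p)" where
  "kron A B = (\<chi> p q. A $ fst p $ fst q * B $ snd p $ snd q)"

definition flip_matrix :: "'a::semiring_1^('i::finite \<times> 'i)^('i \<times> 'i)" where
  "flip_matrix = (\<Sum>i\<in>UNIV. \<Sum>j\<in>UNIV. kron (unit_matrix i j) (unit_matrix j i))"

definition fps_map :: "('a \<Rightarrow> 'b) \<Rightarrow> 'a fps \<Rightarrow> 'b fps" where
  "fps_map h f = Abs_fps (\<lambda>n. h (fps_nth f n))"

text \<open>Only used for maps \<open>h\<close> with \<open>h 0 = 0\<close>.\<close>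
definition fls_map :: "('a::zero \<Rightarrow> 'b::zero) \<Rightarrow> 'a fls \<Rightarrow> 'b fls" where
  "fls_map h f = Abs_fls (\<lambda>n. h (f $$ n))"

text \<open>
  An \<open>'a fps\<close> stands for a power series in \<open>u\<^sup>-\<^sup>1\<close>: its \<open>n\<close>-th coefficient belongs to \<open>u\<^sup>-\<^sup>n\<close>.  Hence
  \<open>f (\<alpha> u + \<beta>)\<close>, for \<open>\<alpha> \<noteq> 0\<close>, is obtained by replacing \<open>x = u\<^sup>-\<^sup>1\<close> with
  \<open>(\<alpha> u + \<beta>)\<^sup>-\<^sup>1 = x / (\<alpha> + \<beta> x)\<close>.
\<close>
definition at_affine :: "complex \<Rightarrow> complex \<Rightarrow> 'a::calgebra_1 fps \<Rightarrow> 'a fps" where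
  "at_affine \<alpha> \<beta> f = Abs_fps (\<lambda>n. \<Sum>i\<le>n.
     fps_nth ((fps_X / (fps_const \<alpha> + fps_const \<beta> * fps_X)) ^ i) n *\<^sub>C fps_nth f i)"

text \<open>
  Series in two variables \<open>u, v\<close> are elements of \<open>'a fls fls\<close>, the outer variable being \<open>u\<^sup>-\<^sup>1\<close> and
  the inner one \<open>v\<^sup>-\<^sup>1\<close>.  Since \<open>complex fls fls\<close> is a field containing \<open>u\<close> and \<open>v\<close>, rational functions
  of \<open>u - v\<close> make sense in it (they get expanded at \<open>\<bar>u\<bar> > \<bar>v\<bar>\<close>), and \<open>lift_scalar\<close> carries them over
  to any algebra.
\<close>
definition var_u :: "complex fls fls" where "var_u = fls_X_inv"
definition var_v :: "complex fls fls" where "var_v = fls_const fls_X_inv"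

definition lift_scalar :: "complex fls fls \<Rightarrow> 'a::calgebra_1 fls fls" where
  "lift_scalar = fls_map (fls_map (\<lambda>c. c *\<^sub>C 1))"

definition in_u :: "'a::zero fps \<Rightarrow> 'a fls fls" where
  "in_u f = fps_to_fls (fps_map fls_const f)"

definition in_v :: "'a::zero fps \<Rightarrow> 'a fls fls" where
  "in_v f = fls_const (fps_to_fls f)"

text \<open>
  The difference of the two sides of \<open>R(u - v) T\<^sub>1(u) T\<^sub>2(v) = T\<^sub>2(v) T\<^sub>1(u) R(u - v)\<close>.
\<close>
definition rtt_defect ::
    "(complex fls fls \<Rightarrow> complex fls fls^('i \<times> 'i)^('i \<times> 'i)) \<Rightarrow> 'a::calgebra_1 fps^'i^'i \<Rightarrow>
     'a fls fls^('i::finite \<times> 'i)^('i \<times> 'i)" where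
  "rtt_defect R T =
    (let R\<^sub>u\<^sub>v = map_matrix lift_scalar (R (var_u - var_v));
         T\<^sub>1 = kron (map_matrix in_u T) (mat 1);
         T\<^sub>2 = kron (mat 1) (map_matrix in_v T)
     in R\<^sub>u\<^sub>v ** T\<^sub>1 ** T\<^sub>2 - T\<^sub>2 ** T\<^sub>1 ** R\<^sub>u\<^sub>v)"

text \<open>
  The generator \<open>(i, j, r)\<close> is the coefficient of \<open>u\<^sup>-\<^sup>r\<^sup>-\<^sup>1\<close> in \<open>t\<^sub>i\<^sub>j(u)\<close>.
\<close>
definition free_T :: "('i \<times> 'i \<times> nat) free_alg fps^'i^'i" where
  "free_T = (\<chi> i j. Abs_fps (\<lambda>n. case n of 0 \<Rightarrow> if i = j then 1 else 0 | Suc r \<Rightarrow> free_gen (i, j, r)))"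

definition rtt_relators ::
    "(complex fls fls \<Rightarrow> complex fls fls^('i::finite \<times> 'i)^('i \<times> 'i)) \<Rightarrow> ('i \<times> 'i \<times> nat) free_alg set" where
  "rtt_relators R = {rtt_defect R free_T $ p $ q $$ a $$ b |p q a b. True}"

lemma fps_map_nth [simp]: "fps_nth (fps_map h f) n = h (fps_nth f n)"
  by (simp add: fps_map_def)

lemma fls_map_nth [simp]:
  assumes "h 0 = 0"
  shows "fls_map h f $$ n = h (f $$ n)"
proof -
  have "\<forall>\<^sub>\<infinity>n::nat. h (f $$ (- int n)) = 0"
    using MOST_fls_neg_nth_eq_0[of f] by (rule MOST_mono) (simp add: assms)
  then show ?thesis by (simp add: fls_map_def Abs_fls_inverse)
qed

definition unital_ring_hom :: "('a::ring_1 \<Rightarrow> 'b::ring_1) \<Rightarrow> bool" where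
  "unital_ring_hom h \<longleftrightarrow> h 1 = 1 \<and> (\<forall>x y. h (x + y) = h x + h y) \<and> (\<forall>x y. h (x * y) = h x * h y)"

lemma unital_ring_homD:
  assumes "unital_ring_hom h"
  shows "h 1 = 1" "h (x + y) = h x + h y" "h (x * y) = h x * h y" "h 0 = 0" "h (x - y) = h x - h y"
    "h (sum g A) = (\<Sum>a\<in>A. h (g a))"
proof -
  have add: "h (x + y) = h x + h y" for x y using assms by (simp add: unital_ring_hom_def)
  then show "h (x + y) = h x + h y" .
  show z: "h 0 = 0" using add[of 0 0] by simp
  show "h (x - y) = h x - h y" using add[of "x - y" y] by (simp add: algebra_simps)
  show "h (sum g A) = (\<Sum>a\<in>A. h (g a))"
    by (induction A rule: infinite_finite_induct) (simp_all add: z add)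
qed (use assms in \<open>simp_all add: unital_ring_hom_def\<close>)

lemma fls_times_nth_wide:
  fixes f g :: "'a::semiring_0 fls"
  assumes "a \<le> fls_subdegree f" "b \<le> fls_subdegree g"
  shows "(f * g) $$ n = (\<Sum>i=a..n - b. f $$ i * g $$ (n - i))"
  unfolding fls_times_nth(2)
  by (rule sum.mono_neutral_left) (use assms in \<open>auto simp: not_le\<close>)

lemma unital_ring_hom_fls_map:
  assumes "unital_ring_hom h"
  shows "unital_ring_hom (fls_map h)"
proof -
  note h = unital_ring_homD[OF assms]
  have "fls_map h (f * g) = fls_map h f * fls_map h g" for f g
  proof (rule fls_eqI)
    fix n
    define a where "a = min (fls_subdegree f) (fls_subdegree (fls_map h f))"
    define b where "b = min (fls_subdegree g) (fls_subdegree (fls_map h g))"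
    show "fls_map h (f * g) $$ n = (fls_map h f * fls_map h g) $$ n"
      using fls_times_nth_wide[of a f b g n] fls_times_nth_wide[of a "fls_map h f" b "fls_map h g" n]
      by (simp add: a_def b_def h)
  qed
  then show ?thesis
    by (auto simp: unital_ring_hom_def h intro!: fls_eqI)
qed

lemma map_matrix_mult:
  assumes "unital_ring_hom h"
  shows "map_matrix h (A ** B) = map_matrix h A ** map_matrix h B"
  by (simp add: vec_eq_iff matrix_matrix_mult_def unital_ring_homD[OF assms])

lemma map_matrix_kron:
  assumes "unital_ring_hom h"
  shows "map_matrix h (kron A B) = kron (map_matrix h A) (map_matrix h B)"
  by (simp add: vec_eq_iff kron_def unital_ring_homD[OF assms])

lemma map_matrix_mat_1:
  assumes "unital_ring_hom h"
  shows "map_matrix h (mat 1) = mat 1"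
  by (simp add: vec_eq_iff mat_def unital_ring_homD[OF assms])

lemma rtt_defect_hom:
  assumes "calg_hom h"
  shows "map_matrix (fls_map (fls_map h)) (rtt_defect R T) = rtt_defect R (map_matrix (fps_map h) T)"
proof -
  note h = calg_homD[OF assms]
  have "unital_ring_hom h" using assms by (simp add: calg_hom_def unital_ring_hom_def)
  then have uh: "unital_ring_hom (fls_map h)" and u: "unital_ring_hom (fls_map (fls_map h))"
    by (simp_all add: unital_ring_hom_fls_map)
  have m: "map_matrix (fls_map (fls_map h)) (A - B) =
      map_matrix (fls_map (fls_map h)) A - map_matrix (fls_map (fls_map h)) B"
    for A B :: "'a fls fls^'k^'l"
    by (simp add: vec_eq_iff unital_ring_homD[OF u])
  have z: "fls_map h 0 = 0" by (rule unital_ring_homD[OF uh])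
  have z': "fls_map (\<lambda>c. c *\<^sub>C (1 :: 'd)) 0 = (0 :: 'd::calgebra_1 fls)" by (rule fls_eqI) simp
  have 1: "map_matrix (fls_map (fls_map h)) (map_matrix lift_scalar A) = map_matrix lift_scalar A"
    for A :: "complex fls fls^'k^'l"
    by (auto simp: vec_eq_iff lift_scalar_def h z z' intro!: fls_eqI)
  have 2: "map_matrix (fls_map (fls_map h)) (map_matrix in_u T) = map_matrix in_u (map_matrix (fps_map h) T)"
    by (auto simp: vec_eq_iff in_u_def h z fps_to_fls_nth intro!: fls_eqI)
  have 3: "map_matrix (fls_map (fls_map h)) (map_matrix in_v T) = map_matrix in_v (map_matrix (fps_map h) T)"
    by (auto simp: vec_eq_iff in_v_def h z fps_to_fls_nth intro!: fls_eqI)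
  show ?thesis
    by (simp add: rtt_defect_def Let_def m map_matrix_mult[OF u] map_matrix_kron[OF u]
        map_matrix_mat_1[OF u] 1 2 3)
qed

lemma rtt_defect_mat_1: "rtt_defect R (mat 1 :: 'a::calgebra_1 fps^'i::finite^'i) = 0"
proof -
  have "kron (mat 1) (mat 1) = (mat 1 :: 'a fls fls^('i \<times> 'i)^('i \<times> 'i))"
    by (auto simp: vec_eq_iff kron_def mat_def)
  moreover have "fps_map fls_const 1 = (1 :: 'a fls fps)" "fps_map fls_const 0 = (0 :: 'a fls fps)"
    by (simp_all add: fps_eq_iff)
  then have "map_matrix in_u (mat 1) = (mat 1 :: 'a fls fls^'i^'i)"
    by (simp add: vec_eq_iff in_u_def mat_def)
  moreover have "map_matrix in_v (mat 1) = (mat 1 :: 'a fls fls^'i^'i)"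
    by (auto simp: vec_eq_iff in_v_def mat_def fps_to_fls_nth intro!: fls_eqI)
  ultimately show ?thesis by (simp add: rtt_defect_def Let_def)
qed

text \<open>Sending \<open>T(u)\<close> to the identity matrix is a homomorphism to \<open>\<complex>\<close>, so the quotients below are non-zero.\<close>

lemma counit_rtt_ideal:
  fixes R :: "complex fls fls \<Rightarrow> complex fls fls^('i::finite \<times> 'i)^('i \<times> 'i)"
  assumes "x \<in> ideal_gen (rtt_relators R)"
  shows "free_lift (\<lambda>_. 0) x = (0 :: complex)"
proof -
  let ?e = "free_lift (\<lambda>_. 0) :: ('i \<times> 'i \<times> nat) free_alg \<Rightarrow> complex"
  note e = calg_homD[OF calg_hom_free_lift[of "\<lambda>_. 0 :: complex"]]
  have T: "map_matrix (fps_map ?e) free_T = mat 1"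
    by (auto simp: vec_eq_iff free_T_def mat_def e free_lift_gen fps_eq_iff split: nat.split)
  have "?e (rtt_defect R free_T $ p $ q $$ a $$ b) = 0" for p q a b
  proof -
    have "fls_map ?e 0 = 0" by (rule fls_eqI) (simp add: e)
    then have "?e (rtt_defect R free_T $ p $ q $$ a $$ b) =
        map_matrix (fls_map (fls_map ?e)) (rtt_defect R free_T) $ p $ q $$ a $$ b"
      by (simp add: e)
    also have "\<dots> = 0"
      by (simp add: rtt_defect_hom[OF calg_hom_free_lift] T rtt_defect_mat_1)
    finally show ?thesis .
  qed
  then have "rtt_relators R \<subseteq> {x. ?e x = 0}" by (auto simp: rtt_relators_def)
  moreover have "two_sided_ideal {x. ?e x = 0}" by (simp add: two_sided_ideal_def e)
  ultimately show ?thesis using assms hull_minimal[of "rtt_relators R" "{x. ?e x = 0}"] by blast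
qed


lemma fps_map_hom:
  assumes "calg_hom h"
  shows "fps_map h 1 = 1" "fps_map h 0 = 0" "fps_map h (f + g) = fps_map h f + fps_map h g"
    "fps_map h (f - g) = fps_map h f - fps_map h g" "fps_map h (f * g) = fps_map h f * fps_map h g"
    "fps_map h (sum k A) = (\<Sum>a\<in>A. fps_map h (k a))"
    "fps_map h (at_affine \<alpha> \<beta> f) = at_affine \<alpha> \<beta> (fps_map h f)"
proof -
  note h = calg_homD[OF assms]
  show add: "fps_map h (f + g) = fps_map h f + fps_map h g" for f g by (simp add: fps_eq_iff h)
  show z: "fps_map h 0 = 0" by (simp add: fps_eq_iff h)
  show "fps_map h (sum k A) = (\<Sum>a\<in>A. fps_map h (k a))"
    by (induction A rule: infinite_finite_induct) (simp_all add: z add)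
qed (simp_all add: fps_eq_iff fps_mult_nth at_affine_def calg_homD[OF assms])

lemma at_affine_0_1:
  "at_affine \<alpha> \<beta> (0 :: 'a::calgebra_1 fps) = 0" "at_affine \<alpha> \<beta> (1 :: 'a fps) = 1"
proof -
  show "at_affine \<alpha> \<beta> (0 :: 'a fps) = 0" by (simp add: fps_eq_iff at_affine_def)
  have "fps_nth (at_affine \<alpha> \<beta> 1) n = fps_nth (1 :: 'a fps) n" for n
  proof -
    have "fps_nth (at_affine \<alpha> \<beta> 1) n = (\<Sum>i\<in>{0}.
        fps_nth ((fps_X / (fps_const \<alpha> + fps_const \<beta> * fps_X)) ^ i) n *\<^sub>C fps_nth 1 i :: 'a)"
      unfolding at_affine_def fps_nth_Abs_fps by (rule sum.mono_neutral_right) auto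
    also have "\<dots> = fps_nth (1 :: 'a fps) n" by (simp add: scaleC_one)
    finally show ?thesis .
  qed
  then show "at_affine \<alpha> \<beta> 1 = (1 :: 'a fps)" by (simp add: fps_eq_iff)
qed


section \<open>The Yangian of \<open>gl\<^sub>2\<close>\<close>

datatype ix2 = Neg | Pos  \<comment> \<open>the indices \<open>-1\<close> and \<open>1\<close>\<close>

instance ix2 :: finite
proof
  have "(UNIV :: ix2 set) \<subseteq> {Neg, Pos}" using ix2.exhaust by blast
  then show "finite (UNIV :: ix2 set)" by (rule finite_subset) simp
qed

primrec neg2 :: "ix2 \<Rightarrow> ix2" where "neg2 Neg = Pos" | "neg2 Pos = Neg"
primrec sign2 :: "ix2 \<Rightarrow> 'a::ring_1" where "sign2 Neg = - 1" | "sign2 Pos = 1"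

definition R_gl2 :: "complex fls fls \<Rightarrow> complex fls fls^(ix2 \<times> ix2)^(ix2 \<times> ix2)" where
  "R_gl2 w = mat 1 - mat (1 / w) ** flip_matrix"

text \<open>The linear extension of \<open>(E\<^sub>i\<^sub>j)\<^sup>t = sign(i) sign(j) E\<^sub>-\<^sub>j\<^sub>,\<^sub>-\<^sub>i\<close>.\<close>
definition transpose_minus :: "'a::ring_1^ix2^ix2 \<Rightarrow> 'a^ix2^ix2" where
  "transpose_minus M = (\<chi> a b. sign2 a * sign2 b * M $ neg2 b $ neg2 a)"

definition qdet :: "'a::calgebra_1 fps^ix2^ix2 \<Rightarrow> 'a fps" where
  "qdet T = at_affine 1 (- 1) (T $ Neg $ Neg) * T $ Pos $ Pos
          - at_affine 1 (- 1) (T $ Neg $ Pos) * T $ Pos $ Neg"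

definition S_minus :: "'a::calgebra_1 fps^ix2^ix2 \<Rightarrow> 'a fps^ix2^ix2" where
  "S_minus T = T ** transpose_minus (map_matrix (at_affine (- 1) 0) T)"

lemma S_minus_hom:
  assumes "calg_hom h"
  shows "map_matrix (fps_map h) (S_minus T) = S_minus (map_matrix (fps_map h) T)"
proof -
  note h = fps_map_hom[OF assms]
  have "fps_map h (- f) = - fps_map h f" for f using h(4)[of 0 f] h(2) by simp
  then have "fps_map h (sign2 a) = sign2 a" for a by (cases a) (simp_all add: h)
  then show ?thesis
    by (simp add: vec_eq_iff S_minus_def transpose_minus_def matrix_matrix_mult_def h)
qed

quotient_type y2 = "(ix2 \<times> ix2 \<times> nat) free_alg" / "\<lambda>x y. x - y \<in> ideal_gen (rtt_relators R_gl2)"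
  by (rule ideal_equivp[OF two_sided_ideal_ideal_gen])

lemma one_notin_rtt_ideal: "1 \<notin> ideal_gen (rtt_relators R)"
  using counit_rtt_ideal[of 1 R] by (auto simp: calg_homD(1)[OF calg_hom_free_lift])

instantiation y2 :: calgebra_1
begin

lift_definition zero_y2 :: y2 is 0 .
lift_definition one_y2 :: y2 is 1 .
lift_definition plus_y2 :: "y2 \<Rightarrow> y2 \<Rightarrow> y2" is "(+)"
  by (rule ideal_cong[OF two_sided_ideal_ideal_gen])
lift_definition minus_y2 :: "y2 \<Rightarrow> y2 \<Rightarrow> y2" is "(-)"
  by (rule ideal_cong[OF two_sided_ideal_ideal_gen])
lift_definition uminus_y2 :: "y2 \<Rightarrow> y2" is uminus
  by (rule ideal_cong[OF two_sided_ideal_ideal_gen])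
lift_definition times_y2 :: "y2 \<Rightarrow> y2 \<Rightarrow> y2" is "(*)"
  by (rule ideal_cong[OF two_sided_ideal_ideal_gen])
lift_definition scaleC_y2 :: "complex \<Rightarrow> y2 \<Rightarrow> y2" is "(*\<^sub>C)"
  by (rule ideal_cong_scaleC[OF two_sided_ideal_ideal_gen])

instance
proof
  show "(0 :: y2) \<noteq> 1"
    by transfer (use one_notin_rtt_ideal[of R_gl2] ideal_closed(5)[OF two_sided_ideal_ideal_gen] in fastforce)
qed (transfer; simp add: algebra_simps scaleC_add_right scaleC_add_left scaleC_scaleC scaleC_one
      mult_scaleC_left mult_scaleC_right ideal_closed(1)[OF two_sided_ideal_ideal_gen])+

end

lemma calg_hom_abs_y2: "calg_hom abs_y2"
  by (simp add: calg_hom_def one_y2.abs_eq plus_y2.abs_eq times_y2.abs_eq scaleC_y2.abs_eq)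

definition T_y2 :: "y2 fps^ix2^ix2" where
  "T_y2 = map_matrix (fps_map abs_y2) free_T"

quotient_type sy2 = y2 / "\<lambda>x y. x - y \<in> ideal_gen (range (fps_nth (qdet T_y2 - 1)))"
  by (rule ideal_equivp[OF two_sided_ideal_ideal_gen])

lemma one_notin_qdet_ideal: "1 \<notin> ideal_gen (range (fps_nth (qdet T_y2 - 1)))"
proof
  define e :: "y2 \<Rightarrow> complex" where "e = (\<lambda>x. free_lift (\<lambda>_. 0) (rep_y2 x))"
  note f = calg_homD[OF calg_hom_free_lift[of "\<lambda>_. 0 :: complex"]]
  have e_abs: "e (abs_y2 p) = free_lift (\<lambda>_. 0) p" for p
  proof -
    have "rep_y2 (abs_y2 p) - p \<in> ideal_gen (rtt_relators R_gl2)"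
      using Quotient3_rep_abs[OF Quotient3_y2, where r = p] ideal_closed(1)[OF two_sided_ideal_ideal_gen]
      by auto
    from counit_rtt_ideal[OF this] show ?thesis by (simp add: e_def f)
  qed
  have ex: "\<exists>p. x = abs_y2 p" for x by (metis Quotient3_abs_rep[OF Quotient3_y2])
  have hom: "calg_hom e"
    unfolding calg_hom_def
  proof (intro conjI allI)
    show "e 1 = 1" by (simp add: one_y2.abs_eq e_abs f)
    fix x y c
    obtain p q where [simp]: "x = abs_y2 p" "y = abs_y2 q" using ex[of x] ex[of y] by blast
    show "e (x + y) = e x + e y" by (simp add: plus_y2.abs_eq e_abs f)
    show "e (x * y) = e x * e y" by (simp add: times_y2.abs_eq e_abs f)
    show "e (c *\<^sub>C x) = c *\<^sub>C e x" by (simp add: scaleC_y2.abs_eq e_abs f)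
  qed
  note e = calg_homD[OF hom] fps_map_hom[OF hom]
  have "map_matrix (fps_map e) T_y2 = mat 1"
    by (auto simp: vec_eq_iff T_y2_def free_T_def mat_def e_abs f free_lift_gen fps_eq_iff
        split: nat.split)
  then have T: "fps_map e (T_y2 $ i $ j) = (if i = j then 1 else 0)" for i j
    by (auto simp: vec_eq_iff mat_def)
  have "fps_map e (qdet T_y2 - 1) = 0"
    by (simp add: qdet_def e T at_affine_0_1)
  then have "e (fps_nth (qdet T_y2 - 1) n) = 0" for n
    by (metis fps_map_nth fps_zero_nth)
  then have "range (fps_nth (qdet T_y2 - 1)) \<subseteq> {x. e x = 0}" by blast
  moreover have "two_sided_ideal {x. e x = 0}" by (simp add: two_sided_ideal_def e)
  ultimately have "ideal_gen (range (fps_nth (qdet T_y2 - 1))) \<subseteq> {x. e x = 0}"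
    by (rule hull_minimal)
  moreover assume "1 \<in> ideal_gen (range (fps_nth (qdet T_y2 - 1)))"
  ultimately show False by (auto simp: e)
qed

instantiation sy2 :: calgebra_1
begin

lift_definition zero_sy2 :: sy2 is 0 .
lift_definition one_sy2 :: sy2 is 1 .
lift_definition plus_sy2 :: "sy2 \<Rightarrow> sy2 \<Rightarrow> sy2" is "(+)"
  by (rule ideal_cong[OF two_sided_ideal_ideal_gen])
lift_definition minus_sy2 :: "sy2 \<Rightarrow> sy2 \<Rightarrow> sy2" is "(-)"
  by (rule ideal_cong[OF two_sided_ideal_ideal_gen])
lift_definition uminus_sy2 :: "sy2 \<Rightarrow> sy2" is uminus
  by (rule ideal_cong[OF two_sided_ideal_ideal_gen])
lift_definition times_sy2 :: "sy2 \<Rightarrow> sy2 \<Rightarrow> sy2" is "(*)"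
  by (rule ideal_cong[OF two_sided_ideal_ideal_gen])
lift_definition scaleC_sy2 :: "complex \<Rightarrow> sy2 \<Rightarrow> sy2" is "(*\<^sub>C)"
  by (rule ideal_cong_scaleC[OF two_sided_ideal_ideal_gen])

instance
proof
  show "(0 :: sy2) \<noteq> 1"
    by transfer (use one_notin_qdet_ideal ideal_closed(5)[OF two_sided_ideal_ideal_gen] in fastforce)
qed (transfer; simp add: algebra_simps scaleC_add_right scaleC_add_left scaleC_scaleC scaleC_one
      mult_scaleC_left mult_scaleC_right ideal_closed(1)[OF two_sided_ideal_ideal_gen])+

end

lemma calg_hom_abs_sy2: "calg_hom abs_sy2"
  by (simp add: calg_hom_def one_sy2.abs_eq plus_sy2.abs_eq times_sy2.abs_eq scaleC_sy2.abs_eq)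

definition T_sy2 :: "sy2 fps^ix2^ix2" where
  "T_sy2 = map_matrix (fps_map abs_sy2) T_y2"


section \<open>The twisted Yangians \<open>Y\<^sup>-(2)\<close> and \<open>SY\<^sup>-(2)\<close>\<close>

typedef y2_tw = "subalgebra_gen {fps_nth (S_minus T_y2 $ i $ j) n |i j n. True}"
  using subalgebra_closed(1)[OF subalgebra_subalgebra_gen] by blast

setup_lifting type_definition_y2_tw

instantiation y2_tw :: calgebra_1
begin

lift_definition zero_y2_tw :: y2_tw is 0 by (rule subalgebra_closed[OF subalgebra_subalgebra_gen])
lift_definition one_y2_tw :: y2_tw is 1 by (rule subalgebra_closed[OF subalgebra_subalgebra_gen])
lift_definition plus_y2_tw :: "y2_tw \<Rightarrow> y2_tw \<Rightarrow> y2_tw" is "(+)"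
  by (rule subalgebra_closed[OF subalgebra_subalgebra_gen])
lift_definition minus_y2_tw :: "y2_tw \<Rightarrow> y2_tw \<Rightarrow> y2_tw" is "(-)"
  by (rule subalgebra_closed[OF subalgebra_subalgebra_gen])
lift_definition uminus_y2_tw :: "y2_tw \<Rightarrow> y2_tw" is uminus
  by (rule subalgebra_closed[OF subalgebra_subalgebra_gen])
lift_definition times_y2_tw :: "y2_tw \<Rightarrow> y2_tw \<Rightarrow> y2_tw" is "(*)"
  by (rule subalgebra_closed[OF subalgebra_subalgebra_gen])
lift_definition scaleC_y2_tw :: "complex \<Rightarrow> y2_tw \<Rightarrow> y2_tw" is "(*\<^sub>C)"
  by (rule subalgebra_closed[OF subalgebra_subalgebra_gen])

instance
  by standard (transfer; simp add: algebra_simps scaleC_add_right scaleC_add_left scaleC_scaleC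
      scaleC_one mult_scaleC_left mult_scaleC_right)+

end

definition S_y2_tw :: "y2_tw fps^ix2^ix2" where
  "S_y2_tw = map_matrix (fps_map Abs_y2_tw) (S_minus T_y2)"

typedef sy2_tw = "subalgebra_gen {fps_nth (S_minus T_sy2 $ i $ j) n |i j n. True}"
  using subalgebra_closed(1)[OF subalgebra_subalgebra_gen] by blast

setup_lifting type_definition_sy2_tw

instantiation sy2_tw :: calgebra_1
begin

lift_definition zero_sy2_tw :: sy2_tw is 0 by (rule subalgebra_closed[OF subalgebra_subalgebra_gen])
lift_definition one_sy2_tw :: sy2_tw is 1 by (rule subalgebra_closed[OF subalgebra_subalgebra_gen])
lift_definition plus_sy2_tw :: "sy2_tw \<Rightarrow> sy2_tw \<Rightarrow> sy2_tw" is "(+)"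
  by (rule subalgebra_closed[OF subalgebra_subalgebra_gen])
lift_definition minus_sy2_tw :: "sy2_tw \<Rightarrow> sy2_tw \<Rightarrow> sy2_tw" is "(-)"
  by (rule subalgebra_closed[OF subalgebra_subalgebra_gen])
lift_definition uminus_sy2_tw :: "sy2_tw \<Rightarrow> sy2_tw" is uminus
  by (rule subalgebra_closed[OF subalgebra_subalgebra_gen])
lift_definition times_sy2_tw :: "sy2_tw \<Rightarrow> sy2_tw \<Rightarrow> sy2_tw" is "(*)"
  by (rule subalgebra_closed[OF subalgebra_subalgebra_gen])
lift_definition scaleC_sy2_tw :: "complex \<Rightarrow> sy2_tw \<Rightarrow> sy2_tw" is "(*\<^sub>C)"
  by (rule subalgebra_closed[OF subalgebra_subalgebra_gen])

instance
  by standard (transfer; simp add: algebra_simps scaleC_add_right scaleC_add_left scaleC_scaleC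
      scaleC_one mult_scaleC_left mult_scaleC_right)+

end

definition proj_tw :: "y2_tw \<Rightarrow> sy2_tw" where
  "proj_tw x = Abs_sy2_tw (abs_sy2 (Rep_y2_tw x))"

lemma Rep_proj_tw: "Rep_sy2_tw (proj_tw x) = abs_sy2 (Rep_y2_tw x)"
proof -
  let ?G = "{fps_nth (S_minus T_sy2 $ i $ j) n |i j n. True}"
  have "map_matrix (fps_map abs_sy2) (S_minus T_y2) = S_minus T_sy2"
    by (simp add: S_minus_hom[OF calg_hom_abs_sy2] T_sy2_def)
  then have "abs_sy2 (fps_nth (S_minus T_y2 $ i $ j) n) = fps_nth (S_minus T_sy2 $ i $ j) n" for i j n
    by (metis fps_map_nth nth_map_matrix)
  then have "{fps_nth (S_minus T_y2 $ i $ j) n |i j n. True} \<subseteq> {x. abs_sy2 x \<in> subalgebra_gen ?G}"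
    by (auto intro!: hull_inc) blast
  moreover have "subalgebra {x. abs_sy2 x \<in> subalgebra_gen ?G}"
    using subalgebra_closed[OF subalgebra_subalgebra_gen[of ?G]]
    by (simp add: subalgebra_def calg_homD[OF calg_hom_abs_sy2])
  ultimately have "subalgebra_gen {fps_nth (S_minus T_y2 $ i $ j) n |i j n. True}
      \<subseteq> {x. abs_sy2 x \<in> subalgebra_gen ?G}"
    by (rule hull_minimal)
  then show ?thesis using Rep_y2_tw[of x] by (auto simp: proj_tw_def Abs_sy2_tw_inverse)
qed

lemma calg_hom_proj_tw: "calg_hom proj_tw"
  unfolding calg_hom_def
  by (simp add: Rep_sy2_tw_inject[symmetric] Rep_proj_tw one_y2_tw.rep_eq one_sy2_tw.rep_eq
      plus_y2_tw.rep_eq plus_sy2_tw.rep_eq times_y2_tw.rep_eq times_sy2_tw.rep_eq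
      scaleC_y2_tw.rep_eq scaleC_sy2_tw.rep_eq calg_homD[OF calg_hom_abs_sy2])

definition Pr1 :: "(y2_tw, y2_tw) tensor \<Rightarrow> (sy2_tw, y2_tw) tensor"
  where "Pr1 = tensor_map proj_tw id"

definition Pr2 :: "(y2_tw, y2_tw) tensor \<Rightarrow> (y2_tw, sy2_tw) tensor"
  where "Pr2 = tensor_map id proj_tw"


section \<open>The extended twisted Yangian \<open>X(so\<^sub>4, so\<^sub>4)\<^sup>t\<^sup>w\<close>\<close>

datatype ix4 = Neg2 | Neg1 | Pos1 | Pos2  \<comment> \<open>the indices \<open>-2, -1, 1, 2\<close>\<close>

instance ix4 :: finite
proof
  have "(UNIV :: ix4 set) \<subseteq> {Neg2, Neg1, Pos1, Pos2}" using ix4.exhaust by blast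
  then show "finite (UNIV :: ix4 set)" by (rule finite_subset) simp
qed

primrec neg4 :: "ix4 \<Rightarrow> ix4" where
  "neg4 Neg2 = Pos2" | "neg4 Neg1 = Pos1" | "neg4 Pos1 = Neg1" | "neg4 Pos2 = Neg2"

definition Q_so4 :: "'a::semiring_1^(ix4 \<times> ix4)^(ix4 \<times> ix4)" where
  "Q_so4 = (\<Sum>i\<in>UNIV. \<Sum>j\<in>UNIV. kron (unit_matrix i j) (unit_matrix (neg4 i) (neg4 j)))"

definition R_so4 :: "complex fls fls \<Rightarrow> complex fls fls^(ix4 \<times> ix4)^(ix4 \<times> ix4)" where
  "R_so4 w = mat 1 - mat (1 / w) ** flip_matrix + mat (1 / (w - 1)) ** Q_so4"

text \<open>The linear extension of \<open>(E\<^sub>i\<^sub>j)\<^sup>t = E\<^sub>-\<^sub>j\<^sub>,\<^sub>-\<^sub>i\<close>.\<close>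
definition transpose_plus :: "'a^ix4^ix4 \<Rightarrow> 'a^ix4^ix4" where
  "transpose_plus M = (\<chi> a b. M $ neg4 b $ neg4 a)"

quotient_type xso4 = "(ix4 \<times> ix4 \<times> nat) free_alg" / "\<lambda>x y. x - y \<in> ideal_gen (rtt_relators R_so4)"
  by (rule ideal_equivp[OF two_sided_ideal_ideal_gen])

instantiation xso4 :: calgebra_1
begin

lift_definition zero_xso4 :: xso4 is 0 .
lift_definition one_xso4 :: xso4 is 1 .
lift_definition plus_xso4 :: "xso4 \<Rightarrow> xso4 \<Rightarrow> xso4" is "(+)"
  by (rule ideal_cong[OF two_sided_ideal_ideal_gen])
lift_definition minus_xso4 :: "xso4 \<Rightarrow> xso4 \<Rightarrow> xso4" is "(-)"
  by (rule ideal_cong[OF two_sided_ideal_ideal_gen])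
lift_definition uminus_xso4 :: "xso4 \<Rightarrow> xso4" is uminus
  by (rule ideal_cong[OF two_sided_ideal_ideal_gen])
lift_definition times_xso4 :: "xso4 \<Rightarrow> xso4 \<Rightarrow> xso4" is "(*)"
  by (rule ideal_cong[OF two_sided_ideal_ideal_gen])
lift_definition scaleC_xso4 :: "complex \<Rightarrow> xso4 \<Rightarrow> xso4" is "(*\<^sub>C)"
  by (rule ideal_cong_scaleC[OF two_sided_ideal_ideal_gen])

instance
proof
  show "(0 :: xso4) \<noteq> 1"
    by transfer (use one_notin_rtt_ideal[of R_so4] ideal_closed(5)[OF two_sided_ideal_ideal_gen] in fastforce)
qed (transfer; simp add: algebra_simps scaleC_add_right scaleC_add_left scaleC_scaleC scaleC_one
      mult_scaleC_left mult_scaleC_right ideal_closed(1)[OF two_sided_ideal_ideal_gen])+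

end

lemma calg_hom_abs_xso4: "calg_hom abs_xso4"
  by (simp add: calg_hom_def one_xso4.abs_eq plus_xso4.abs_eq times_xso4.abs_eq scaleC_xso4.abs_eq)

definition T_xso4 :: "xso4 fps^ix4^ix4" where
  "T_xso4 = map_matrix (fps_map abs_xso4) free_T"

definition S_xso4 :: "xso4 fps^ix4^ix4" where
  "S_xso4 = map_matrix (at_affine 1 (- 1 / 2)) T_xso4 **
            transpose_plus (map_matrix (at_affine (- 1) (1 / 2)) T_xso4)"

typedef xso4_tw = "subalgebra_gen {fps_nth (S_xso4 $ i $ j) n |i j n. True}"
  using subalgebra_closed(1)[OF subalgebra_subalgebra_gen] by blast

setup_lifting type_definition_xso4_tw

instantiation xso4_tw :: calgebra_1
begin

lift_definition zero_xso4_tw :: xso4_tw is 0 by (rule subalgebra_closed[OF subalgebra_subalgebra_gen])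
lift_definition one_xso4_tw :: xso4_tw is 1 by (rule subalgebra_closed[OF subalgebra_subalgebra_gen])
lift_definition plus_xso4_tw :: "xso4_tw \<Rightarrow> xso4_tw \<Rightarrow> xso4_tw" is "(+)"
  by (rule subalgebra_closed[OF subalgebra_subalgebra_gen])
lift_definition minus_xso4_tw :: "xso4_tw \<Rightarrow> xso4_tw \<Rightarrow> xso4_tw" is "(-)"
  by (rule subalgebra_closed[OF subalgebra_subalgebra_gen])
lift_definition uminus_xso4_tw :: "xso4_tw \<Rightarrow> xso4_tw" is uminus
  by (rule subalgebra_closed[OF subalgebra_subalgebra_gen])
lift_definition times_xso4_tw :: "xso4_tw \<Rightarrow> xso4_tw \<Rightarrow> xso4_tw" is "(*)"
  by (rule subalgebra_closed[OF subalgebra_subalgebra_gen])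
lift_definition scaleC_xso4_tw :: "complex \<Rightarrow> xso4_tw \<Rightarrow> xso4_tw" is "(*\<^sub>C)"
  by (rule subalgebra_closed[OF subalgebra_subalgebra_gen])

instance
  by standard (transfer; simp add: algebra_simps scaleC_add_right scaleC_add_left scaleC_scaleC
      scaleC_one mult_scaleC_left mult_scaleC_right)+

end

definition S_xso4_tw :: "xso4_tw fps^ix4^ix4" where
  "S_xso4_tw = map_matrix (fps_map Abs_xso4_tw) S_xso4"


section \<open>The identification of \<open>\<complex>\<^sup>4\<close> with \<open>\<complex>\<^sup>2 \<otimes> \<complex>\<^sup>2\<close>\<close>

primrec basis_vec :: "ix4 \<Rightarrow> complex^(ix2 \<times> ix2)" where
  "basis_vec Neg2 = axis (Neg, Neg) 1"
| "basis_vec Neg1 = axis (Neg, Pos) 1"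
| "basis_vec Pos1 = axis (Pos, Neg) 1"
| "basis_vec Pos2 = - axis (Pos, Pos) 1"

definition basis_matrix :: "complex^ix4^(ix2 \<times> ix2)" where
  "basis_matrix = (\<chi> p i. basis_vec i $ p)"

lemma basis_matrix_inverse:
  "transpose basis_matrix ** basis_matrix = mat 1" "basis_matrix ** transpose basis_matrix = mat 1"
proof -
  have U2: "(UNIV :: ix2 set) = {Neg, Pos}" using ix2.exhaust by blast
  have U4: "(UNIV :: ix4 set) = {Neg2, Neg1, Pos1, Pos2}" using ix4.exhaust by blast
  have s4: "(\<Sum>k\<in>UNIV. f k) = f Neg2 + f Neg1 + f Pos1 + f Pos2" for f :: "ix4 \<Rightarrow> complex"
    by (simp add: U4)
  have s2: "(\<Sum>p\<in>UNIV. f p) = f (Neg, Neg) + f (Neg, Pos) + f (Pos, Neg) + f (Pos, Pos)"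
    for f :: "ix2 \<times> ix2 \<Rightarrow> complex"
    by (simp add: UNIV_Times_UNIV[symmetric] U2 insert_Times_insert del: UNIV_Times_UNIV)
  have "(transpose basis_matrix ** basis_matrix) $ i $ j = mat 1 $ i $ j" for i j
    by (cases i; cases j)
      (simp_all add: matrix_matrix_mult_def transpose_def basis_matrix_def s2 axis_def mat_def)
  then show "transpose basis_matrix ** basis_matrix = mat 1" by (simp add: vec_eq_iff)
  have "(basis_matrix ** transpose basis_matrix) $ (a, b) $ (c, d) = mat 1 $ (a, b) $ (c, d)" for a b c d
    by (cases a; cases b; cases c; cases d)
      (simp_all add: matrix_matrix_mult_def transpose_def basis_matrix_def s4 axis_def mat_def)
  then show "basis_matrix ** transpose basis_matrix = mat 1" by (simp add: vec_eq_iff)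
qed

lemma matrix_inv_basis_matrix: "matrix_inv basis_matrix = transpose basis_matrix"
proof -
  have "basis_matrix ** matrix_inv basis_matrix = mat 1"
    unfolding matrix_inv_def using someI_ex[of "\<lambda>B. basis_matrix ** B = mat 1 \<and> B ** basis_matrix = mat 1"]
      basis_matrix_inverse by blast
  then have "transpose basis_matrix ** (basis_matrix ** matrix_inv basis_matrix) = transpose basis_matrix"
    by simp
  then show ?thesis by (simp add: matrix_mul_assoc basis_matrix_inverse)
qed

definition scalar_matrix :: "complex^'n^'m \<Rightarrow> 'a::calgebra_1 fps^'n^'m" where
  "scalar_matrix A = map_matrix (\<lambda>c. fps_const (c *\<^sub>C 1)) A"

text \<open>The matrix of an operator on \<open>\<complex>\<^sup>2 \<otimes> \<complex>\<^sup>2\<close> in the basis \<open>v\<^sub>-\<^sub>2, v\<^sub>-\<^sub>1, v\<^sub>1, v\<^sub>2\<close>.\<close>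
definition in_basis :: "'a::calgebra_1 fps^(ix2 \<times> ix2)^(ix2 \<times> ix2) \<Rightarrow> 'a fps^ix4^ix4" where
  "in_basis M = scalar_matrix (matrix_inv basis_matrix) ** M ** scalar_matrix basis_matrix"

text \<open>
  \<open>S\<^sup>\<circ>(u)\<close> and \<open>S\<^sup>\<bullet>(u)\<close> with entries in \<open>Y\<^sup>-(2) \<otimes> Y\<^sup>-(2)\<close>, acting on the first and on the second
  factor of \<open>\<complex>\<^sup>2 \<otimes> \<complex>\<^sup>2\<close>.
\<close>
definition S_circ :: "(y2_tw, y2_tw) tensor fps^(ix2 \<times> ix2)^(ix2 \<times> ix2)" where
  "S_circ = kron (map_matrix (fps_map (\<lambda>a. a \<otimes> 1)) S_y2_tw) (mat 1)"

definition S_bullet :: "(y2_tw, y2_tw) tensor fps^(ix2 \<times> ix2)^(ix2 \<times> ix2)" where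
  "S_bullet = kron (mat 1) (map_matrix (fps_map (\<lambda>a. 1 \<otimes> a)) S_y2_tw)"

end

theory Submission
  imports Defs
begin

text \<open>
  The image of \<open>\<phi>\<^sub>1\<close> is generated by the coefficients of the products of an entry of \<open>S\<^sup>\<circ>(u)\<close> with an
  entry of \<open>S\<^sup>\<bullet>(u)\<close>.

  Surjectivity: after the projection of the first factor one has \<open>S\<^sup>\<circ>(u) S\<^sup>\<circ>(- u - 1) = 1\<close>, and
  \<open>tr S\<^sup>\<circ>(u)\<close> is even in \<open>u\<close>.  This allows one to recover the coefficients of \<open>S\<^sup>\<circ>(u)\<close> recursively, and
  hence those of \<open>S\<^sup>\<bullet>(u)\<close>, from the products of entries.

  Injectivity: since \<open>qdet T\<^sup>\<circ>(u)\<close> is central, it equals \<open>d(u - 1) d(u)\<close> for a central series \<open>d(u)\<close>, so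
  \<open>T\<^sup>\<circ>(u) \<mapsto> d(u)\<^sup>-\<^sup>1 T\<^sup>\<circ>(u)\<close> defines a homomorphism \<open>SY(2) \<rightarrow> Y(2)\<close>.  If the second copy of \<open>T\<^sup>\<circ>(u)\<close> is
  multiplied by \<open>d(u)\<close> of the first copy at the same time, then the products of entries of \<open>S\<^sup>\<circ>(u)\<close> and
  \<open>S\<^sup>\<bullet>(u)\<close> do not change.  Thus the projection followed by this homomorphism is the inclusion into
  \<open>Y(2) \<otimes> Y(2)\<close> on the image of \<open>\<phi>\<^sub>1\<close>.
\<close>

(* Formal_Laurent_Series leaves this notation enabled, where it makes the $ of vectors ambiguous. *)
no_notation fps_nth (infixl \<open>$\<close> 75)

text \<open>Products of entries do not change when the two matrices are scaled by a central series
  f(u) and by its inverse. On a factor of determinant one, S(u) S(-u-1) = 1 restricts this freedom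
  to f(u) f(-u-1) = 1, and evenness of the trace forces f(-u) = f(u). Then f(u) f(u+1) = 1, so f =
  1. The first condition controls the even orders in u^-1, the second the odd ones. The obstacle is
  that coefficients do not commute and that there may be zero divisors. The RTT relation is
  therefore specialised to two arguments that are series in the single variable u^-1, with
  denominators cleared, and scalar series are cancelled rather than divided by. The arguments u - 1
  and u yield the adjugate identity for the quantum determinant, hence S(u) S(-u-1) = 1. The
  arguments u and -u yield evenness of the trace. A series against a single coefficient yields
  centrality of the quantum determinant.\<close>

lemma sum_swap3: "(\<Sum>m\<in>A. \<Sum>r\<in>B. \<Sum>s\<in>C. f m r s) = (\<Sum>r\<in>B. \<Sum>s\<in>C. \<Sum>m\<in>A. f m r s)"
proof -
  have "(\<Sum>m\<in>A. \<Sum>r\<in>B. \<Sum>s\<in>C. f m r s) = (\<Sum>r\<in>B. \<Sum>m\<in>A. \<Sum>s\<in>C. f m r s)"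
    by (rule sum.swap)
  also have "\<dots> = (\<Sum>r\<in>B. \<Sum>s\<in>C. \<Sum>m\<in>A. f m r s)"
    by (intro sum.cong refl, rule sum.swap)
  finally show ?thesis .
qed

section \<open>Substitution into series with non-commuting coefficients\<close>

text \<open>The scalar series \<open>w\<close> is put for u^-1. Cutting the sum at \<open>n\<close>
  is exact when \<open>w\<close> has constant term 0, because w^i then starts at order i.\<close>

definition fps_subst :: "complex fps \<Rightarrow> 'a::calgebra_1 fps \<Rightarrow> 'a fps" where
  "fps_subst w f = Abs_fps (\<lambda>n. \<Sum>i\<le>n. fps_nth (w ^ i) n *\<^sub>C fps_nth f i)"

text \<open>Takes a family of coefficients in place of a series in two variables, so that relations
  between coefficients pass directly to two arguments \<open>w\<close> and \<open>v\<close> in one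
  common variable.\<close>

definition fps_subst2 :: "complex fps \<Rightarrow> complex fps \<Rightarrow> (nat \<Rightarrow> nat \<Rightarrow> 'a::calgebra_1) \<Rightarrow> 'a fps" where
  "fps_subst2 w v F = Abs_fps (\<lambda>n. \<Sum>r\<le>n. \<Sum>s\<le>n. fps_nth (w ^ r * v ^ s) n *\<^sub>C F r s)"

definition fps_scalar :: "complex fps \<Rightarrow> 'a::calgebra_1 fps" where
  "fps_scalar w = fps_map (\<lambda>c. c *\<^sub>C 1) w"

definition affine_arg :: "complex \<Rightarrow> complex \<Rightarrow> complex fps" where
  "affine_arg \<alpha> \<beta> = fps_X / (fps_const \<alpha> + fps_const \<beta> * fps_X)"

lemma at_affine_eq_fps_subst: "at_affine \<alpha> \<beta> = fps_subst (affine_arg \<alpha> \<beta>)"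
  by (rule ext) (simp add: at_affine_def fps_subst_def affine_arg_def)

lemma fps_nth_scalar [simp]: "fps_nth (fps_scalar w) n = fps_nth w n *\<^sub>C 1"
  by (simp add: fps_scalar_def)

lemma fps_scalar_simps:
  "fps_scalar (v * w) = fps_scalar v * fps_scalar w"
  "fps_scalar (v + w) = fps_scalar v + fps_scalar w"
  "fps_scalar (v - w) = fps_scalar v - fps_scalar w"
  "fps_scalar (- w) = - fps_scalar w"
  "fps_scalar 1 = 1" "fps_scalar 0 = 0" "fps_scalar fps_X = fps_X"
  by (simp_all add: fps_eq_iff fps_mult_nth mult_scaleC_left scaleC_scaleC cvec.scale_sum_left
      scaleC_add_left scaleC_one cvec.scale_left_diff_distrib fps_X_def)

lemma fps_nth_scalar_mult: "fps_nth (fps_scalar w * f) n = (\<Sum>i\<le>n. fps_nth w i *\<^sub>C fps_nth f (n - i))"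
  by (simp add: fps_mult_nth mult_scaleC_left atLeast0AtMost)

lemma fps_scalar_commute: "f * fps_scalar w = fps_scalar w * f"
proof (rule fps_ext)
  fix n
  have "fps_nth (f * fps_scalar w) n = (\<Sum>i\<le>n. fps_nth w (n - i) *\<^sub>C fps_nth f i)"
    by (simp add: fps_mult_nth mult_scaleC_right atLeast0AtMost)
  also have "\<dots> = (\<Sum>i\<le>n. fps_nth w i *\<^sub>C fps_nth f (n - i))"
    by (rule sum.reindex_bij_witness[of _ "\<lambda>i. n - i" "\<lambda>i. n - i"]) auto
  finally show "fps_nth (f * fps_scalar w) n = fps_nth (fps_scalar w * f) n"
    by (simp only: fps_nth_scalar_mult)
qed

lemma fps_scalar_left_commute: "f * (fps_scalar w * g) = fps_scalar w * (f * g)"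
  by (metis fps_scalar_commute mult.assoc)

text \<open>Up to an invertible factor \<open>w\<close> is a power of \<open>fps_X\<close>, and
  multiplying by such a power only shifts coefficients. This serves as division by specialised
  values of u - v in an algebra with possible zero divisors.\<close>

lemma fps_scalar_cancel:
  assumes "w \<noteq> 0" "fps_scalar w * f = fps_scalar w * g"
  shows "f = g"
proof -
  have "inverse (unit_factor w) * w = fps_X ^ subdegree w"
    using fps_mult_left_inverse_unit_factor[of "inverse (fps_nth w (subdegree w))" w] assms(1)
    by (simp add: fps_inverse_def fps_left_inverse_eq_fps_right_inverse_comm)
  then have "fps_scalar (fps_X ^ subdegree w) * f = fps_scalar (fps_X ^ subdegree w) * g"
    using assms(2) by (metis fps_scalar_simps(1) mult.assoc)
  moreover have "fps_scalar (fps_X ^ k) = (fps_X ^ k :: 'a fps)" for k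
    by (induction k) (simp_all add: fps_scalar_simps)
  ultimately have "fps_nth (fps_X ^ subdegree w * f) (n + subdegree w) =
      fps_nth (fps_X ^ subdegree w * g) (n + subdegree w)" for n
    by simp
  then show ?thesis by (simp add: fps_X_power_mult_nth fps_eq_iff)
qed

lemma fps_nth_power_eq_0: "fps_nth w 0 = 0 \<Longrightarrow> n < i \<Longrightarrow> fps_nth (w ^ i :: complex fps) n = 0"
  using startsby_zero_power_prefix[of w] by blast

lemma fps_nth_power_mult_eq_0:
  assumes "fps_nth w 0 = 0" "fps_nth v 0 = 0" "n < r \<or> n < s"
  shows "fps_nth (w ^ r * v ^ s :: complex fps) n = 0"
proof -
  have "fps_nth (w ^ r) i * fps_nth (v ^ s) (n - i) = 0" if "i \<le> n" for i
    using assms that fps_nth_power_eq_0[of w i r] fps_nth_power_eq_0[of v "n - i" s] by force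
  then show ?thesis unfolding fps_mult_nth by (intro sum.neutral) auto
qed

lemma fps_nth_subst:
  assumes "fps_nth w 0 = 0" "n \<le> N"
  shows "fps_nth (fps_subst w f) n = (\<Sum>i\<le>N. fps_nth (w ^ i) n *\<^sub>C fps_nth f i)"
  unfolding fps_subst_def fps_nth_Abs_fps
  by (rule sum.mono_neutral_left) (use assms in \<open>auto simp: fps_nth_power_eq_0\<close>)

lemma fps_nth_subst2:
  assumes "fps_nth w 0 = 0" "fps_nth v 0 = 0" "n \<le> N"
  shows "fps_nth (fps_subst2 w v F) n = (\<Sum>r\<le>N. \<Sum>s\<le>N. fps_nth (w ^ r * v ^ s) n *\<^sub>C F r s)"
proof -
  have "fps_nth (fps_subst2 w v F) n = (\<Sum>r\<le>n. \<Sum>s\<le>N. fps_nth (w ^ r * v ^ s) n *\<^sub>C F r s)"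
    unfolding fps_subst2_def fps_nth_Abs_fps
    by (intro sum.cong refl sum.mono_neutral_left)
      (use assms in \<open>auto simp: fps_nth_power_mult_eq_0\<close>)
  also have "\<dots> = (\<Sum>r\<le>N. \<Sum>s\<le>N. fps_nth (w ^ r * v ^ s) n *\<^sub>C F r s)"
    by (rule sum.mono_neutral_left) (use assms in \<open>auto simp: fps_nth_power_mult_eq_0\<close>)
  finally show ?thesis .
qed

text \<open>In the second form \<open>w\<close> stays attached to the index \<open>r\<close>
  although the factors are reversed. Commutators of coefficients thus become commutators of
  series.\<close>

lemma fps_subst2_mult:
  assumes w: "fps_nth w 0 = 0" and v: "fps_nth v 0 = 0"
  shows "fps_subst2 w v (\<lambda>r s. fps_nth f r * fps_nth g s) = fps_subst w f * fps_subst v g"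
    and "fps_subst2 w v (\<lambda>r s. fps_nth g s * fps_nth f r) = fps_subst v g * fps_subst w f"
proof -
  let ?c = "\<lambda>n r s. fps_nth (w ^ r * v ^ s) n"
  have c: "?c n r s = (\<Sum>m\<le>n. fps_nth (w ^ r) m * fps_nth (v ^ s) (n - m))"
    "?c n r s = (\<Sum>m\<le>n. fps_nth (v ^ s) m * fps_nth (w ^ r) (n - m))" for n r s
    by (simp add: fps_mult_nth atLeast0AtMost)
      (subst mult.commute, simp add: fps_mult_nth atLeast0AtMost)
  show "fps_subst2 w v (\<lambda>r s. fps_nth f r * fps_nth g s) = fps_subst w f * fps_subst v g"
  proof (rule fps_ext)
    fix n
    have "fps_nth (fps_subst w f * fps_subst v g) n =
        (\<Sum>m\<le>n. (\<Sum>r\<le>n. fps_nth (w ^ r) m *\<^sub>C fps_nth f r) * (\<Sum>s\<le>n. fps_nth (v ^ s) (n - m) *\<^sub>C fps_nth g s))"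
      unfolding fps_mult_nth atLeast0AtMost
      by (intro sum.cong refl arg_cong2[of _ _ _ _ "(*)"] fps_nth_subst w v) auto
    also have "\<dots> = (\<Sum>m\<le>n. \<Sum>r\<le>n. \<Sum>s\<le>n.
        (fps_nth (w ^ r) m * fps_nth (v ^ s) (n - m)) *\<^sub>C (fps_nth f r * fps_nth g s))"
      by (simp add: sum_product mult_scaleC_left mult_scaleC_right scaleC_scaleC mult.commute)
    also have "\<dots> = (\<Sum>r\<le>n. \<Sum>s\<le>n. \<Sum>m\<le>n.
        (fps_nth (w ^ r) m * fps_nth (v ^ s) (n - m)) *\<^sub>C (fps_nth f r * fps_nth g s))"
      by (rule sum_swap3)
    finally show "fps_nth (fps_subst2 w v (\<lambda>r s. fps_nth f r * fps_nth g s)) n = fps_nth (fps_subst w f * fps_subst v g) n"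
      by (simp add: fps_nth_subst2[OF w v order_refl] c(1) cvec.scale_sum_left)
  qed
  show "fps_subst2 w v (\<lambda>r s. fps_nth g s * fps_nth f r) = fps_subst v g * fps_subst w f"
  proof (rule fps_ext)
    fix n
    have "fps_nth (fps_subst v g * fps_subst w f) n =
        (\<Sum>m\<le>n. (\<Sum>s\<le>n. fps_nth (v ^ s) m *\<^sub>C fps_nth g s) * (\<Sum>r\<le>n. fps_nth (w ^ r) (n - m) *\<^sub>C fps_nth f r))"
      unfolding fps_mult_nth atLeast0AtMost
      by (intro sum.cong refl arg_cong2[of _ _ _ _ "(*)"] fps_nth_subst w v) auto
    also have "\<dots> = (\<Sum>m\<le>n. \<Sum>s\<le>n. \<Sum>r\<le>n.
        (fps_nth (v ^ s) m * fps_nth (w ^ r) (n - m)) *\<^sub>C (fps_nth g s * fps_nth f r))"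
      by (simp add: sum_product mult_scaleC_left mult_scaleC_right scaleC_scaleC mult.commute)
    also have "\<dots> = (\<Sum>m\<le>n. \<Sum>r\<le>n. \<Sum>s\<le>n.
        (fps_nth (v ^ s) m * fps_nth (w ^ r) (n - m)) *\<^sub>C (fps_nth g s * fps_nth f r))"
      by (rule sum.cong[OF refl], rule sum.swap)
    also have "\<dots> = (\<Sum>r\<le>n. \<Sum>s\<le>n. \<Sum>m\<le>n.
        (fps_nth (v ^ s) m * fps_nth (w ^ r) (n - m)) *\<^sub>C (fps_nth g s * fps_nth f r))"
      by (rule sum_swap3)
    finally show "fps_nth (fps_subst2 w v (\<lambda>r s. fps_nth g s * fps_nth f r)) n = fps_nth (fps_subst v g * fps_subst w f) n"
      by (simp add: fps_nth_subst2[OF w v order_refl] c(2) cvec.scale_sum_left)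
  qed
qed

lemma fps_subst2_linear:
  "fps_subst2 w v (\<lambda>r s. F r s + G r s) = fps_subst2 w v F + fps_subst2 w v G"
  "fps_subst2 w v (\<lambda>r s. F r s - G r s) = fps_subst2 w v F - fps_subst2 w v G"
  by (simp_all add: fps_eq_iff fps_subst2_def scaleC_add_right sum.distrib sum_subtractf
      cvec.scale_right_diff_distrib)

lemma fps_scalar_mult_subst2:
  assumes w: "fps_nth w 0 = 0" and v: "fps_nth v 0 = 0"
  shows "fps_scalar w * fps_subst2 w v F = fps_subst2 w v (\<lambda>r s. case r of 0 \<Rightarrow> 0 | Suc r \<Rightarrow> F r s)"
    and "fps_scalar v * fps_subst2 w v F = fps_subst2 w v (\<lambda>r s. case s of 0 \<Rightarrow> 0 | Suc s \<Rightarrow> F r s)"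
proof -
  have *: "fps_nth (fps_scalar x * fps_subst2 w v F) n =
      (\<Sum>r\<le>n. \<Sum>s\<le>n. fps_nth (x * (w ^ r * v ^ s)) n *\<^sub>C F r s)" for x n
  proof -
    have "fps_nth (fps_scalar x * fps_subst2 w v F) n =
        (\<Sum>m\<le>n. fps_nth x m *\<^sub>C (\<Sum>r\<le>n. \<Sum>s\<le>n. fps_nth (w ^ r * v ^ s) (n - m) *\<^sub>C F r s))"
      unfolding fps_nth_scalar_mult
      by (intro sum.cong refl arg_cong[of _ _ "scaleC _"] fps_nth_subst2 w v) auto
    also have "\<dots> = (\<Sum>m\<le>n. \<Sum>r\<le>n. \<Sum>s\<le>n. (fps_nth x m * fps_nth (w ^ r * v ^ s) (n - m)) *\<^sub>C F r s)"
      by (simp add: cvec.scale_sum_right scaleC_scaleC)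
    also have "\<dots> = (\<Sum>r\<le>n. \<Sum>s\<le>n. \<Sum>m\<le>n. (fps_nth x m * fps_nth (w ^ r * v ^ s) (n - m)) *\<^sub>C F r s)"
      by (rule sum_swap3)
    finally show ?thesis
      by (simp add: cvec.scale_sum_left fps_mult_nth[of x] atLeast0AtMost)
  qed
  show "fps_scalar w * fps_subst2 w v F = fps_subst2 w v (\<lambda>r s. case r of 0 \<Rightarrow> 0 | Suc r \<Rightarrow> F r s)"
  proof (rule fps_ext)
    fix n
    \<comment> \<open>Extending the sums to \<open>Suc n\<close> before shifting \<open>r\<close>
      also adds the column with \<open>s\<close> equal to \<open>Suc n\<close>. It vanishes, since
      v^(n+1) starts at order n + 1.\<close>
    have z: "fps_nth (w * (w ^ r * (v * v ^ n))) n = 0" for r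
      using fps_nth_power_mult_eq_0[OF w v, of n "Suc r" "Suc n"] by (simp add: mult.assoc)
    have "fps_nth (fps_subst2 w v (\<lambda>r s. case r of 0 \<Rightarrow> 0 | Suc r \<Rightarrow> F r s)) n =
        (\<Sum>r\<le>Suc n. \<Sum>s\<le>Suc n. fps_nth (w ^ r * v ^ s) n *\<^sub>C (case r of 0 \<Rightarrow> 0 | Suc r \<Rightarrow> F r s))"
      by (rule fps_nth_subst2[OF w v]) simp
    also have "\<dots> = (\<Sum>r\<le>n. \<Sum>s\<le>n. fps_nth (w * (w ^ r * v ^ s)) n *\<^sub>C F r s)"
      by (subst sum.atMost_Suc_shift)
        (simp add: mult.assoc z)
    finally show "fps_nth (fps_scalar w * fps_subst2 w v F) n =
        fps_nth (fps_subst2 w v (\<lambda>r s. case r of 0 \<Rightarrow> 0 | Suc r \<Rightarrow> F r s)) n"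
      by (simp add: *)
  qed
  show "fps_scalar v * fps_subst2 w v F = fps_subst2 w v (\<lambda>r s. case s of 0 \<Rightarrow> 0 | Suc s \<Rightarrow> F r s)"
  proof (rule fps_ext)
    fix n
    have "fps_nth (fps_subst2 w v (\<lambda>r s. case s of 0 \<Rightarrow> 0 | Suc s \<Rightarrow> F r s)) n =
        (\<Sum>r\<le>Suc n. \<Sum>s\<le>Suc n. fps_nth (w ^ r * v ^ s) n *\<^sub>C (case s of 0 \<Rightarrow> 0 | Suc s \<Rightarrow> F r s))"
      by (rule fps_nth_subst2[OF w v]) simp
    also have "\<dots> = (\<Sum>r\<le>Suc n. \<Sum>s\<le>n. fps_nth (w ^ r * v ^ Suc s) n *\<^sub>C F r s)"
      by (rule sum.cong[OF refl], subst sum.atMost_Suc_shift, simp)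
    also have "\<dots> = (\<Sum>r\<le>n. \<Sum>s\<le>n. fps_nth (w ^ r * v ^ Suc s) n *\<^sub>C F r s)"
      by (simp add: fps_nth_power_mult_eq_0[OF w v, of n "Suc n"] del: power_Suc)
    finally show "fps_nth (fps_scalar v * fps_subst2 w v F) n =
        fps_nth (fps_subst2 w v (\<lambda>r s. case s of 0 \<Rightarrow> 0 | Suc s \<Rightarrow> F r s)) n"
      by (simp add: * mult.left_commute)
  qed
qed

lemma fps_subst_linear:
  "fps_subst w (f + g) = fps_subst w f + fps_subst w g"
  "fps_subst w (f - g) = fps_subst w f - fps_subst w g"
  "fps_subst w (- f) = - fps_subst w f"
  by (simp_all add: fps_eq_iff fps_subst_def scaleC_add_right sum.distrib sum_subtractf
      cvec.scale_right_diff_distrib sum_negf)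

lemma fps_subst_mult:
  assumes w: "fps_nth w 0 = 0"
  shows "fps_subst w (f * g) = fps_subst w f * fps_subst w g"
proof (rule fps_ext)
  fix n
  let ?h = "\<lambda>r s. fps_nth (w ^ (r + s)) n *\<^sub>C (fps_nth f r * fps_nth g s)"
  have "fps_nth (fps_subst w f * fps_subst w g) n = (\<Sum>r\<le>n. \<Sum>s\<le>n. ?h r s)"
    by (simp add: fps_subst2_mult(1)[OF w w, symmetric] fps_nth_subst2[OF w w order_refl] power_add)
  also have "\<dots> = (\<Sum>r\<le>n. \<Sum>s\<le>n - r. ?h r s)"
    by (intro sum.cong refl sum.mono_neutral_right) (auto simp: fps_nth_power_eq_0[OF w])
  also have "\<dots> = (\<Sum>(r, s)\<in>{(r, s). r + s \<le> n}. ?h r s)"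
    by (subst sum.Sigma) (auto intro!: sum.cong)
  also have "\<dots> = (\<Sum>k\<le>n. \<Sum>r\<le>k. ?h r (k - r))"
    by (rule sum.triangle_reindex_eq)
  also have "\<dots> = fps_nth (fps_subst w (f * g)) n"
    by (simp add: fps_subst_def fps_mult_nth cvec.scale_sum_right atLeast0AtMost)
  finally show "fps_nth (fps_subst w (f * g)) n = fps_nth (fps_subst w f * fps_subst w g) n" ..
qed

lemma fps_subst_fps_X [simp]: "fps_subst fps_X f = f"
  by (simp add: fps_eq_iff fps_subst_def fps_X_power_nth if_distrib[of "\<lambda>c. c *\<^sub>C _"] scaleC_one cong: if_cong)

lemma fps_subst_scalar:
  assumes w: "fps_nth w 0 = 0"
  shows "fps_subst w (fps_scalar v) = fps_scalar (v oo w)"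
  by (simp add: fps_eq_iff fps_subst_def fps_compose_nth scaleC_scaleC cvec.scale_sum_left
      atLeast0AtMost mult.commute)

lemma fps_subst_const [simp]: "fps_subst w (fps_const c) = fps_const c"
proof (rule fps_ext)
  fix n
  have "fps_nth (fps_subst w (fps_const c)) n = (\<Sum>i\<in>{0}. fps_nth (w ^ i) n *\<^sub>C fps_nth (fps_const c) i)"
    unfolding fps_subst_def fps_nth_Abs_fps by (rule sum.mono_neutral_right) auto
  then show "fps_nth (fps_subst w (fps_const c)) n = fps_nth (fps_const c) n"
    by (simp add: scaleC_one)
qed

lemma fps_subst_X:
  assumes "fps_nth w 0 = 0"
  shows "fps_subst w fps_X = fps_scalar w"
  using fps_subst_scalar[OF assms, of fps_X] assms by (simp add: fps_scalar_simps)

lemma fps_subst_subst: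
  assumes w: "fps_nth w 0 = 0" and v: "fps_nth v 0 = 0"
  shows "fps_subst w (fps_subst v f) = fps_subst (v oo w) f"
proof (rule fps_ext)
  fix n
  have "fps_nth (fps_subst w (fps_subst v f)) n =
      (\<Sum>i\<le>n. fps_nth (w ^ i) n *\<^sub>C (\<Sum>j\<le>n. fps_nth (v ^ j) i *\<^sub>C fps_nth f j))"
    unfolding fps_subst_def[of w] fps_nth_Abs_fps
    by (intro sum.cong refl arg_cong[of _ _ "scaleC _"] fps_nth_subst v) auto
  also have "\<dots> = (\<Sum>j\<le>n. \<Sum>i\<le>n. (fps_nth (v ^ j) i * fps_nth (w ^ i) n) *\<^sub>C fps_nth f j)"
    by (simp add: cvec.scale_sum_right scaleC_scaleC mult.commute) (rule sum.swap)
  also have "\<dots> = fps_nth (fps_subst (v oo w) f) n"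
    by (simp add: fps_subst_def fps_compose_power[OF w] fps_compose_nth cvec.scale_sum_left atLeast0AtMost)
  finally show "fps_nth (fps_subst w (fps_subst v f)) n = fps_nth (fps_subst (v oo w) f) n" .
qed

lemma affine_arg_0 [simp]: "\<alpha> \<noteq> 0 \<Longrightarrow> fps_nth (affine_arg \<alpha> \<beta>) 0 = 0"
  by (simp add: affine_arg_def fps_divide_unit)

lemma affine_arg_times: "\<alpha> \<noteq> 0 \<Longrightarrow> affine_arg \<alpha> \<beta> * (fps_const \<alpha> + fps_const \<beta> * fps_X) = fps_X"
  unfolding affine_arg_def by (simp add: fps_divide_unit mult.assoc inverse_mult_eq_1)

lemma affine_arg_unique:
  assumes "\<alpha> \<noteq> 0" "w * (fps_const \<alpha> + fps_const \<beta> * fps_X) = fps_X"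
  shows "w = affine_arg \<alpha> \<beta>"
proof -
  have "fps_const \<alpha> + fps_const \<beta> * fps_X \<noteq> 0"
    using assms(1) by (metis add.right_neutral fps_add_nth fps_mult_fps_X_nonzero fps_nth_fps_const fps_zero_nth fps_mult_nth_0 fps_X_nth mult_zero_right zero_neq_one)
  then show ?thesis
    using assms affine_arg_times[OF assms(1)] by (metis mult_right_cancel)
qed

lemma affine_arg_1_0: "affine_arg 1 0 = fps_X"
  by (rule affine_arg_unique[symmetric]) simp_all

lemma affine_arg_compose:
  assumes "\<alpha> \<noteq> 0" "\<gamma> \<noteq> 0"
  shows "affine_arg \<gamma> \<delta> oo affine_arg \<alpha> \<beta> = affine_arg (\<gamma> * \<alpha>) (\<gamma> * \<beta> + \<delta>)"
proof (rule affine_arg_unique)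
  let ?w = "affine_arg \<alpha> \<beta>" and ?v = "affine_arg \<gamma> \<delta>"
  have w0: "fps_nth ?w 0 = 0" using assms by simp
  have "(?v * (fps_const \<gamma> + fps_const \<delta> * fps_X)) oo ?w = ?w"
    by (simp add: affine_arg_times[OF assms(2)] w0)
  then have 1: "(?v oo ?w) * (fps_const \<gamma> + fps_const \<delta> * ?w) = ?w"
    by (simp add: fps_compose_mult_distrib[OF w0] fps_compose_add_distrib w0)
  have "fps_const (\<gamma> * \<alpha>) + fps_const (\<gamma> * \<beta> + \<delta>) * fps_X =
      fps_const \<gamma> * (fps_const \<alpha> + fps_const \<beta> * fps_X) + fps_const \<delta> * fps_X"
    by (simp add: algebra_simps flip: fps_const_mult fps_const_add)
  then have "(?v oo ?w) * (fps_const (\<gamma> * \<alpha>) + fps_const (\<gamma> * \<beta> + \<delta>) * fps_X) =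
      (?v oo ?w) * (fps_const \<gamma> * (fps_const \<alpha> + fps_const \<beta> * fps_X) +
        fps_const \<delta> * (?w * (fps_const \<alpha> + fps_const \<beta> * fps_X)))"
    by (simp only: affine_arg_times[OF assms(1)])
  also have "\<dots> = ((?v oo ?w) * (fps_const \<gamma> + fps_const \<delta> * ?w)) * (fps_const \<alpha> + fps_const \<beta> * fps_X)"
    by (simp only: distrib_left distrib_right mult.assoc mult.left_commute mult.commute)
  also have "\<dots> = fps_X" by (simp add: 1 affine_arg_times[OF assms(1)])
  finally show "(?v oo ?w) * (fps_const (\<gamma> * \<alpha>) + fps_const (\<gamma> * \<beta> + \<delta>) * fps_X) = fps_X" .
qed (use assms in simp)

lemma at_affine_simps:
  "at_affine \<alpha> \<beta> (f + g) = at_affine \<alpha> \<beta> f + at_affine \<alpha> \<beta> g"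
  "at_affine \<alpha> \<beta> (f - g) = at_affine \<alpha> \<beta> f - at_affine \<alpha> \<beta> g"
  "at_affine \<alpha> \<beta> (- f) = - at_affine \<alpha> \<beta> f"
  "\<alpha> \<noteq> 0 \<Longrightarrow> at_affine \<alpha> \<beta> (f * g) = at_affine \<alpha> \<beta> f * at_affine \<alpha> \<beta> g"
  by (simp_all add: at_affine_eq_fps_subst fps_subst_linear fps_subst_mult)

lemma at_affine_at_affine:
  assumes "\<alpha> \<noteq> 0" "\<gamma> \<noteq> 0"
  shows "at_affine \<alpha> \<beta> (at_affine \<gamma> \<delta> f) = at_affine (\<gamma> * \<alpha>) (\<gamma> * \<beta> + \<delta>) f"
  using assms by (simp add: at_affine_eq_fps_subst fps_subst_subst affine_arg_compose)

lemma at_affine_1_0 [simp]: "at_affine 1 0 f = f"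
  by (simp add: at_affine_eq_fps_subst affine_arg_1_0)

lemma fps_nth_affine_arg_power: "\<alpha> \<noteq> 0 \<Longrightarrow> fps_nth (affine_arg \<alpha> \<beta> ^ n) n = inverse \<alpha> ^ n"
  by (simp add: affine_arg_def fps_divide_unit power_mult_distrib fps_X_power_mult_nth fps_nth_power_0)

text \<open>An affine substitution acts triangularly on coefficients with diagonal entries
  \<alpha>^-n. This makes the later recursions for coefficients solvable.\<close>

lemma fps_nth_at_affine:
  assumes "\<alpha> \<noteq> 0"
  shows "fps_nth (at_affine \<alpha> \<beta> f) n = inverse \<alpha> ^ n *\<^sub>C fps_nth f n +
      (\<Sum>i<n. fps_nth (affine_arg \<alpha> \<beta> ^ i) n *\<^sub>C fps_nth f i)"
  by (simp add: at_affine_eq_fps_subst fps_subst_def fps_nth_affine_arg_power[OF assms] add.commute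
      flip: lessThan_Suc_atMost)

lemma fps_nth_at_affine_0 [simp]: "\<alpha> \<noteq> 0 \<Longrightarrow> fps_nth (at_affine \<alpha> \<beta> f) 0 = fps_nth f 0"
  by (simp add: fps_nth_at_affine scaleC_one)

section \<open>The RTT relation in terms of coefficients\<close>

lemma fls_mult_commute:
  fixes f g :: "'a::semiring_0 fls"
  assumes "\<And>i j. f $$ i * g $$ j = g $$ j * f $$ i"
  shows "f * g = g * f"
proof (rule fls_eqI)
  fix n
  let ?a = "fls_subdegree f" and ?b = "fls_subdegree g"
  have "(f * g) $$ n = (\<Sum>i=?a..n - ?b. f $$ i * g $$ (n - i))"
    by (rule fls_times_nth_wide) simp_all
  also have "\<dots> = (\<Sum>i=?b..n - ?a. g $$ i * f $$ (n - i))"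
    by (rule sum.reindex_bij_witness[of _ "\<lambda>i. n - i" "\<lambda>i. n - i"]) (auto simp: assms)
  also have "\<dots> = (g * f) $$ n"
    by (rule fls_times_nth_wide[symmetric]) simp_all
  finally show "(f * g) $$ n = (g * f) $$ n" .
qed

lemma unital_ring_hom_lift_scalar: "unital_ring_hom lift_scalar"
  unfolding lift_scalar_def
  by (intro unital_ring_hom_fls_map)
    (simp add: unital_ring_hom_def scaleC_one scaleC_add_left mult_scaleC_left scaleC_scaleC)

lemma lift_scalar_nth [simp]: "lift_scalar f $$ m $$ n = (f $$ m $$ n) *\<^sub>C 1"
proof -
  have "fls_map (\<lambda>c. c *\<^sub>C (1 :: 'a)) 0 = 0" by (rule fls_eqI) simp
  then show ?thesis by (simp add: lift_scalar_def)
qed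

lemma lift_scalar_commute: "f * lift_scalar c = lift_scalar c * f"
  by (intro fls_mult_commute) (simp_all add: mult_scaleC_left mult_scaleC_right)

lemma in_u_nth: "in_u f $$ n = (if n < 0 then 0 else fls_const (fps_nth f (nat n)))"
  by (simp add: in_u_def fps_to_fls_nth)

lemma in_v_mult: "in_v f * in_v g = in_v (f * g :: 'a::ring_1 fps)"
  by (simp add: in_v_def fls_times_fps_to_fls)

lemma in_u_mult: "in_u f * in_u g = in_u (f * g :: 'a::ring_1 fps)"
proof -
  have const: "fls_const (a + b) = fls_const a + (fls_const b :: 'a fls)" for a b
    by (simp add: fls_plus_const)
  have "fls_const (sum h A) = (\<Sum>x\<in>A. fls_const (h x) :: 'a fls)" for h :: "nat \<Rightarrow> 'a" and A
    by (induction A rule: infinite_finite_induct) (simp_all add: const)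
  then have "fps_map fls_const (f * g) = fps_map fls_const f * fps_map fls_const g"
    by (simp add: fps_eq_iff fps_mult_nth)
  then show ?thesis by (simp add: in_u_def fls_times_fps_to_fls)
qed

lemma in_u_commute:
  fixes z :: "'a::ring_1 fps"
  assumes "\<And>i x. fps_nth z i * x = x * fps_nth z i"
  shows "f * in_u z = in_u z * f"
  by (intro fls_mult_commute) (auto simp: in_u_nth intro: assms[symmetric])

lemma in_v_commute:
  fixes z :: "'a::ring_1 fps"
  assumes "\<And>i x. fps_nth z i * x = x * fps_nth z i"
  shows "f * in_v z = in_v z * f"
  by (intro fls_mult_commute) (auto simp: in_v_def fps_to_fls_nth intro: assms[symmetric])

lemma flip_matrix_nth: "flip_matrix $ (i, k) $ (j, l) = (if i = l \<and> k = j then 1 else 0)"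
proof -
  have "flip_matrix $ (i, k) $ (j, l) = (\<Sum>a\<in>UNIV. \<Sum>b\<in>UNIV. (if i = a \<and> j = b then 1 else 0) * (if k = b \<and> l = a then 1 else 0) :: 'a)"
    by (simp add: flip_matrix_def kron_def unit_matrix_def)
  also have "\<dots> = (\<Sum>a\<in>UNIV. \<Sum>b\<in>UNIV. if b = j then if a = i then if i = l \<and> k = j then 1 else 0 else 0 else 0)"
    by (intro sum.cong refl) auto
  also have "\<dots> = (if i = l \<and> k = j then 1 else 0)" by simp
  finally show ?thesis .
qed

lemma UNIV_ix2: "(UNIV :: ix2 set) = {Neg, Pos}"
  using ix2.exhaust by blast

lemma sum_ix2: "(\<Sum>i\<in>UNIV. f i) = f Neg + f Pos"
  by (simp add: UNIV_ix2)

lemma sum_ix2_pair: "(\<Sum>p\<in>UNIV. f p) = f (Neg, Neg) + f (Neg, Pos) + f (Pos, Neg) + f (Pos, Pos)"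
  for f :: "ix2 \<times> ix2 \<Rightarrow> 'a::ab_group_add"
  by (simp add: UNIV_Times_UNIV[symmetric] UNIV_ix2 insert_Times_insert add.assoc del: UNIV_Times_UNIV)

lemma kron_mult_kron_nth:
  fixes A B :: "'a::ring_1^ix2^ix2"
  shows "(kron A (mat 1) ** kron (mat 1) B) $ (i, k) $ (j, l) = A $ i $ j * B $ k $ l"
    and "(kron (mat 1) B ** kron A (mat 1)) $ (i, k) $ (j, l) = B $ k $ l * A $ i $ j"
  by (cases i; cases j; cases k; cases l; simp add: matrix_matrix_mult_def kron_def mat_def sum_ix2_pair)+

lemma R_gl2_nth:
  "R_gl2 w $ (a, b) $ (c, d) = (if a = c \<and> b = d then 1 else 0) - 1 / w * (if a = d \<and> b = c then 1 else 0)"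
proof -
  have "(mat x ** M) $ p $ q = x * M $ p $ q" for x :: "complex fls fls" and M :: "complex fls fls^(ix2 \<times> ix2)^(ix2 \<times> ix2)" and p q
    by (simp add: matrix_matrix_mult_def mat_def if_distrib[of "\<lambda>x. x * _"] cong: if_cong)
  moreover have "(mat 1 :: complex fls fls^(ix2 \<times> ix2)^(ix2 \<times> ix2)) $ (a, b) $ (c, d) = (if a = c \<and> b = d then 1 else 0)"
    by (simp add: mat_def)
  ultimately show ?thesis
    by (simp only: R_gl2_def vector_minus_component flip_matrix_nth)
qed

text \<open>Multiplication by P swaps the row pair from the left and the column pair from the right,
  and the scalar 1/(u - v) commutes with everything.\<close>

lemma rtt_defect_nth:
  fixes T :: "'a::calgebra_1 fps^ix2^ix2"
  defines "\<omega> \<equiv> lift_scalar (1 / (var_u - var_v))"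
  shows "rtt_defect R_gl2 T $ (i, k) $ (j, l) =
    in_u (T $ i $ j) * in_v (T $ k $ l) - in_v (T $ k $ l) * in_u (T $ i $ j)
    - \<omega> * (in_u (T $ k $ j) * in_v (T $ i $ l)) + \<omega> * (in_v (T $ k $ j) * in_u (T $ i $ l))"
proof -
  define Rm where "Rm = (map_matrix lift_scalar (R_gl2 (var_u - var_v)) :: 'a fls fls^(ix2 \<times> ix2)^(ix2 \<times> ix2))"
  let ?A = "kron (map_matrix in_u T) (mat 1)" and ?B = "kron (mat 1) (map_matrix in_v T)"
  note h = unital_ring_homD[OF unital_ring_hom_lift_scalar]
  have h_if: "lift_scalar (if P then 1 else 0) = (if P then 1 else 0 :: 'a fls fls)" for P
    by (simp add: h)
  have R: "Rm $ (a, b) $ (c, d) = (if a = c \<and> b = d then 1 else 0) - \<omega> * (if a = d \<and> b = c then 1 else 0)"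
    for a b c d
    unfolding Rm_def nth_map_matrix R_gl2_nth h(5,3) \<omega>_def[symmetric] h_if by (rule refl)
  have wc: "f * \<omega> = \<omega> * f" for f :: "'a fls fls"
    unfolding \<omega>_def by (rule lift_scalar_commute)
  have L: "(Rm ** M) $ (i, k) $ (j, l) = M $ (i, k) $ (j, l) - \<omega> * M $ (k, i) $ (j, l)" for M
    by (cases i; cases k) (simp_all add: matrix_matrix_mult_def sum_ix2_pair R left_diff_distrib)
  have RR: "(M ** Rm) $ (i, k) $ (j, l) = M $ (i, k) $ (j, l) - \<omega> * M $ (i, k) $ (l, j)" for M
    by (cases j; cases l) (simp_all add: matrix_matrix_mult_def sum_ix2_pair R right_diff_distrib wc)
  have "rtt_defect R_gl2 T $ (i, k) $ (j, l) = (Rm ** (?A ** ?B)) $ (i, k) $ (j, l) - ((?B ** ?A) ** Rm) $ (i, k) $ (j, l)"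
    by (simp only: Rm_def rtt_defect_def Let_def matrix_mul_assoc vector_minus_component)
  then show ?thesis
    unfolding L RR kron_mult_kron_nth by (simp add: right_diff_distrib)
qed

text \<open>Each term of the relation contains one entry of T(u) and one of T(v), so the common
  factor z(u) z(v) comes out.\<close>

lemma rtt_defect_central_mult:
  fixes T :: "'a::calgebra_1 fps^ix2^ix2"
  assumes "\<And>i x. fps_nth z i * x = x * fps_nth z i" and "rtt_defect R_gl2 T = 0"
  shows "rtt_defect R_gl2 (\<chi> i j. z * T $ i $ j) = 0"
proof -
  have u: "f * (in_u z * g) = in_u z * (f * g)" and v: "f * (in_v z * g) = in_v z * (f * g)" for f g
    using in_u_commute[OF assms(1)] in_v_commute[OF assms(1)] by (metis mult.assoc)+
  have 1: "in_u (z * a) * in_v (z * b) = in_u z * (in_v z * (in_u a * in_v b))" for a b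
    by (simp only: mult.assoc v[of "in_u a"] flip: in_u_mult in_v_mult)
  have 2: "in_v (z * b) * in_u (z * a) = in_u z * (in_v z * (in_v b * in_u a))" for a b
    by (simp only: mult.assoc u[of "in_v b"] u[of "in_v z"] flip: in_u_mult in_v_mult)
  have 3: "lift_scalar c * (in_u z * (in_v z * x)) = in_u z * (in_v z * (lift_scalar c * x))" for c x
    by (simp only: u[of "lift_scalar c"] v[of "lift_scalar c"])
  have "rtt_defect R_gl2 (\<chi> i j. z * T $ i $ j) $ (i, k) $ (j, l) =
      in_u z * (in_v z * rtt_defect R_gl2 T $ (i, k) $ (j, l))" for i j k l
    by (simp only: rtt_defect_nth vec_lambda_beta 1 2 3 distrib_left right_diff_distrib)
  then show ?thesis by (simp add: assms(2) vec_eq_iff)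
qed

text \<open>Multiplying the relation by u - v removes the denominator. On coefficients, u and v act
  by shifting one index each.\<close>

lemma rtt_coeff:
  fixes T :: "'a::calgebra_1 fps^ix2^ix2"
  assumes "rtt_defect R_gl2 T = 0"
  defines "t \<equiv> \<lambda>i j. fps_nth (T $ i $ j)"
  shows "t i j (Suc r) * t k l s - t k l s * t i j (Suc r) - (t i j r * t k l (Suc s) - t k l (Suc s) * t i j r) =
      t k j r * t i l s - t k j s * t i l r"
proof -
  note h = unital_ring_homD[OF unital_ring_hom_lift_scalar]
  let ?d = "var_u - var_v"
  have d_nth: "?d $$ (- 1) $$ 0 = 1" by (simp add: var_u_def var_v_def)
  then have "?d \<noteq> 0" by auto
  then have d: "lift_scalar ?d * (lift_scalar (1 / ?d) * x) = x" for x :: "'a fls fls"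
    by (simp add: mult.assoc[symmetric] h(1) flip: h(3))
  have d': "lift_scalar ?d = (fls_X_inv - fls_const fls_X_inv :: 'a fls fls)"
    by (intro fls_eqI) (simp add: var_u_def var_v_def scaleC_one)
  let ?C = "in_u (T $ i $ j) * in_v (T $ k $ l) - in_v (T $ k $ l) * in_u (T $ i $ j)"
  let ?A = "in_u (T $ k $ j) * in_v (T $ i $ l) - in_v (T $ k $ j) * in_u (T $ i $ l)"
  have "?C - lift_scalar (1 / ?d) * ?A = 0"
    using assms(1) rtt_defect_nth[of T i k j l] by (simp add: algebra_simps)
  then have "lift_scalar ?d * (?C - lift_scalar (1 / ?d) * ?A) = lift_scalar ?d * 0" by (simp only:)
  then have "lift_scalar ?d * ?C = ?A" by (simp add: right_diff_distrib d)
  then have "(fls_X_inv * ?C - fls_const fls_X_inv * ?C) $$ int r $$ int s = ?A $$ int r $$ int s"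
    by (simp only: d' left_diff_distrib)
  moreover have "(fls_X_inv * f - fls_const fls_X_inv * f) $$ int r $$ int s =
      f $$ int (Suc r) $$ int s - f $$ int r $$ int (Suc s)" for f :: "'a fls fls"
    by (simp add: fls_X_inv_times_conv_shift add.commute)
  moreover have "(in_u f * in_v g) $$ int m $$ int n = fps_nth f m * fps_nth g n"
    "(in_v g * in_u f) $$ int m $$ int n = fps_nth g n * fps_nth f m" for f g :: "'a fps" and m n
    by (simp_all add: in_v_def in_u_nth fps_to_fls_nth)
  ultimately show ?thesis by (simp only: fls_minus_nth t_def)
qed

section \<open>Consequences of the RTT relation\<close>

lemma calgebra_double_eq_0:
  fixes x :: "'a::calgebra_1"
  assumes "x + x = 0"
  shows "x = 0"
proof -
  have "(1 / 2 + 1 / 2 :: complex) *\<^sub>C x = (1 / 2) *\<^sub>C (x + x)"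
    by (simp only: scaleC_add_left scaleC_add_right)
  then show ?thesis by (simp add: assms scaleC_one)
qed

lemma calgebra_fps_double_eq_0:
  fixes f :: "'a::calgebra_1 fps"
  assumes "f + f = 0"
  shows "f = 0"
proof (rule fps_ext)
  fix n
  have "fps_nth f n + fps_nth f n = 0" using arg_cong[OF assms, of "\<lambda>f. fps_nth f n"] by simp
  then have "fps_nth f n = 0" by (rule calgebra_double_eq_0)
  then show "fps_nth f n = fps_nth 0 n" by simp
qed

lemma fps_scalar_2: "fps_scalar 2 = 2"
  using fps_scalar_simps(2)[of 1 1] by (simp add: fps_scalar_simps(5))

text \<open>By \<open>y2_hom\<close> below, such a matrix amounts to an algebra homomorphism from
  Y(2). An arbitrary target lets the same consequences hold for Y(2) and SY(2), and lets rescaled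
  matrices define homomorphisms.\<close>

locale rtt_matrix =
  fixes T :: "'a::calgebra_1 fps^ix2^ix2"
  assumes rtt: "rtt_defect R_gl2 T = 0"
    and T_0: "fps_nth (T $ i $ j) 0 = (if i = j then 1 else 0)"
begin

text \<open>This is \<open>rtt_coeff\<close> with the two entries interchanged. The left side is the
  same, so the right side has two forms, and both are exploited below.\<close>

lemma rtt_coeff':
  "fps_nth (T $ i $ j) (Suc r) * fps_nth (T $ k $ l) s - fps_nth (T $ k $ l) s * fps_nth (T $ i $ j) (Suc r)
    - (fps_nth (T $ i $ j) r * fps_nth (T $ k $ l) (Suc s) - fps_nth (T $ k $ l) (Suc s) * fps_nth (T $ i $ j) r) =
    fps_nth (T $ i $ l) s * fps_nth (T $ k $ j) r - fps_nth (T $ i $ l) r * fps_nth (T $ k $ j) s"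
  using rtt_coeff[OF rtt, of k l s i j r] by (simp add: algebra_simps)

text \<open>With \<open>w\<close> and \<open>v\<close> as the reciprocals of the two arguments, u -
  v becomes 1/w - 1/v. Both sides are multiplied by w v to stay within power series.\<close>

lemma rtt_subst:
  assumes w: "fps_nth w 0 = 0" and v: "fps_nth v 0 = 0"
  defines "f \<equiv> \<lambda>i j. fps_subst w (T $ i $ j)" and "g \<equiv> \<lambda>i j. fps_subst v (T $ i $ j)"
  shows "fps_scalar (v - w) * (f i j * g k l - g k l * f i j) =
      fps_scalar (w * v) * (f k j * g i l - g k j * f i l)" (is ?P)
    and "fps_scalar (v - w) * (f i j * g k l - g k l * f i j) =
      fps_scalar (w * v) * (g i l * f k j - f i l * g k j)" (is ?Q)
proof -
  let ?t = "\<lambda>i j. fps_nth (T $ i $ j)"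
  let ?F = "\<lambda>r s. ?t i j r * ?t k l s - ?t k l s * ?t i j r"
  have *: "fps_scalar (v - w) * (f i j * g k l - g k l * f i j) = fps_scalar (w * v) * fps_subst2 w v G"
    if G: "\<And>r s. ?F (Suc r) s - ?F r (Suc s) = G r s" for G
  proof -
    \<comment> \<open>Constant terms of \<open>T\<close> are scalars. Hence the double series
      multiplied by v - w has no coefficients with \<open>r\<close> or \<open>s\<close> equal to 0,
      which allows w v to be taken out.\<close>
    have F0: "?F 0 s = 0" "?F r 0 = 0" for r s by (simp_all add: T_0)
    have "fps_scalar (v - w) * (f i j * g k l - g k l * f i j) = fps_scalar (v - w) * fps_subst2 w v ?F"
      by (simp add: fps_subst2_linear fps_subst2_mult[OF w v] f_def g_def)
    also have "\<dots> = fps_subst2 w v (\<lambda>r s. (case s of 0 \<Rightarrow> 0 | Suc s \<Rightarrow> ?F r s) - (case r of 0 \<Rightarrow> 0 | Suc r \<Rightarrow> ?F r s))"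
      unfolding fps_scalar_simps(3) left_diff_distrib fps_scalar_mult_subst2[OF w v]
      by (rule fps_subst2_linear(2)[symmetric])
    also have "(\<lambda>r s. (case s of 0 \<Rightarrow> 0 | Suc s \<Rightarrow> ?F r s) - (case r of 0 \<Rightarrow> 0 | Suc r \<Rightarrow> ?F r s)) =
        (\<lambda>r s. case r of 0 \<Rightarrow> 0 | Suc r \<Rightarrow> case s of 0 \<Rightarrow> 0 | Suc s \<Rightarrow> G r s)"
      by (intro ext) (simp add: F0 G[symmetric] split: nat.split)
    also have "fps_subst2 w v \<dots> = fps_scalar (w * v) * fps_subst2 w v G"
      by (simp only: fps_scalar_simps mult.assoc fps_scalar_mult_subst2[OF w v])
    finally show ?thesis .
  qed
  show ?P
    by (subst *[OF rtt_coeff[OF rtt]]) (simp only: fps_subst2_linear fps_subst2_mult[OF w v] f_def g_def)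
  show ?Q
    by (subst *[OF rtt_coeff']) (simp only: fps_subst2_linear fps_subst2_mult[OF w v] f_def g_def)
qed

section \<open>The arguments u - 1 and u, and the quantum determinant\<close>

abbreviation a where "a i j \<equiv> at_affine 1 (- 1) (T $ i $ j)"
abbreviation b where "b i j \<equiv> T $ i $ j"

text \<open>The two arguments differ by the constant -1, so no denominator remains. This is the RTT
  relation at the degenerate value R(-1) = I + P.\<close>

lemma rtt_shift:
  "b k l * a i j - a i j * b k l = a k j * b i l - b k j * a i l"
  "b k l * a i j - a i j * b k l = b i l * a k j - a i l * b k j"
proof -
  let ?w = "affine_arg 1 (- 1)"
  have w: "fps_nth ?w 0 = 0" by simp
  have X: "?w - ?w * fps_X = fps_X"
    using affine_arg_times[of 1 "- 1"] by (simp add: algebra_simps flip: fps_const_neg)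
  then have 1: "fps_X - ?w = - (?w * fps_X)" by (simp add: algebra_simps)
  have 2: "?w * fps_X \<noteq> 0" using X by (metis fps_X_neq_zero mult_eq_0_iff diff_zero mult_zero_left)
  note r = rtt_subst[OF w, of fps_X, unfolded 1, simplified, folded at_affine_eq_fps_subst[THEN fun_cong]]
  have "fps_scalar (?w * fps_X) * (b k l * a i j - a i j * b k l) =
      fps_scalar (?w * fps_X) * (a k j * b i l - b k j * a i l)"
    using r(1)[of i j k l] by (simp add: fps_scalar_simps algebra_simps)
  then show "b k l * a i j - a i j * b k l = a k j * b i l - b k j * a i l"
    by (rule fps_scalar_cancel[OF 2])
  have "fps_scalar (?w * fps_X) * (b k l * a i j - a i j * b k l) =
      fps_scalar (?w * fps_X) * (b i l * a k j - a i l * b k j)"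
    using r(2)[of i j k l] by (simp add: fps_scalar_simps algebra_simps)
  then show "b k l * a i j - a i j * b k l = b i l * a k j - a i l * b k j"
    by (rule fps_scalar_cancel[OF 2])
qed

text \<open>In the second form of \<open>rtt_shift\<close>, equal row indices or equal column
  indices make one term on each side coincide and cancel.\<close>

lemma a_b_exchange: "a i j * b i l = a i l * b i j" "b k j * a i j = b i j * a k j"
  using rtt_shift[of i l i j] rtt_shift[of k j i j] by (simp_all add: algebra_simps)

lemma qdet_forms:
  "a Pos Pos * b Neg Neg - a Pos Neg * b Neg Pos = qdet T"
  "b Pos Pos * a Neg Neg - b Neg Pos * a Pos Neg = qdet T"
  "b Neg Neg * a Pos Pos - b Pos Neg * a Neg Pos = qdet T"
proof -
  have q: "qdet T = a Neg Neg * b Pos Pos - a Neg Pos * b Pos Neg" by (simp add: qdet_def)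
  show 2: "b Pos Pos * a Neg Neg - b Neg Pos * a Pos Neg = qdet T"
    using rtt_shift(2)[of Pos Pos Neg Neg] by (simp add: q algebra_simps)
  show 3: "b Neg Neg * a Pos Pos - b Pos Neg * a Neg Pos = qdet T"
    using rtt_shift(2)[of Pos Neg Neg Pos] by (simp add: q algebra_simps)
  show "a Pos Pos * b Neg Neg - a Pos Neg * b Neg Pos = qdet T"
    using rtt_shift(2)[of Neg Neg Pos Pos] 3 by (simp add: algebra_simps)
qed

text \<open>The transpose is the adjugate of a 2 by 2 matrix, so this is a quantum Cramer rule. The
  diagonal entries are forms of the quantum determinant, and the others vanish by the exchange
  relations.\<close>

lemma shift_mult_transpose_minus:
  "map_matrix (at_affine 1 (- 1)) T ** transpose_minus T = mat (qdet T)"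
  "transpose_minus T ** map_matrix (at_affine 1 (- 1)) T = mat (qdet T)"
proof -
  have "(map_matrix (at_affine 1 (- 1)) T ** transpose_minus T) $ i $ j = mat (qdet T) $ i $ j" for i j
    using a_b_exchange(1)[of Neg Neg Pos] a_b_exchange(1)[of Pos Neg Pos] qdet_forms(1)
    by (cases i; cases j) (simp_all add: matrix_matrix_mult_def transpose_minus_def mat_def sum_ix2 qdet_def)
  then show "map_matrix (at_affine 1 (- 1)) T ** transpose_minus T = mat (qdet T)"
    by (simp add: vec_eq_iff)
  have "(transpose_minus T ** map_matrix (at_affine 1 (- 1)) T) $ i $ j = mat (qdet T) $ i $ j" for i j
    using a_b_exchange(2)[of Pos Neg Neg] a_b_exchange(2)[of Pos Pos Neg] qdet_forms(2,3)
    by (cases i; cases j) (simp_all add: matrix_matrix_mult_def transpose_minus_def mat_def sum_ix2 algebra_simps)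
  then show "transpose_minus T ** map_matrix (at_affine 1 (- 1)) T = mat (qdet T)"
    by (simp add: vec_eq_iff)
qed

text \<open>The trace at -u consists of the same products as the trace at u with the factors
  reversed, so the difference is a signed sum of four commutators. The RTT relation at u and -u,
  where u - v is 2u, turns twice this sum into -u^-1 times itself. The resulting factor 2 + u^-1 can
  be cancelled.\<close>

lemma trace_S_minus_even:
  "at_affine (- 1) 0 (S_minus T $ Neg $ Neg + S_minus T $ Pos $ Pos) =
    S_minus T $ Neg $ Neg + S_minus T $ Pos $ Pos"
proof -
  let ?v = "affine_arg (- 1) 0"
  define g where "g i j = at_affine (- 1) 0 (T $ i $ j)" for i j
  have g_g: "at_affine (- 1) 0 (g i j) = b i j" for i j
    by (simp add: g_def at_affine_at_affine)
  have v: "?v = - fps_X" by (rule affine_arg_unique[symmetric]) (simp_all flip: fps_const_neg)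
  have comm: "2 * (b i j * g k l - g k l * b i j) = fps_X * (b k j * g i l - g k j * b i l)" for i j k l
  proof -
    have 1: "- fps_X - fps_X = - (fps_X * 2 :: complex fps)" by simp
    have "fps_scalar fps_X * (2 * (b i j * g k l - g k l * b i j)) =
        fps_scalar fps_X * (fps_X * (b k j * g i l - g k j * b i l))"
      using rtt_subst(1)[of fps_X "- fps_X" i j k l] 
      by (simp add: 1 fps_scalar_2 fps_scalar_simps at_affine_eq_fps_subst v g_def mult.assoc)
    then show ?thesis by (rule fps_scalar_cancel[rotated]) simp
  qed
  let ?D = "b Neg Neg * g Pos Pos - b Neg Pos * g Pos Neg - b Pos Neg * g Neg Pos + b Pos Pos * g Neg Neg"
  let ?D' = "g Neg Neg * b Pos Pos - g Neg Pos * b Pos Neg - g Pos Neg * b Neg Pos + g Pos Pos * b Neg Neg"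
  have D: "S_minus T $ Neg $ Neg + S_minus T $ Pos $ Pos = ?D"
    by (simp add: S_minus_def transpose_minus_def matrix_matrix_mult_def sum_ix2 g_def)
  have D': "at_affine (- 1) 0 ?D = ?D'"
    by (simp add: at_affine_simps g_g) (simp add: g_def)
  have "2 * (?D - ?D') = 2 * (b Neg Neg * g Pos Pos - g Pos Pos * b Neg Neg)
      + 2 * (b Pos Pos * g Neg Neg - g Neg Neg * b Pos Pos)
      - 2 * (b Neg Pos * g Pos Neg - g Pos Neg * b Neg Pos)
      - 2 * (b Pos Neg * g Neg Pos - g Neg Pos * b Pos Neg)"
    by (simp add: algebra_simps)
  also have "\<dots> = - (fps_X * (?D - ?D'))"
    by (simp only: comm) (simp add: algebra_simps)
  finally have "(2 + fps_X) * (?D - ?D') = 0" by (simp add: distrib_right)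
  moreover have "2 + fps_X = (fps_scalar (2 + fps_X) :: 'a fps)"
    by (simp add: fps_scalar_simps fps_scalar_2)
  ultimately have "fps_scalar (2 + fps_X) * (?D - ?D') = fps_scalar (2 + fps_X) * 0"
    by simp
  moreover have "fps_nth (2 + fps_X :: complex fps) 0 \<noteq> 0" by (simp add: numeral_fps_const)
  then have "2 + fps_X \<noteq> (0 :: complex fps)" by (metis fps_zero_nth)
  ultimately have "?D - ?D' = 0" by (rule fps_scalar_cancel[rotated])
  then show ?thesis unfolding D D' by simp
qed

text \<open>The coefficient of v^-s in the RTT relation, multiplied by the reciprocal of the first
  argument. It is a recursion in \<open>s\<close> for commutators with one coefficient, in two forms
  as before.\<close>

lemma rtt_const:
  assumes w: "fps_nth w 0 = 0"
  defines "f \<equiv> \<lambda>i j. fps_subst w (T $ i $ j)" and "c \<equiv> \<lambda>k l s. fps_const (fps_nth (T $ k $ l) s)"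
  shows "fps_scalar w * (f i j * c k l (Suc s) - c k l (Suc s) * f i j) =
      f i j * c k l s - c k l s * f i j - fps_scalar w * (f k j * c i l s - c k j s * f i l)" (is ?P)
    and "fps_scalar w * (f i j * c k l (Suc s) - c k l (Suc s) * f i j) =
      f i j * c k l s - c k l s * f i j - fps_scalar w * (c i l s * f k j - f i l * c k j s)" (is ?Q)
proof -
  note lin = fps_subst_linear fps_subst_mult[OF w] fps_subst_X[OF w] fps_subst_const
  have "fps_X * (T $ i $ j * c k l (Suc s) - c k l (Suc s) * T $ i $ j) =
      T $ i $ j * c k l s - c k l s * T $ i $ j - fps_X * (T $ k $ j * c i l s - c k j s * T $ i $ l)"
  proof (rule fps_ext)
    fix n show "fps_nth (fps_X * (T $ i $ j * c k l (Suc s) - c k l (Suc s) * T $ i $ j)) n =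
      fps_nth (T $ i $ j * c k l s - c k l s * T $ i $ j - fps_X * (T $ k $ j * c i l s - c k j s * T $ i $ l)) n"
    proof (cases n)
      case (Suc r)
      then show ?thesis using rtt_coeff[OF rtt, of i j r k l s] by (simp add: c_def fps_X_mult_nth algebra_simps)
    qed (simp add: c_def T_0)
  qed
  then show ?P
    unfolding f_def c_def by (drule_tac arg_cong[of _ _ "fps_subst w"]) (simp only: lin)
  have "fps_X * (T $ i $ j * c k l (Suc s) - c k l (Suc s) * T $ i $ j) =
      T $ i $ j * c k l s - c k l s * T $ i $ j - fps_X * (c i l s * T $ k $ j - T $ i $ l * c k j s)"
  proof (rule fps_ext)
    fix n show "fps_nth (fps_X * (T $ i $ j * c k l (Suc s) - c k l (Suc s) * T $ i $ j)) n =
      fps_nth (T $ i $ j * c k l s - c k l s * T $ i $ j - fps_X * (c i l s * T $ k $ j - T $ i $ l * c k j s)) n"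
    proof (cases n)
      case (Suc r)
      then show ?thesis using rtt_coeff'[of i j r k l s] by (simp add: c_def fps_X_mult_nth algebra_simps)
    qed (simp add: c_def T_0)
  qed
  then show ?Q
    unfolding f_def c_def by (drule_tac arg_cong[of _ _ "fps_subst w"]) (simp only: lin)
qed

text \<open>For equal index pairs the two forms of \<open>rtt_const\<close> differ only in the sign
  of a commutator, so twice that commutator is 0.\<close>

lemma subst_commute_coeff:
  assumes w: "fps_nth w 0 = 0" "w \<noteq> 0"
  shows "fps_subst w (T $ i $ j) * fps_const (fps_nth (T $ i $ j) s) =
    fps_const (fps_nth (T $ i $ j) s) * fps_subst w (T $ i $ j)"
proof -
  let ?f = "fps_subst w (T $ i $ j)" and ?c = "fps_const (fps_nth (T $ i $ j) s)"
  have "fps_scalar w * (?f * ?c - ?c * ?f) = fps_scalar w * (?c * ?f - ?f * ?c)"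
    using rtt_const(1)[OF w(1), of i j i j s] unfolding rtt_const(2)[OF w(1), of i j i j s] by simp
  then have "?f * ?c - ?c * ?f = ?c * ?f - ?f * ?c" by (rule fps_scalar_cancel[OF w(2)])
  then have "(?f * ?c - ?c * ?f) + (?f * ?c - ?c * ?f) = (?c * ?f - ?f * ?c) + (?f * ?c - ?c * ?f)"
    by (rule arg_cong)
  then have "(?f * ?c - ?c * ?f) + (?f * ?c - ?c * ?f) = 0" by simp
  from calgebra_fps_double_eq_0[OF this] show ?thesis by simp
qed

text \<open>Induction on \<open>s\<close>: by \<open>rtt_const\<close> the commutators of entries
  with the next coefficient reduce to those with the current one. Collected over the quantum
  determinant, the latter form its commutator with the current coefficient, and the correction terms
  cancel.\<close>

lemma qdet_commute_coeff:
  "qdet T * fps_const (fps_nth (T $ k $ l) s) = fps_const (fps_nth (T $ k $ l) s) * qdet T"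
proof (induction s arbitrary: k l)
  case 0
  then show ?case by (simp add: T_0)
next
  case (Suc s)
  let ?w = "affine_arg 1 (- 1)"
  \<comment> \<open>\<open>x\<close> is 1/u and \<open>y\<close> is 1/(u - 1), the factors that
    \<open>rtt_const\<close> produces for \<open>b\<close> and \<open>a\<close>. They satisfy y - x
    = y x.\<close>
  define x y :: "'a fps" where "x = fps_X" and "y = fps_scalar ?w"
  define c where "c = (\<lambda>k l s. fps_const (fps_nth (T $ k $ l) s))"
  have w: "fps_nth ?w 0 = 0" by simp
  have wX: "fps_X = ?w - ?w * fps_X"
    using affine_arg_times[of 1 "- 1"] by (simp add: algebra_simps flip: fps_const_neg)
  have w_nz: "?w \<noteq> 0" using wX by (metis fps_X_neq_zero diff_zero mult_zero_left)
  have wX_nz: "?w * fps_X \<noteq> 0" using w_nz by simp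
  have xy: "x = y - y * x"
    using arg_cong[OF wX, of "fps_scalar :: complex fps \<Rightarrow> 'a fps"] unfolding x_def y_def fps_scalar_simps .
  have x_central: "f * (x * g) = x * (f * g)" for f g
    unfolding x_def by (metis fps_scalar_left_commute fps_scalar_simps(7))
  have y_central: "f * (y * g) = y * (f * g)" for f g
    unfolding y_def by (rule fps_scalar_left_commute)
  have cc: "fps_const (fps_nth (T $ k $ l) s) = c k l s" for k l s by (simp add: c_def)
  have X: "fps_nth fps_X 0 = (0 :: complex)" by simp
  note A = rtt_const[OF w, unfolded at_affine_eq_fps_subst[THEN fun_cong, symmetric] cc y_def[symmetric]]
  note B = rtt_const[OF X, unfolded fps_subst_fps_X fps_scalar_simps(7) cc x_def[symmetric]]
  \<comment> \<open>The form of the quantum determinant is adapted to the coefficient in question: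
    the entries of \<open>a\<close> come from its row \<open>k\<close>, those of \<open>b\<close>
    from the other row.\<close>
  define i' where "i' = neg2 k"
  have q: "qdet T = a k k * b i' i' - a k i' * b i' k"
    using qdet_forms(1) by (cases k) (simp_all add: qdet_def i'_def)
  \<comment> \<open>The corrections stay arbitrary because the two cases use different forms of
    \<open>rtt_const\<close>. Writing x as y - y x in front of \<open>?U\<close> completes
    \<open>?U\<close> + \<open>?V\<close>, the commutator with the current coefficient. The rest is
    y x times \<open>?Z\<close>.\<close>
  have main: "qdet T * c k l (Suc s) = c k l (Suc s) * qdet T"
    if a1: "y * (a k k * c k l (Suc s) - c k l (Suc s) * a k k) = a k k * c k l s - c k l s * a k k - y * \<alpha>\<^sub>1"
      and b1: "x * (b i' i' * c k l (Suc s) - c k l (Suc s) * b i' i') = b i' i' * c k l s - c k l s * b i' i' - x * \<beta>\<^sub>1"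
      and a2: "y * (a k i' * c k l (Suc s) - c k l (Suc s) * a k i') = a k i' * c k l s - c k l s * a k i' - y * \<alpha>\<^sub>2"
      and b2: "x * (b i' k * c k l (Suc s) - c k l (Suc s) * b i' k) = b i' k * c k l s - c k l s * b i' k - x * \<beta>\<^sub>2"
      and Z: "(a k k * c k l s - c k l s * a k k) * b i' i' - (a k i' * c k l s - c k l s * a k i') * b i' k
        + \<alpha>\<^sub>1 * b i' i' + a k k * \<beta>\<^sub>1 - \<alpha>\<^sub>2 * b i' k - a k i' * \<beta>\<^sub>2 = 0" for \<alpha>\<^sub>1 \<beta>\<^sub>1 \<alpha>\<^sub>2 \<beta>\<^sub>2
  proof -
    let ?g = "c k l s" and ?g' = "c k l (Suc s)"
    let ?Z = "(a k k * ?g - ?g * a k k) * b i' i' - (a k i' * ?g - ?g * a k i') * b i' k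
        + \<alpha>\<^sub>1 * b i' i' + a k k * \<beta>\<^sub>1 - \<alpha>\<^sub>2 * b i' k - a k i' * \<beta>\<^sub>2"
    let ?U = "(a k k * ?g - ?g * a k k) * b i' i' - (a k i' * ?g - ?g * a k i') * b i' k"
    let ?V = "a k k * (b i' i' * ?g - ?g * b i' i') - a k i' * (b i' k * ?g - ?g * b i' k)"
    have yxc: "y * (x * f) = x * (y * f)" for f by (rule x_central)
    have "y * (x * (qdet T * ?g' - ?g' * qdet T)) =
        x * (y * (a k k * ?g' - ?g' * a k k) * b i' i') + y * (a k k * (x * (b i' i' * ?g' - ?g' * b i' i')))
        - x * (y * (a k i' * ?g' - ?g' * a k i') * b i' k) - y * (a k i' * (x * (b i' k * ?g' - ?g' * b i' k)))"
      unfolding q x_central[of "a _ _"] mult.assoc yxc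
      by (simp only: algebra_simps)
    also have "\<dots> = x * ?U + y * ?V - x * (y * (\<alpha>\<^sub>1 * b i' i' + a k k * \<beta>\<^sub>1 - \<alpha>\<^sub>2 * b i' k - a k i' * \<beta>\<^sub>2))"
      unfolding a1 a2 b1 b2 unfolding right_diff_distrib left_diff_distrib distrib_left x_central[of "a _ _"] mult.assoc yxc
      by (simp only: algebra_simps)
    also have "x * ?U = y * ?U - x * (y * ?U)"
      by (subst xy) (simp only: left_diff_distrib mult.assoc yxc)
    also have "y * ?U - x * (y * ?U) + y * ?V - x * (y * (\<alpha>\<^sub>1 * b i' i' + a k k * \<beta>\<^sub>1 - \<alpha>\<^sub>2 * b i' k - a k i' * \<beta>\<^sub>2))
        = y * (?U + ?V) - x * (y * ?Z)"
      by (simp only: distrib_left right_diff_distrib) (simp only: algebra_simps)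
    also have "?U + ?V = qdet T * ?g - ?g * qdet T"
      unfolding q by (simp add: algebra_simps)
    also have "\<dots> = 0" using Suc.IH by (simp add: c_def)
    finally have "y * (x * (qdet T * ?g' - ?g' * qdet T)) = y * (x * 0)" by (simp add: Z)
    then have "fps_scalar (?w * fps_X) * (qdet T * ?g' - ?g' * qdet T) = fps_scalar (?w * fps_X) * 0"
      by (simp only: fps_scalar_simps x_def y_def mult.assoc)
    then have "qdet T * ?g' - ?g' * qdet T = 0" by (rule fps_scalar_cancel[OF wX_nz])
    then show ?thesis by simp
  qed
  \<comment> \<open>With the forms of \<open>rtt_const\<close> chosen below, the remainder vanishes
    by this commutation and the exchange relation \<open>ex\<close>.\<close>
  have com: "a i j * c i j s = c i j s * a i j" for i j
    using subst_commute_coeff[OF w w_nz] by (simp add: c_def at_affine_eq_fps_subst)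
  have ex: "a k k * b k i' * z = a k i' * b k k * z" for z
    by (simp only: a_b_exchange(1)[of k k i'])
  have "l = k \<or> l = i'" by (cases k; cases l) (simp_all add: i'_def)
  then have "qdet T * c k l (Suc s) = c k l (Suc s) * qdet T"
  proof
    assume l: "l = k"
    show ?thesis unfolding l
      by (rule main[unfolded l, OF A(1) B(1) A(2) B(1)])
        (use ex[of "c i' k s"] com[of k k] in \<open>simp add: algebra_simps\<close>)
  next
    assume l: "l = i'"
    show ?thesis unfolding l
      by (rule main[unfolded l, OF A(2) B(1) A(1) B(1)])
        (use ex[of "c i' i' s"] com[of k i'] in \<open>simp add: algebra_simps\<close>)
  qed
  then show ?case by (simp add: c_def)
qed

end

section \<open>Subalgebras and series with coefficients in them\<close>

lemma calg_hom_comp: "calg_hom f \<Longrightarrow> calg_hom g \<Longrightarrow> calg_hom (g \<circ> f)"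
  by (simp add: calg_hom_def)

lemma calg_hom_factor:
  assumes p: "calg_hom p" "surj p" and h: "calg_hom h" and ker: "\<And>x. p x = 0 \<Longrightarrow> h x = 0"
  shows "\<exists>k. calg_hom k \<and> (\<forall>x. k (p x) = h x)"
proof -
  define k where "k y = h (inv p y)" for y
  have k: "k (p x) = h x" for x
  proof -
    have "p (inv p (p x) - x) = 0" by (simp add: calg_homD[OF p(1)] surj_f_inv_f[OF p(2)])
    then have "h (inv p (p x) - x) = 0" by (rule ker)
    then show ?thesis by (simp add: k_def calg_homD[OF h])
  qed
  have "calg_hom k"
    unfolding calg_hom_def
  proof (intro conjI allI)
    show "k 1 = 1" using k[of 1] by (simp add: calg_homD[OF p(1)] calg_homD[OF h])
    fix x y :: 'b and c
    obtain x' y' where [simp]: "x = p x'" "y = p y'" using p(2) by (metis surjD)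
    show "k (x + y) = k x + k y" using k[of "x' + y'"] by (simp add: calg_homD[OF p(1)] calg_homD[OF h] k)
    show "k (x * y) = k x * k y" using k[of "x' * y'"] by (simp add: calg_homD[OF p(1)] calg_homD[OF h] k)
    show "k (c *\<^sub>C x) = c *\<^sub>C k x" using k[of "c *\<^sub>C x'"] by (simp add: calg_homD[OF p(1)] calg_homD[OF h] k)
  qed
  then show ?thesis using k by blast
qed

lemma subalgebra_vimage: "calg_hom f \<Longrightarrow> subalgebra H \<Longrightarrow> subalgebra (f -` H)"
  by (simp add: subalgebra_def calg_homD)

lemma subalgebra_range:
  assumes "calg_hom f"
  shows "subalgebra (range f)"
  unfolding subalgebra_def
  using calg_homD[OF assms, symmetric] by (auto simp: image_iff)

lemma subalgebra_equalizer: "calg_hom f \<Longrightarrow> calg_hom g \<Longrightarrow> subalgebra {x. f x = g x}"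
  by (simp add: subalgebra_def calg_homD)

lemma subalgebra_centralizer: "subalgebra {x. \<forall>y\<in>Y. x * y = y * x}"
  by (auto simp: subalgebra_def mult_scaleC_left mult_scaleC_right distrib_left distrib_right)
    (metis mult.assoc)

lemma subalgebra_sum: "subalgebra H \<Longrightarrow> (\<And>i. i \<in> A \<Longrightarrow> f i \<in> H) \<Longrightarrow> sum f A \<in> H"
  by (induction A rule: infinite_finite_induct) (simp_all add: subalgebra_closed)

definition series_in :: "'a::calgebra_1 set \<Rightarrow> 'a fps \<Rightarrow> bool" where
  "series_in H f \<longleftrightarrow> (\<forall>n. fps_nth f n \<in> H)"

lemma series_inD: "series_in H f \<Longrightarrow> fps_nth f n \<in> H"
  by (simp add: series_in_def)

lemma series_in_simps:
  assumes "subalgebra H"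
  shows "series_in H 1" "series_in H 0" "series_in H f \<Longrightarrow> series_in H g \<Longrightarrow> series_in H (f + g)"
    "series_in H f \<Longrightarrow> series_in H g \<Longrightarrow> series_in H (f - g)"
    "series_in H f \<Longrightarrow> series_in H g \<Longrightarrow> series_in H (f * g)"
    "c \<in> H \<Longrightarrow> series_in H (fps_const c)"
    "series_in H f \<Longrightarrow> series_in H (at_affine \<alpha> \<beta> f)"
    "(\<And>i. i \<in> A \<Longrightarrow> series_in H (k i)) \<Longrightarrow> series_in H (sum k A)"
proof -
  note cl = subalgebra_closed[OF assms] subalgebra_sum[OF assms]
  show "(\<And>i. i \<in> A \<Longrightarrow> series_in H (k i)) \<Longrightarrow> series_in H (sum k A)"
    by (simp add: series_in_def fps_sum_nth cl)
qed (use subalgebra_closed[OF assms] subalgebra_sum[OF assms] in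
    \<open>auto simp: series_in_def fps_mult_nth at_affine_def intro!: subalgebra_sum[OF assms]\<close>)

text \<open>An affine substitution is undone by another one with scalar coefficients. This removes
  the shift by 1/2 in the embedding.\<close>

lemma series_in_at_affine_iff:
  assumes "subalgebra H" "\<alpha> \<noteq> 0"
  shows "series_in H (at_affine \<alpha> \<beta> f) \<longleftrightarrow> series_in H f"
proof
  assume "series_in H (at_affine \<alpha> \<beta> f)"
  then have "series_in H (at_affine (1 / \<alpha>) (- (\<beta> / \<alpha>)) (at_affine \<alpha> \<beta> f))"
    by (rule series_in_simps(7)[OF assms(1)])
  moreover have "at_affine (1 / \<alpha>) (- (\<beta> / \<alpha>)) (at_affine \<alpha> \<beta> f) = f"
    using assms(2) by (subst at_affine_at_affine) simp_all
  ultimately show "series_in H f" by simp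
qed (rule series_in_simps(7)[OF assms(1)])

section \<open>Inverses and shift roots of series with non-commuting coefficients\<close>

definition fps_unit_inverse :: "'a::ring_1 fps \<Rightarrow> 'a fps" where
  "fps_unit_inverse f = fps_right_inverse f 1"

lemma fps_unit_inverse:
  assumes "fps_nth f 0 = 1"
  shows "f * fps_unit_inverse f = 1" "fps_unit_inverse f * f = 1" "fps_nth (fps_unit_inverse f) 0 = 1"
  using fps_right_inverse[of f 1] fps_left_inverse'[of 1 f 1] assms by (simp_all add: fps_unit_inverse_def)

lemma series_in_unit_inverse:
  assumes H: "subalgebra H" and f: "series_in H f"
  shows "series_in H (fps_unit_inverse f)"
proof -
  have "fps_right_inverse_constructor f 1 n \<in> H" for n
  proof (induction n rule: less_induct)
    case (less n)
    show ?case
    proof (cases n)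
      case (Suc m)
      have "(\<Sum>i=1..n. fps_nth f i * fps_right_inverse_constructor f 1 (n - i)) \<in> H"
        by (rule subalgebra_sum[OF H]) (use less f Suc in \<open>auto intro!: subalgebra_closed(4)[OF H] series_inD\<close>)
      from subalgebra_closed(5)[OF H this] show ?thesis
        unfolding Suc fps_right_inverse_constructor.simps by (simp only: mult_minus1)
    qed (simp add: subalgebra_closed[OF H])
  qed
  then show ?thesis by (simp add: series_in_def fps_unit_inverse_def)
qed

lemma fps_mult_commute_coeffs:
  fixes f g :: "'a::ring_1 fps"
  assumes "\<And>i j. fps_nth f i * fps_nth g j = fps_nth g j * fps_nth f i"
  shows "f * g = g * f"
proof (rule fps_ext)
  fix n
  have "fps_nth (f * g) n = (\<Sum>i=0..n. fps_nth g (n - i) * fps_nth f i)"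
    by (simp add: fps_mult_nth assms)
  also have "\<dots> = fps_nth (g * f) n"
    unfolding fps_mult_nth
    by (rule sum.reindex_bij_witness[of _ "\<lambda>i. n - i" "\<lambda>i. n - i"]) auto
  finally show "fps_nth (f * g) n = fps_nth (g * f) n" .
qed

lemma fps_mult_nth_split:
  fixes f g :: "'a::ring_1 fps"
  assumes "n > 0"
  shows "fps_nth (f * g) n = fps_nth f 0 * fps_nth g n + fps_nth f n * fps_nth g 0 +
    (\<Sum>i\<in>{0<..<n}. fps_nth f i * fps_nth g (n - i))"
proof -
  have "{0..n} = insert 0 (insert n {0<..<n})" using assms by auto
  then show ?thesis using assms by (simp add: fps_mult_nth add.assoc)
qed

text \<open>At order n the unknown d_n enters d(u - 1) d(u) only as 2 d_n; the truncated series
  supplies everything else. The guard on \<open>k\<close> both truncates and makes the recursion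
  terminate.\<close>

fun shift_root_coeff :: "'a::calgebra_1 fps \<Rightarrow> nat \<Rightarrow> 'a" where
  "shift_root_coeff q 0 = 1"
| "shift_root_coeff q (Suc n) = (1 / 2) *\<^sub>C (fps_nth q (Suc n) -
     fps_nth (at_affine 1 (- 1) (Abs_fps (\<lambda>k. if k \<le> n then shift_root_coeff q k else 0)) *
       Abs_fps (\<lambda>k. if k \<le> n then shift_root_coeff q k else 0)) (Suc n))"

text \<open>The solution \<open>d(u)\<close> of \<open>d(u - 1) d(u) = q(u)\<close> with \<open>d(\<infinity>) = 1\<close>.\<close>
definition shift_root :: "'a::calgebra_1 fps \<Rightarrow> 'a fps" where
  "shift_root q = Abs_fps (shift_root_coeff q)"

lemma shift_root_0 [simp]: "fps_nth (shift_root q) 0 = 1"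
  by (simp add: shift_root_def)

lemma series_in_shift_root:
  assumes H: "subalgebra H" and q: "series_in H q"
  shows "series_in H (shift_root q)"
proof -
  have "shift_root_coeff q n \<in> H" for n
  proof (induction n rule: less_induct)
    case (less n)
    show ?case
    proof (cases n)
      case (Suc m)
      let ?f = "Abs_fps (\<lambda>k. if k \<le> m then shift_root_coeff q k else 0)"
      have "series_in H ?f" using less Suc by (simp add: series_in_def subalgebra_closed[OF H])
      then have "series_in H (at_affine 1 (- 1) ?f * ?f)" by (intro series_in_simps[OF H])
      then show ?thesis
        unfolding Suc shift_root_coeff.simps using q
        by (intro subalgebra_closed[OF H] series_inD)
    qed (simp add: subalgebra_closed[OF H])
  qed
  then show ?thesis by (simp add: series_in_def shift_root_def)
qed

lemma shift_root:
  assumes "fps_nth q 0 = 1"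
  shows "at_affine 1 (- 1) (shift_root q) * shift_root q = q"
proof (rule fps_ext)
  fix n
  show "fps_nth (at_affine 1 (- 1) (shift_root q) * shift_root q) n = fps_nth q n"
  proof (cases n)
    case (Suc m)
    let ?d = "shift_root q"
    let ?f = "Abs_fps (\<lambda>k. if k \<le> m then shift_root_coeff q k else 0)"
    have f: "fps_nth ?f k = fps_nth ?d k" if "k < n" for k using that Suc by (simp add: shift_root_def)
    have f_n: "fps_nth ?f n = 0" using Suc by simp
    have af: "fps_nth (at_affine 1 (- 1) ?f) k = fps_nth (at_affine 1 (- 1) ?d) k" if "k < n" for k
      using that f by (simp add: fps_nth_at_affine del: fps_nth_Abs_fps)
    have ad: "fps_nth (at_affine 1 (- 1) ?d) n = fps_nth ?d n + fps_nth (at_affine 1 (- 1) ?f) n"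
      using f f_n by (simp add: fps_nth_at_affine scaleC_one del: fps_nth_Abs_fps)
    have n: "n > 0" using Suc by simp
    \<comment> \<open>Going from the truncation to the full series adds d_n once for each factor,
      because both factors have constant term 1.\<close>
    have "fps_nth (at_affine 1 (- 1) ?d * ?d) n = fps_nth ?d n + fps_nth ?d n + fps_nth (at_affine 1 (- 1) ?f * ?f) n"
      using af ad f f_n f[OF n] n by (simp add: fps_mult_nth_split add.assoc del: fps_nth_Abs_fps)
    also have "fps_nth ?d n + fps_nth ?d n = (1 + 1) *\<^sub>C fps_nth ?d n"
      by (simp only: scaleC_add_left scaleC_one)
    also have "\<dots> = fps_nth q n - fps_nth (at_affine 1 (- 1) ?f * ?f) n"
      unfolding Suc by (simp add: shift_root_def scaleC_scaleC scaleC_one)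
    finally show ?thesis by simp
  qed (simp add: assms)
qed

section \<open>Recovering two commuting matrices from their Kronecker product\<close>

text \<open>
  With \<open>\<alpha> = tr a / 2\<close>, the products of entries determine the coefficients of \<open>W = a / \<alpha>\<close>.  An entry
  of \<open>a(u) a(- u - 1) = 1\<close>, written in terms of \<open>\<alpha>\<close> and \<open>W\<close>, then determines
  \<open>(1 + (- 1)\<^sup>n) \<alpha>\<^sub>n\<close> recursively, and the odd coefficients of \<open>\<alpha>\<close> vanish.
\<close>

lemma kronecker_factors_in_subalgebra:
  fixes a b :: "'a::calgebra_1 fps^ix2^ix2"
  assumes H: "subalgebra H"
    and comm: "\<And>i j k l m n. fps_nth (a $ i $ j) m * fps_nth (b $ k $ l) n = fps_nth (b $ k $ l) n * fps_nth (a $ i $ j) m"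
    and a_0: "\<And>i j. fps_nth (a $ i $ j) 0 = (if i = j then 1 else 0)"
    and b_0: "\<And>i j. fps_nth (b $ i $ j) 0 = (if i = j then 1 else 0)"
    and even: "at_affine (- 1) 0 (a $ Neg $ Neg + a $ Pos $ Pos) = a $ Neg $ Neg + a $ Pos $ Pos"
    and inv: "a ** map_matrix (at_affine (- 1) (- 1)) a = mat 1"
    and prod: "\<And>i j k l. series_in H (a $ i $ j * b $ k $ l)"
  shows "series_in H (a $ i $ j)" "series_in H (b $ i $ j)"
proof -
  define hf :: "'a fps" where "hf = fps_const ((1 / 2) *\<^sub>C 1)"
  have hf: "series_in H hf" unfolding hf_def
    by (intro series_in_simps subalgebra_closed H)
  have hf_comm: "hf * f = f * hf" for f
    by (simp add: hf_def fps_eq_iff mult_scaleC_left mult_scaleC_right)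
  define \<alpha> where "\<alpha> = hf * (a $ Neg $ Neg + a $ Pos $ Pos)"
  define \<beta> where "\<beta> = hf * (b $ Neg $ Neg + b $ Pos $ Pos)"
  have "(1 / 2) *\<^sub>C (1 + 1) = (1 / 2 + 1 / 2) *\<^sub>C (1 :: 'a)"
    by (simp only: scaleC_add_right scaleC_add_left)
  then have half: "(1 / 2) *\<^sub>C 2 = (1 :: 'a)"
    by (simp add: scaleC_one)
  have \<alpha>_0: "fps_nth \<alpha> 0 = 1" and \<beta>_0: "fps_nth \<beta> 0 = 1"
    using half by (simp_all add: \<alpha>_def \<beta>_def hf_def a_0 b_0 mult_scaleC_left)
  have comm': "a $ i $ j * b $ k $ l = b $ k $ l * a $ i $ j" for i j k l
    by (rule fps_mult_commute_coeffs) (rule comm)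
  have hf_left: "f * (hf * g) = hf * (f * g)" for f g
    using hf_comm[of f] by (simp only: mult.assoc[symmetric])
  have a\<beta>_hf: "a $ i $ j * \<beta> = hf * (a $ i $ j * b $ Neg $ Neg + a $ i $ j * b $ Pos $ Pos)" for i j
    by (simp only: \<beta>_def hf_left[of "a $ i $ j"] distrib_left)
  have a\<beta>: "a $ i $ j * \<beta> = \<beta> * a $ i $ j" for i j
    unfolding a\<beta>_hf by (simp only: \<beta>_def distrib_right mult.assoc comm')
  have \<alpha>\<beta>: "\<alpha> * \<beta> = \<beta> * \<alpha>"
    by (simp only: \<alpha>_def mult.assoc hf_left[of \<beta>] distrib_left distrib_right a\<beta>)
  have p1: "series_in H (a $ i $ j * \<beta>)" for i j
    unfolding a\<beta>_hf by (intro series_in_simps(3,5)[OF H] hf prod)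
  have p2: "series_in H (\<alpha> * \<beta>)"
  proof -
    have "\<alpha> * \<beta> = hf * (a $ Neg $ Neg * \<beta> + a $ Pos $ Pos * \<beta>)"
      by (simp add: \<alpha>_def distrib_right mult.assoc)
    then show ?thesis by (simp only:) (intro series_in_simps(3,5)[OF H] hf p1)
  qed
  have \<alpha>\<beta>_0: "fps_nth (\<alpha> * \<beta>) 0 = 1" by (simp add: \<alpha>_0 \<beta>_0)
  let ?r = "fps_unit_inverse (\<alpha> * \<beta>)" and ?\<alpha>' = "fps_unit_inverse \<alpha>"
  define W where "W i j = a $ i $ j * ?\<alpha>'" for i j
  \<comment> \<open>Multiplying a \<beta> by the inverse of \<alpha> \<beta> yields a / \<alpha>.
    Both of these products lie in \<open>H\<close>, although \<alpha> and \<beta> are not yet known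
    to do so.\<close>
  have r: "\<beta> * ?r = ?\<alpha>'"
  proof -
    have "\<alpha> * (\<beta> * ?r) = 1" using fps_unit_inverse(1)[OF \<alpha>\<beta>_0] by (simp add: mult.assoc)
    then have "?\<alpha>' * (\<alpha> * (\<beta> * ?r)) = ?\<alpha>'" by simp
    then show ?thesis by (simp add: fps_unit_inverse(2)[OF \<alpha>_0] flip: mult.assoc)
  qed
  have W: "series_in H (W i j)" for i j
  proof -
    have "W i j = (a $ i $ j * \<beta>) * ?r" by (simp add: W_def r mult.assoc)
    then show ?thesis by (simp only:) (intro series_in_simps(5)[OF H] p1 series_in_unit_inverse[OF H] p2)
  qed
  have aW: "a $ i $ j = W i j * \<alpha>" for i j
    by (simp add: W_def mult.assoc fps_unit_inverse[OF \<alpha>_0])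
  have W_0: "fps_nth (W i j) 0 = (if i = j then 1 else 0)" for i j
    by (simp add: W_def a_0 fps_unit_inverse[OF \<alpha>_0])
  let ?t = "at_affine (- 1) (- 1)"
  have \<alpha>_even: "at_affine (- 1) 0 \<alpha> = \<alpha>"
  proof -
    have "at_affine (- 1) 0 hf = hf" by (simp add: hf_def at_affine_eq_fps_subst)
    then show ?thesis by (simp only: \<alpha>_def at_affine_simps(4)[of "- 1"] even neg_equal_0_iff_equal one_neq_zero not_False_eq_True)
  qed
  have odd: "fps_nth \<alpha> n = 0" if "odd n" for n
  proof -
    have "affine_arg (- 1) 0 = - fps_X" by (rule affine_arg_unique[symmetric]) (simp_all flip: fps_const_neg)
    then have "affine_arg (- 1) 0 ^ i = fps_const ((- 1) ^ i) * fps_X ^ i" for i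
      by (simp add: power_minus[of fps_X] flip: fps_const_power fps_const_neg)
    then have "fps_nth \<alpha> n = (- 1) ^ n *\<^sub>C fps_nth \<alpha> n"
      using arg_cong[OF \<alpha>_even, of "\<lambda>f. fps_nth f n"] by (simp add: fps_nth_at_affine fps_X_power_nth)
    then have "fps_nth \<alpha> n = - fps_nth \<alpha> n"
      using that by (simp add: scaleC_one)
    then have "fps_nth \<alpha> n + fps_nth \<alpha> n = 0"
      by (simp only: eq_neg_iff_add_eq_0)
    then show ?thesis by (rule calgebra_double_eq_0)
  qed
  \<comment> \<open>A diagonal entry is chosen because \<alpha>_n then survives through the constant
    term 1 of \<open>W Neg Neg\<close>, while \<open>W Neg Pos\<close> and \<open>W Pos Neg\<close>
    have constant term 0. The order of factors is kept, since \<alpha> need not commute with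
    \<open>W\<close>.\<close>
  have eq: "W Neg Neg * (\<alpha> * (?t (W Neg Neg) * ?t \<alpha>)) + W Neg Pos * (\<alpha> * (?t (W Pos Neg) * ?t \<alpha>)) = 1"
  proof -
    have "(a ** map_matrix ?t a) $ Neg $ Neg = 1" by (simp add: inv mat_def)
    then show ?thesis
      by (simp add: matrix_matrix_mult_def sum_ix2 aW at_affine_simps mult.assoc)
  qed
  have \<alpha>_in: "fps_nth \<alpha> n \<in> H" for n
  proof (induction n rule: less_induct)
    case (less n)
    show ?case
    proof (cases "n = 0 \<or> odd n")
      case True
      then show ?thesis using \<alpha>_0 odd[of n] by (auto simp: subalgebra_closed[OF H])
    next
      case False
      then have n: "n > 0" and ev: "even n" by auto
      define f where "f = Abs_fps (\<lambda>k. if k < n then fps_nth \<alpha> k else 0)"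
      have f: "series_in H f" using less by (simp add: f_def series_in_def subalgebra_closed[OF H])
      have f_lt: "fps_nth f k = fps_nth \<alpha> k" if "k < n" for k using that by (simp add: f_def)
      have f_n: "fps_nth f n = 0" by (simp add: f_def)
      have tf_lt: "fps_nth (?t f) k = fps_nth (?t \<alpha>) k" if "k < n" for k
        using that by (simp add: fps_nth_at_affine f_lt)
      have tf_n: "fps_nth (?t \<alpha>) n = fps_nth \<alpha> n + fps_nth (?t f) n"
        using ev by (simp add: fps_nth_at_affine f_lt f_n scaleC_one)
      have mult_lt: "fps_nth (x * y) k = fps_nth (x' * y') k"
        if "k < n" "\<And>i. i < n \<Longrightarrow> fps_nth x i = fps_nth x' i" "\<And>i. i < n \<Longrightarrow> fps_nth y i = fps_nth y' i"
        for x y x' y' :: "'a fps" and k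
        using that by (simp add: fps_mult_nth)
      \<comment> \<open>Replacing \<alpha> by its truncation \<open>f\<close> at both places changes
        the coefficient of order \<open>n\<close> by twice \<alpha>_n in the diagonal term and by 0
        in the other. Evenness of \<open>n\<close> gives both contributions the same sign.\<close>
      have d: "fps_nth (W i j * (\<alpha> * (?t (W j k) * ?t \<alpha>))) n - fps_nth (W i j * (f * (?t (W j k) * ?t f))) n =
        (if i = j \<and> j = k then fps_nth \<alpha> n + fps_nth \<alpha> n else 0)" for i j k
      proof -
        have 1: "fps_nth (?t (W j k) * ?t \<alpha>) m = fps_nth (?t (W j k) * ?t f) m" if "m < n" for m
          by (rule mult_lt) (use that tf_lt in auto)
        have 2: "fps_nth (\<alpha> * (?t (W j k) * ?t \<alpha>)) m = fps_nth (f * (?t (W j k) * ?t f)) m" if "m < n" for m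
          by (rule mult_lt) (use that f_lt 1 in auto)
        have 3: "fps_nth (?t (W j k) * ?t \<alpha>) n - fps_nth (?t (W j k) * ?t f) n = (if j = k then fps_nth \<alpha> n else 0)"
          using n by (simp add: fps_mult_nth_split W_0 tf_n tf_lt f_lt)
        have 4: "fps_nth (\<alpha> * (?t (W j k) * ?t \<alpha>)) n - fps_nth (f * (?t (W j k) * ?t f)) n =
            (if j = k then fps_nth \<alpha> n + fps_nth \<alpha> n else 0)"
          using 3 n by (simp add: fps_mult_nth_split[of n \<alpha>] fps_mult_nth_split[of n f] f_lt f_n 1 W_0 \<alpha>_0)
            (auto simp: algebra_simps split: if_splits)
        show ?thesis
          using 4 n by (simp add: fps_mult_nth_split[of n "W i j"] 2 W_0 f_lt \<alpha>_0 split: if_splits)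
      qed
      have "series_in H (W Neg Neg * (f * (?t (W Neg Neg) * ?t f)) + W Neg Pos * (f * (?t (W Pos Neg) * ?t f)))"
        by (intro series_in_simps(3,5,7)[OF H] W f)
      note in_H = series_inD[OF this, of n]
      have solve: "s = - (r1 + r2)" if "p1 - r1 = s" "p2 - r2 = 0" "p1 + p2 = 0" for s p1 p2 r1 r2 :: 'a
      proof -
        have "p1 = - r2" using that by (simp add: eq_neg_iff_add_eq_0)
        with that(1)[symmetric] show ?thesis by simp
      qed
      have "fps_nth \<alpha> n + fps_nth \<alpha> n =
          - fps_nth (W Neg Neg * (f * (?t (W Neg Neg) * ?t f)) + W Neg Pos * (f * (?t (W Pos Neg) * ?t f))) n"
        unfolding fps_add_nth
      proof (rule solve)
        show "fps_nth (W Neg Neg * (\<alpha> * (?t (W Neg Neg) * ?t \<alpha>))) n -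
            fps_nth (W Neg Neg * (f * (?t (W Neg Neg) * ?t f))) n = fps_nth \<alpha> n + fps_nth \<alpha> n"
          using d[of Neg Neg Neg] by simp
        show "fps_nth (W Neg Pos * (\<alpha> * (?t (W Pos Neg) * ?t \<alpha>))) n -
            fps_nth (W Neg Pos * (f * (?t (W Pos Neg) * ?t f))) n = 0"
          using d[of Neg Pos Neg] by simp
        show "fps_nth (W Neg Neg * (\<alpha> * (?t (W Neg Neg) * ?t \<alpha>))) n +
            fps_nth (W Neg Pos * (\<alpha> * (?t (W Pos Neg) * ?t \<alpha>))) n = 0"
          using arg_cong[OF eq, of "\<lambda>f. fps_nth f n"] n by (simp only: fps_add_nth) simp
      qed
      then have "(1 / 2) *\<^sub>C (fps_nth \<alpha> n + fps_nth \<alpha> n) \<in> H"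
        using in_H by (simp only:) (intro subalgebra_closed[OF H])
      moreover have "(1 / 2) *\<^sub>C (fps_nth \<alpha> n + fps_nth \<alpha> n) = (1 / 2 + 1 / 2) *\<^sub>C fps_nth \<alpha> n"
        by (simp only: scaleC_add_right scaleC_add_left)
      ultimately show ?thesis by (simp add: scaleC_one)
    qed
  qed
  then have \<alpha>: "series_in H \<alpha>" by (simp add: series_in_def)
  show "series_in H (a $ i $ j)"
    unfolding aW by (intro series_in_simps[OF H] W \<alpha>)
  \<comment> \<open>Half the sum of the products of b_ij with the diagonal entries of
    \<open>a\<close> is \<alpha> b_ij, and \<alpha> is now known to lie in \<open>H\<close>.\<close>
  have "b $ i $ j = ?\<alpha>' * (hf * (a $ Neg $ Neg * b $ i $ j + a $ Pos $ Pos * b $ i $ j))"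
  proof -
    have "hf * (a $ Neg $ Neg * b $ i $ j + a $ Pos $ Pos * b $ i $ j) = \<alpha> * b $ i $ j"
      by (simp add: \<alpha>_def distrib_right mult.assoc)
    then show ?thesis by (simp add: fps_unit_inverse(2)[OF \<alpha>_0] flip: mult.assoc)
  qed
  moreover have "series_in H \<dots>"
    by (intro series_in_simps(3,5)[OF H] series_in_unit_inverse[OF H] \<alpha> hf prod)
  ultimately show "series_in H (b $ i $ j)" by simp
qed

section \<open>Tensor products\<close>

lemma calg_hom_abs_tensor: "calg_hom abs_tensor"
  by (simp add: calg_hom_def one_tensor.abs_eq plus_tensor.abs_eq times_tensor.abs_eq scaleC_tensor.abs_eq)

lemma surj_abs_tensor: "surj abs_tensor"
  by (metis Quotient3_abs_rep[OF Quotient3_tensor] surjI)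

text \<open>Scalars are absorbed into the first factor of a pure tensor, so closure under sums is
  enough.\<close>

lemma tensor_induct [case_names tens add]:
  assumes "\<And>a b. P (a \<otimes> b)" "\<And>x y. P x \<Longrightarrow> P y \<Longrightarrow> P (x + y)"
  shows "P t"
proof -
  note A = calg_homD[OF calg_hom_abs_tensor]
  obtain p where t: "t = abs_tensor p" using surj_abs_tensor by (metis surjD)
  have scale: "P (c *\<^sub>C (a \<otimes> b))" for a b c using assms(1) by (metis tens_simps(3))
  have summand: "P (abs_tensor (c *\<^sub>C monom_of m))" for c m
    by (cases m) (simp add: A scale flip: tens.abs_eq)
  have "P (abs_tensor (\<Sum>m\<in>K. c m *\<^sub>C monom_of m))" for K c
  proof (induction K rule: infinite_finite_induct)
    case (insert m K)
    then show ?case using summand[of "c m" m] by (simp add: A assms(2))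
  qed (use summand[of 0] in \<open>simp_all add: A\<close>)
  then show ?thesis unfolding t by (metis monalg_expand)
qed

text \<open>Gives linear maps that need not be multiplicative, as required for left inverses in
  \<open>inj_tensor_map\<close>.\<close>

lemma tensor_bilinear_lift:
  fixes \<beta> :: "'a::calgebra_1 \<Rightarrow> 'b::calgebra_1 \<Rightarrow> 'c::calgebra_1"
  assumes \<beta>: "\<And>a a' b. \<beta> (a + a') b = \<beta> a b + \<beta> a' b" "\<And>a b b'. \<beta> a (b + b') = \<beta> a b + \<beta> a b'"
    "\<And>c a b. \<beta> (c *\<^sub>C a) b = c *\<^sub>C \<beta> a b" "\<And>c a b. \<beta> a (c *\<^sub>C b) = c *\<^sub>C \<beta> a b"
  obtains F where "\<And>x y. F (x + y) = F x + F y" "\<And>c x. F (c *\<^sub>C x) = c *\<^sub>C F x"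
    "\<And>a b. F (a \<otimes> b) = \<beta> a b"
proof -
  define G where "G = monalg_lift (\<lambda>p. case p of Pure a b \<Rightarrow> \<beta> a b)"
  have G: "G (x + y) = G x + G y" "G (c *\<^sub>C x) = c *\<^sub>C G x" "G 0 = 0" "G (sum h A) = (\<Sum>a\<in>A. G (h a))"
    for x y c h and A :: "('a, 'b) pure set"
    by (simp_all add: G_def monalg_lift_add monalg_lift_scaleC monalg_lift_zero monalg_lift_sum)
  have G_minus: "G (x - y) = G x - G y" for x y
    using G(1)[of "x - y" y] by simp
  have G_monom: "G (monom_of (Pure a b)) = \<beta> a b" for a b
    by (simp add: G_def monalg_lift_monom)
  \<comment> \<open>The kernel of \<open>G\<close> need not be an ideal. \<open>?J\<close> is the
    largest two-sided ideal inside it, and it contains the relators because a relator times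
    monomials is again a relator.\<close>
  let ?J = "{x. \<forall>u w. G (u * x * w) = 0}"
  have "two_sided_ideal ?J"
    by (auto simp: two_sided_ideal_def G distrib_left distrib_right mult.assoc) (simp_all flip: mult.assoc)
  moreover have "bilinear_relators \<subseteq> ?J"
  proof
    fix r :: "('a, 'b) pure monalg" assume r: "r \<in> bilinear_relators"
    have distr: "m * (x - (y + z)) * n = m * x * n - (m * y * n + m * z * n)"
      "m * (x - c *\<^sub>C y) * n = m * x * n - c *\<^sub>C (m * y * n)" for m n x y z :: "('a, 'b) pure monalg" and c
      by (simp_all add: algebra_simps mult_scaleC_left mult_scaleC_right)
    have "G (monom_of p * r * monom_of q) = 0" for p q
      using r
      by (cases p; cases q; elim bilinear_relators.cases; hypsubst_thin)
        (simp_all only: distr monom_of_add[symmetric] plus_pure.simps G_minus G G_monom,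
         simp_all add: distrib_left distrib_right mult_scaleC_left mult_scaleC_right \<beta>)
    then have *: "G ((c *\<^sub>C monom_of p) * r * (d *\<^sub>C monom_of q)) = 0" for c d p q
      by (simp add: mult_scaleC_left mult_scaleC_right G)
    have "G (u * r * w) = 0" for u w
    proof -
      have "G (u * r * w) = G
          ((\<Sum>m\<in>Poly_Mapping.keys (coeffs_of u). Poly_Mapping.lookup (coeffs_of u) m *\<^sub>C monom_of m) * r *
           (\<Sum>m\<in>Poly_Mapping.keys (coeffs_of w). Poly_Mapping.lookup (coeffs_of w) m *\<^sub>C monom_of m))"
        by (simp only: monalg_expand)
      also have "\<dots> = 0"
        unfolding sum_distrib_left sum_distrib_right G(4) * by simp
      finally show ?thesis .
    qed
    then show "r \<in> ?J" by simp
  qed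
  ultimately have J: "ideal_gen bilinear_relators \<subseteq> ?J" by (intro hull_minimal)
  have resp: "G x = G y" if "x - y \<in> ideal_gen bilinear_relators" for x y
  proof -
    have "G (1 * (x - y) * 1) = 0" using J that by blast
    then show ?thesis by (simp add: G_minus)
  qed
  define F where "F t = G (rep_tensor t)" for t
  have F: "F (abs_tensor x) = G x" for x
    unfolding F_def
    by (rule resp) (use Quotient3_rep_abs[OF Quotient3_tensor, where r = x]
        ideal_closed(1)[OF two_sided_ideal_ideal_gen] in auto)
  show thesis
  proof
    fix x y :: "('a, 'b) tensor" and c
    obtain p q where [simp]: "x = abs_tensor p" "y = abs_tensor q" using surj_abs_tensor by (metis surjD)
    show "F (x + y) = F x + F y" by (simp add: plus_tensor.abs_eq F G)
    show "F (c *\<^sub>C x) = c *\<^sub>C F x" by (simp add: scaleC_tensor.abs_eq F G)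
    show "F (a \<otimes> b) = \<beta> a b" for a b by (simp add: tens.abs_eq F G_monom)
  qed
qed

lemma tensor_hom_lift:
  assumes f: "calg_hom f" and g: "calg_hom g" and comm: "\<And>a b. f a * g b = g b * f a"
  obtains F where "calg_hom F" "\<And>a b. F (a \<otimes> b) = f a * g b"
proof -
  obtain F where F: "\<And>x y. F (x + y) = F x + F y" "\<And>c x. F (c *\<^sub>C x) = c *\<^sub>C F x"
    "\<And>a b. F (a \<otimes> b) = f a * g b"
    by (rule tensor_bilinear_lift[of "\<lambda>a b. f a * g b"])
      (auto simp: calg_homD[OF f] calg_homD[OF g] distrib_left distrib_right mult_scaleC_left mult_scaleC_right)
  have "F (x * y) = F x * F y" for x y
  proof (induction x rule: tensor_induct)
    case (tens a b)
    show ?case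
    proof (induction y rule: tensor_induct)
      case (tens a' b')
      have "f a * (f a' * g b) * g b' = f a * (g b * f a') * g b'" by (simp only: comm)
      then show ?case
        by (simp add: tens_simps F calg_homD[OF f] calg_homD[OF g] mult.assoc)
    qed (simp add: distrib_left F)
  qed (simp add: distrib_right F)
  moreover have "F 1 = 1" using F(3)[of 1 1] by (simp add: tens_one calg_homD[OF f] calg_homD[OF g])
  ultimately show thesis using F by (intro that[of F]) (simp_all add: calg_hom_def)
qed

lemma calg_hom_left_inverse:
  fixes f :: "'a::calgebra_1 \<Rightarrow> 'b::calgebra_1"
  assumes "calg_hom f" "inj f"
  obtains r where "\<And>x y. r (x + y) = r x + r y" "\<And>c x. r (c *\<^sub>C x) = c *\<^sub>C r x" "\<And>x. r (f x) = x"
proof -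
  interpret vector_space_pair "scaleC :: complex \<Rightarrow> 'a \<Rightarrow> 'a" "scaleC :: complex \<Rightarrow> 'b \<Rightarrow> 'b" ..
  have "Vector_Spaces.linear scaleC scaleC f"
    unfolding Vector_Spaces.linear_iff using assms(1)
    by (auto simp: calg_homD intro: cvec.vector_space_axioms)
  then obtain r where "Vector_Spaces.linear scaleC scaleC r" "r \<circ> f = id"
    using linear_injective_left_inverse[OF _ assms(2)] by blast
  then show thesis
    by (intro that[of r]) (auto simp: Vector_Spaces.linear_iff fun_eq_iff)
qed

text \<open>Over a field, injective linear maps have linear left inverses, and the tensor product of
  these is a left inverse of the tensor map. They need not be homomorphisms.\<close>

lemma inj_tensor_map:
  fixes f :: "'a::calgebra_1 \<Rightarrow> 'c::calgebra_1" and g :: "'b::calgebra_1 \<Rightarrow> 'd::calgebra_1"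
  assumes f: "calg_hom f" "inj f" and g: "calg_hom g" "inj g"
  shows "inj (tensor_map f g)"
proof -
  obtain r where r: "\<And>x y. r (x + y) = r x + r y" "\<And>c x. r (c *\<^sub>C x) = c *\<^sub>C r x" "\<And>x. r (f x) = x"
    using calg_hom_left_inverse[OF f] by blast
  obtain s where s: "\<And>x y. s (x + y) = s x + s y" "\<And>c x. s (c *\<^sub>C x) = c *\<^sub>C s x" "\<And>x. s (g x) = x"
    using calg_hom_left_inverse[OF g] by blast
  obtain F where F: "\<And>x y. F (x + y) = F x + F y" "\<And>a b. F (a \<otimes> b) = r a \<otimes> s b"
    by (rule tensor_bilinear_lift[of "\<lambda>a b. r a \<otimes> s b"]) (auto simp: r s tens_simps)
  have "F (tensor_map f g t) = t" for t
    by (induction t rule: tensor_induct)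
      (simp_all add: tensor_map_tens[OF f(1) g(1)] calg_homD[OF calg_hom_tensor_map[OF f(1) g(1)]] F r s)
  then show ?thesis by (rule inj_on_inverseI)
qed

lemma calg_hom_tens_left: "calg_hom (\<lambda>a. a \<otimes> 1)"
  by (simp add: calg_hom_def tens_one tens_simps)

lemma calg_hom_tens_right: "calg_hom (\<lambda>a. 1 \<otimes> a)"
  by (simp add: calg_hom_def tens_one tens_simps)

lemma tens_commute: "(a \<otimes> 1) * (1 \<otimes> b) = (1 \<otimes> b) * (a \<otimes> 1)"
  by (simp add: tens_simps)

lemma tens_left_central:
  assumes "\<And>x. z * x = x * z"
  shows "(z \<otimes> 1) * t = t * (z \<otimes> 1)"
  by (induction t rule: tensor_induct) (simp_all add: tens_simps assms distrib_left distrib_right)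

lemma tens_right_central:
  assumes "\<And>x. z * x = x * z"
  shows "(1 \<otimes> z) * t = t * (1 \<otimes> z)"
  by (induction t rule: tensor_induct) (simp_all add: tens_simps assms distrib_left distrib_right)

section \<open>Generators and universal properties\<close>

lemma ideal_gen_subset_kernel:
  assumes "calg_hom h" "\<And>x. x \<in> G \<Longrightarrow> h x = 0" "x \<in> ideal_gen G"
  shows "h x = 0"
proof -
  have "two_sided_ideal {x. h x = 0}" by (simp add: two_sided_ideal_def calg_homD[OF assms(1)])
  then have "ideal_gen G \<subseteq> {x. h x = 0}" by (rule hull_minimal[rotated]) (use assms(2) in blast)
  then show ?thesis using assms(3) by blast
qed

lemma subalgebra_image: "calg_hom f \<Longrightarrow> subalgebra H \<Longrightarrow> subalgebra (f ` H)"
  unfolding subalgebra_def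
  using calg_homD(1-4)[of f, symmetric] by (auto simp: image_iff)

lemma subalgebra_gen_typedef:
  assumes "calg_hom Rep" "inj Rep" "range Rep = subalgebra_gen G" "subalgebra H" "G \<subseteq> Rep ` H"
  shows "x \<in> H"
proof -
  have "Rep x \<in> Rep ` H"
    using hull_minimal[of G "Rep ` H" subalgebra] subalgebra_image[OF assms(1,4)] assms(3,5) by blast
  then show ?thesis using assms(2) by (simp add: inj_image_mem_iff)
qed

lemma free_alg_generated:
  fixes H :: "'g free_alg set"
  assumes H: "subalgebra H" and gen: "\<And>g. free_gen g \<in> H"
  shows "x \<in> H"
proof -
  have monom: "monom_of (Word l) \<in> H" for l
  proof (induction l)
    case Nil
    then show ?case using subalgebra_closed(1)[OF H] by (simp add: monom_of_zero flip: zero_word_def)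
  next
    case (Cons g l)
    have "monom_of (Word (g # l)) = free_gen g * monom_of (Word l)"
      unfolding free_gen_def monom_of_add[symmetric] by (simp add: plus_word_def)
    then show ?case using subalgebra_closed(4)[OF H gen Cons] by simp
  qed
  have "(\<Sum>m\<in>Poly_Mapping.keys (coeffs_of x). Poly_Mapping.lookup (coeffs_of x) m *\<^sub>C monom_of m) \<in> H"
    by (intro subalgebra_sum[OF H] subalgebra_closed(7)[OF H]) (metis monom word.exhaust)
  then show ?thesis by (simp only: monalg_expand)
qed

lemma surj_abs_y2: "surj abs_y2"
  by (metis Quotient3_abs_rep[OF Quotient3_y2] surjI)

lemma surj_abs_sy2: "surj abs_sy2"
  by (metis Quotient3_abs_rep[OF Quotient3_sy2] surjI)

lemma abs_y2_eq_0_iff: "abs_y2 x = 0 \<longleftrightarrow> x \<in> ideal_gen (rtt_relators R_gl2)"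
  by (simp add: zero_y2.abs_eq y2.abs_eq_iff)

lemma abs_sy2_eq_0_iff: "abs_sy2 x = 0 \<longleftrightarrow> x \<in> ideal_gen (range (fps_nth (qdet T_y2 - 1)))"
  by (simp add: zero_sy2.abs_eq sy2.abs_eq_iff)

lemma T_y2_nth:
  "fps_nth (T_y2 $ i $ j) 0 = (if i = j then 1 else 0)"
  "fps_nth (T_y2 $ i $ j) (Suc r) = abs_y2 (free_gen (i, j, r))"
  by (simp_all add: T_y2_def free_T_def calg_homD[OF calg_hom_abs_y2])

lemma y2_generated:
  assumes "subalgebra H" "\<And>i j. series_in H (T_y2 $ i $ j)"
  shows "x \<in> H"
proof -
  have "free_gen g \<in> abs_y2 -` H" for g
    using series_inD[OF assms(2)] T_y2_nth(2) by (metis prod_cases3 vimage_eq)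
  then have "y \<in> abs_y2 -` H" for y
    by (rule free_alg_generated[OF subalgebra_vimage[OF calg_hom_abs_y2 assms(1)]])
  then show ?thesis using surj_abs_y2 by (metis surjD vimage_eq)
qed

lemma rtt_matrix_hom:
  assumes "rtt_matrix T" "calg_hom h"
  shows "rtt_matrix (map_matrix (fps_map h) T)"
proof
  interpret rtt_matrix T by fact
  have "fls_map h 0 = 0" by (rule fls_eqI) (simp add: calg_homD[OF assms(2)])
  then have "fls_map (fls_map h) 0 = 0" by (intro fls_eqI) simp
  then show "rtt_defect R_gl2 (map_matrix (fps_map h) T) = 0"
    using rtt_defect_hom[OF assms(2), of R_gl2 T] by (simp add: rtt vec_eq_iff)
  show "fps_nth (map_matrix (fps_map h) T $ i $ j) 0 = (if i = j then 1 else 0)" for i j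
    by (simp add: T_0 calg_homD[OF assms(2)])
qed

lemma rtt_matrix_central_mult:
  assumes "rtt_matrix T" "\<And>i x. fps_nth z i * x = x * fps_nth z i" "fps_nth z 0 = 1"
  shows "rtt_matrix (\<chi> i j. z * T $ i $ j)"
proof
  interpret rtt_matrix T by fact
  show "rtt_defect R_gl2 (\<chi> i j. z * T $ i $ j) = 0"
    by (rule rtt_defect_central_mult[OF assms(2) rtt])
  show "fps_nth ((\<chi> i j. z * T $ i $ j) $ i $ j) 0 = (if i = j then 1 else 0)" for i j
    by (simp add: T_0 assms(3))
qed

lemma rtt_matrix_T_y2: "rtt_matrix T_y2"
proof
  have "fls_map abs_y2 0 = 0" by (rule fls_eqI) (simp add: calg_homD[OF calg_hom_abs_y2])
  then have "rtt_defect R_gl2 T_y2 $ p $ q $$ a $$ b = abs_y2 (rtt_defect R_gl2 free_T $ p $ q $$ a $$ b)" for p q a b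
    unfolding T_y2_def rtt_defect_hom[OF calg_hom_abs_y2, symmetric]
    by (simp add: calg_homD[OF calg_hom_abs_y2])
  moreover have "abs_y2 (rtt_defect R_gl2 free_T $ p $ q $$ a $$ b) = 0" for p q a b
    unfolding abs_y2_eq_0_iff by (rule hull_inc) (unfold rtt_relators_def, blast)
  ultimately have "rtt_defect R_gl2 T_y2 $ p $ q $$ a $$ b = 0" for p q a b
    by simp
  then show "rtt_defect R_gl2 T_y2 = 0"
    unfolding vec_eq_iff by (intro allI fls_eqI) simp
qed (rule T_y2_nth)

lemma y2_hom:
  assumes "rtt_matrix T"
  obtains h where "calg_hom h" "map_matrix (fps_map h) T_y2 = T"
proof -
  interpret rtt_matrix T by fact
  let ?f = "free_lift (\<lambda>(i, j, r). fps_nth (T $ i $ j) (Suc r))"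
  note f = calg_hom_free_lift[of "\<lambda>(i, j, r). fps_nth (T $ i $ j) (Suc r)"]
  have T: "map_matrix (fps_map ?f) free_T = T"
    by (auto simp: vec_eq_iff free_T_def fps_eq_iff T_0 calg_homD[OF f] free_lift_gen split: nat.split)
  have z: "fls_map ?f 0 = 0" by (rule fls_eqI) (simp add: calg_homD[OF f])
  have "?f (rtt_defect R_gl2 free_T $ p $ q $$ a $$ b) = 0" for p q a b
  proof -
    have "?f (rtt_defect R_gl2 free_T $ p $ q $$ a $$ b) =
        map_matrix (fls_map (fls_map ?f)) (rtt_defect R_gl2 free_T) $ p $ q $$ a $$ b"
      by (simp add: calg_homD[OF f] z)
    also have "\<dots> = 0" by (simp add: rtt_defect_hom[OF f] T rtt)
    finally show ?thesis .
  qed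
  then have rel: "?f r = 0" if "r \<in> rtt_relators R_gl2" for r
    using that unfolding rtt_relators_def by blast
  have "?f x = 0" if "abs_y2 x = 0" for x
    by (rule ideal_gen_subset_kernel[OF f rel]) (use that in \<open>simp_all add: abs_y2_eq_0_iff\<close>)
  then obtain h where h: "calg_hom h" "\<And>x. h (abs_y2 x) = ?f x"
    using calg_hom_factor[OF calg_hom_abs_y2 surj_abs_y2 f] by blast
  have "map_matrix (fps_map h) T_y2 = map_matrix (fps_map ?f) free_T"
    by (simp add: T_y2_def vec_eq_iff fps_eq_iff h(2))
  then show thesis using T h(1) that by simp
qed

lemma calg_hom_Rep_y2_tw: "calg_hom Rep_y2_tw"
  by (simp add: calg_hom_def one_y2_tw.rep_eq plus_y2_tw.rep_eq times_y2_tw.rep_eq scaleC_y2_tw.rep_eq)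

lemma calg_hom_Rep_sy2_tw: "calg_hom Rep_sy2_tw"
  by (simp add: calg_hom_def one_sy2_tw.rep_eq plus_sy2_tw.rep_eq times_sy2_tw.rep_eq scaleC_sy2_tw.rep_eq)

lemma calg_hom_Rep_xso4_tw: "calg_hom Rep_xso4_tw"
  by (simp add: calg_hom_def one_xso4_tw.rep_eq plus_xso4_tw.rep_eq times_xso4_tw.rep_eq scaleC_xso4_tw.rep_eq)

lemma inj_Rep_tw: "inj Rep_y2_tw" "inj Rep_sy2_tw" "inj Rep_xso4_tw"
  by (auto intro!: injI simp: Rep_y2_tw_inject Rep_sy2_tw_inject Rep_xso4_tw_inject)

lemma Rep_S_y2_tw: "Rep_y2_tw (fps_nth (S_y2_tw $ i $ j) n) = fps_nth (S_minus T_y2 $ i $ j) n"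
  unfolding S_y2_tw_def nth_map_matrix fps_map_nth
  by (rule Abs_y2_tw_inverse) (auto intro!: hull_inc)

lemma Rep_S_xso4_tw: "Rep_xso4_tw (fps_nth (S_xso4_tw $ i $ j) n) = fps_nth (S_xso4 $ i $ j) n"
  unfolding S_xso4_tw_def nth_map_matrix fps_map_nth
  by (rule Abs_xso4_tw_inverse) (auto intro!: hull_inc)

definition S_sy2_tw :: "sy2_tw fps^ix2^ix2" where
  "S_sy2_tw = map_matrix (fps_map proj_tw) S_y2_tw"

lemma Rep_S_sy2_tw: "Rep_sy2_tw (fps_nth (S_sy2_tw $ i $ j) n) = fps_nth (S_minus T_sy2 $ i $ j) n"
proof -
  have "map_matrix (fps_map abs_sy2) (S_minus T_y2) = S_minus T_sy2"
    by (simp add: S_minus_hom[OF calg_hom_abs_sy2] T_sy2_def)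
  then have "abs_sy2 (fps_nth (S_minus T_y2 $ i $ j) n) = fps_nth (S_minus T_sy2 $ i $ j) n"
    by (metis fps_map_nth nth_map_matrix)
  then show ?thesis by (simp add: S_sy2_tw_def Rep_proj_tw Rep_S_y2_tw)
qed

lemma y2_tw_generated:
  assumes "subalgebra H" "\<And>i j. series_in H (S_y2_tw $ i $ j)"
  shows "x \<in> H"
proof (rule subalgebra_gen_typedef[OF calg_hom_Rep_y2_tw inj_Rep_tw(1) _ assms(1)])
  show "range Rep_y2_tw = subalgebra_gen {fps_nth (S_minus T_y2 $ i $ j) n |i j n. True}"
    by (rule type_definition.Rep_range[OF type_definition_y2_tw])
  show "{fps_nth (S_minus T_y2 $ i $ j) n |i j n. True} \<subseteq> Rep_y2_tw ` H"
    using series_inD[OF assms(2)] by (auto simp flip: Rep_S_y2_tw)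
qed

lemma sy2_tw_generated:
  assumes "subalgebra H" "\<And>i j. series_in H (S_sy2_tw $ i $ j)"
  shows "x \<in> H"
proof (rule subalgebra_gen_typedef[OF calg_hom_Rep_sy2_tw inj_Rep_tw(2) _ assms(1)])
  show "range Rep_sy2_tw = subalgebra_gen {fps_nth (S_minus T_sy2 $ i $ j) n |i j n. True}"
    by (rule type_definition.Rep_range[OF type_definition_sy2_tw])
  show "{fps_nth (S_minus T_sy2 $ i $ j) n |i j n. True} \<subseteq> Rep_sy2_tw ` H"
    using series_inD[OF assms(2)] by (auto simp flip: Rep_S_sy2_tw)
qed

lemma xso4_tw_generated:
  assumes "subalgebra H" "\<And>i j. series_in H (S_xso4_tw $ i $ j)"
  shows "x \<in> H"
proof (rule subalgebra_gen_typedef[OF calg_hom_Rep_xso4_tw inj_Rep_tw(3) _ assms(1)])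
  show "range Rep_xso4_tw = subalgebra_gen {fps_nth (S_xso4 $ i $ j) n |i j n. True}"
    by (rule type_definition.Rep_range[OF type_definition_xso4_tw])
  show "{fps_nth (S_xso4 $ i $ j) n |i j n. True} \<subseteq> Rep_xso4_tw ` H"
    using series_inD[OF assms(2)] by (auto simp flip: Rep_S_xso4_tw)
qed

section \<open>The twisted Yangians\<close>

lemma unital_ring_hom_at_affine: "\<alpha> \<noteq> 0 \<Longrightarrow> unital_ring_hom (at_affine \<alpha> \<beta>)"
  by (simp add: unital_ring_hom_def at_affine_simps at_affine_0_1)

lemma unital_ring_hom_fps_map: "calg_hom h \<Longrightarrow> unital_ring_hom (fps_map h)"
  by (simp add: unital_ring_hom_def fps_map_hom)

lemma fps_map_eq_iff: "inj h \<Longrightarrow> fps_map h f = fps_map h g \<longleftrightarrow> f = g"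
  by (simp add: fps_eq_iff inj_eq)

lemma fps_nth_S_minus_0:
  assumes "rtt_matrix T"
  shows "fps_nth (S_minus T $ i $ j) 0 = (if i = j then 1 else 0)"
  by (cases i; cases j)
    (simp_all add: S_minus_def transpose_minus_def matrix_matrix_mult_def sum_ix2 rtt_matrix.T_0[OF assms])

lemma transpose_minus_at_affine:
  "transpose_minus (map_matrix (at_affine \<alpha> \<beta>) T) = map_matrix (at_affine \<alpha> \<beta>) (transpose_minus T)"
proof -
  have "(transpose_minus (map_matrix (at_affine \<alpha> \<beta>) T)) $ i $ j =
      (map_matrix (at_affine \<alpha> \<beta>) (transpose_minus T)) $ i $ j" for i j
    by (cases i; cases j) (simp_all add: transpose_minus_def at_affine_simps)
  then show ?thesis by (simp add: vec_eq_iff)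
qed

lemma map_matrix_at_affine_compose:
  assumes "\<alpha> \<noteq> 0" "\<gamma> \<noteq> 0"
  shows "map_matrix (at_affine \<alpha> \<beta>) (map_matrix (at_affine \<gamma> \<delta>) T) =
    map_matrix (at_affine (\<gamma> * \<alpha>) (\<gamma> * \<beta> + \<delta>)) T"
  using assms by (simp add: vec_eq_iff at_affine_at_affine)

text \<open>If \<open>qdet T(u) = 1\<close>, then \<open>T(- u)\<^sup>t\<close> is the inverse of \<open>T(- u - 1)\<close>.\<close>

lemma S_minus_inverse:
  assumes "rtt_matrix T" "qdet T = 1"
  shows "S_minus T ** map_matrix (at_affine (- 1) (- 1)) (S_minus T) = mat 1"
proof -
  let ?m = "\<lambda>\<alpha> \<beta>. map_matrix (at_affine \<alpha> \<beta>)" and ?t = transpose_minus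
  note inv = rtt_matrix.shift_mult_transpose_minus[OF assms(1), unfolded assms(2)]
  have hom: "?m \<alpha> \<beta> (A ** B) = ?m \<alpha> \<beta> A ** ?m \<alpha> \<beta> B" if "\<alpha> \<noteq> 0" for \<alpha> \<beta> and A B :: "'a fps^ix2^ix2"
    by (rule map_matrix_mult[OF unital_ring_hom_at_affine[OF that]])
  have one: "?m \<alpha> \<beta> (mat 1 :: 'a fps^ix2^ix2) = mat 1" if "\<alpha> \<noteq> 0" for \<alpha> \<beta>
    by (rule map_matrix_mat_1[OF unital_ring_hom_at_affine[OF that]])
  have 1: "?m (- 1) 0 (?t T) ** ?m (- 1) (- 1) T = mat 1"
    using arg_cong[OF inv(2), of "?m (- 1) 0"] by (simp add: hom one map_matrix_at_affine_compose)
  have id: "?m 1 0 T = T" by (simp add: vec_eq_iff)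
  \<comment> \<open>Replacing u by u + 1 gives T(u) T(u+1)^t = 1. The second factor is the
    transposed part of S(-u-1) and remains after the inner pair has cancelled.\<close>
  have 2: "T ** ?m 1 1 (?t T) = mat 1"
    using arg_cong[OF inv(1), of "?m 1 1"] by (simp add: hom one map_matrix_at_affine_compose id)
  have "S_minus T ** ?m (- 1) (- 1) (S_minus T) =
      T ** (?m (- 1) 0 (?t T) ** ?m (- 1) (- 1) T) ** ?m 1 1 (?t T)"
    by (simp add: S_minus_def transpose_minus_at_affine hom map_matrix_at_affine_compose matrix_mul_assoc)
  also have "\<dots> = mat 1" by (simp add: 1 2)
  finally show ?thesis .
qed

lemma fps_map_qdet: "calg_hom h \<Longrightarrow> fps_map h (qdet T) = qdet (map_matrix (fps_map h) T)"
  by (simp add: qdet_def fps_map_hom)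

lemma rtt_matrix_T_sy2: "rtt_matrix T_sy2"
  unfolding T_sy2_def by (rule rtt_matrix_hom[OF rtt_matrix_T_y2 calg_hom_abs_sy2])

lemma qdet_T_sy2: "qdet T_sy2 = 1"
proof -
  have "abs_sy2 (fps_nth (qdet T_y2 - 1) n) = 0" for n
    unfolding abs_sy2_eq_0_iff by (rule hull_inc) simp
  then have "fps_map abs_sy2 (qdet T_y2 - 1) = 0" by (simp add: fps_eq_iff del: fps_sub_nth)
  then show ?thesis
    by (simp add: fps_map_hom[OF calg_hom_abs_sy2] fps_map_qdet[OF calg_hom_abs_sy2] T_sy2_def)
qed

lemma qdet_T_y2_central: "fps_nth (qdet T_y2) n * x = x * fps_nth (qdet T_y2) n"
proof -
  let ?Z = "{x. \<forall>y\<in>range (fps_nth (qdet T_y2)). x * y = y * x}"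
  have "series_in ?Z (T_y2 $ i $ j)" for i j
  proof -
    have "fps_nth (T_y2 $ i $ j) s * fps_nth (qdet T_y2) m = fps_nth (qdet T_y2) m * fps_nth (T_y2 $ i $ j) s" for m s
      using arg_cong[OF rtt_matrix.qdet_commute_coeff[OF rtt_matrix_T_y2, of i j s], of "\<lambda>f. fps_nth f m"]
      by simp
    then show ?thesis by (auto simp: series_in_def)
  qed
  then have "x \<in> ?Z" by (rule y2_generated[OF subalgebra_centralizer])
  then show ?thesis by simp
qed

lemma qdet_0: "rtt_matrix T \<Longrightarrow> fps_nth (qdet T) 0 = 1"
  by (simp add: qdet_def rtt_matrix.T_0)

lemma fps_map_Rep_S_y2_tw: "map_matrix (fps_map Rep_y2_tw) S_y2_tw = S_minus T_y2"
  by (simp add: vec_eq_iff fps_eq_iff Rep_S_y2_tw)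

lemma fps_map_Rep_S_sy2_tw: "map_matrix (fps_map Rep_sy2_tw) S_sy2_tw = S_minus T_sy2"
  by (simp add: vec_eq_iff fps_eq_iff Rep_S_sy2_tw)

lemma S_y2_tw_0: "fps_nth (S_y2_tw $ i $ j) 0 = (if i = j then 1 else 0)"
proof -
  have "Rep_y2_tw (fps_nth (S_y2_tw $ i $ j) 0) = Rep_y2_tw (if i = j then 1 else 0)"
    by (simp add: Rep_S_y2_tw fps_nth_S_minus_0[OF rtt_matrix_T_y2] calg_homD[OF calg_hom_Rep_y2_tw])
  then show ?thesis by (simp only: Rep_y2_tw_inject)
qed

lemma S_sy2_tw_0: "fps_nth (S_sy2_tw $ i $ j) 0 = (if i = j then 1 else 0)"
  by (simp add: S_sy2_tw_def S_y2_tw_0 calg_homD[OF calg_hom_proj_tw])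

lemma S_sy2_tw_even:
  "at_affine (- 1) 0 (S_sy2_tw $ Neg $ Neg + S_sy2_tw $ Pos $ Pos) = S_sy2_tw $ Neg $ Neg + S_sy2_tw $ Pos $ Pos"
proof -
  have R: "fps_map Rep_sy2_tw (S_sy2_tw $ i $ j) = S_minus T_sy2 $ i $ j" for i j
    by (metis fps_map_Rep_S_sy2_tw nth_map_matrix)
  show ?thesis
    unfolding fps_map_eq_iff[OF inj_Rep_tw(2), symmetric] fps_map_hom[OF calg_hom_Rep_sy2_tw] R
    by (rule rtt_matrix.trace_S_minus_even[OF rtt_matrix_T_sy2])
qed

lemma map_matrix_at_affine_hom:
  "calg_hom h \<Longrightarrow> map_matrix (fps_map h) (map_matrix (at_affine \<alpha> \<beta>) A) = map_matrix (at_affine \<alpha> \<beta>) (map_matrix (fps_map h) A)"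
  by (simp add: vec_eq_iff fps_map_hom)

lemma S_sy2_tw_inverse: "S_sy2_tw ** map_matrix (at_affine (- 1) (- 1)) S_sy2_tw = mat 1"
proof -
  note u = unital_ring_hom_fps_map[OF calg_hom_Rep_sy2_tw]
  have "map_matrix (fps_map Rep_sy2_tw) (S_sy2_tw ** map_matrix (at_affine (- 1) (- 1)) S_sy2_tw) =
      map_matrix (fps_map Rep_sy2_tw) (mat 1)"
    unfolding map_matrix_mult[OF u] map_matrix_mat_1[OF u] map_matrix_at_affine_hom[OF calg_hom_Rep_sy2_tw]
      fps_map_Rep_S_sy2_tw
    by (rule S_minus_inverse[OF rtt_matrix_T_sy2 qdet_T_sy2])
  then show ?thesis by (simp add: vec_eq_iff fps_map_eq_iff[OF inj_Rep_tw(2)])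
qed

section \<open>The image of the embedding\<close>

text \<open>The entries of the product of the two matrices before the change of basis and the shift
  by 1/2. The image of the embedding is accessed through these.\<close>

definition S_prod :: "ix2 \<Rightarrow> ix2 \<Rightarrow> ix2 \<Rightarrow> ix2 \<Rightarrow> (y2_tw, y2_tw) tensor fps" where
  "S_prod i j k l = fps_map (\<lambda>a. a \<otimes> 1) (S_y2_tw $ i $ j) * fps_map (\<lambda>a. 1 \<otimes> a) (S_y2_tw $ k $ l)"

lemma S_circ_bullet_nth:
  assumes "\<alpha> \<noteq> 0"
  shows "(map_matrix (at_affine \<alpha> \<beta>) S_circ ** map_matrix (at_affine \<alpha> \<beta>) S_bullet) $ (i, k) $ (j, l) =
    at_affine \<alpha> \<beta> (S_prod i j k l)"
proof -
  note u = unital_ring_hom_at_affine[OF assms]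
  show ?thesis
    unfolding S_circ_def S_bullet_def map_matrix_kron[OF u] map_matrix_mat_1[OF u] kron_mult_kron_nth(1)
    by (simp add: S_prod_def at_affine_simps(4)[OF assms])
qed

lemma scalar_matrix_mult: "scalar_matrix A ** scalar_matrix B = scalar_matrix (A ** B)"
proof -
  have sum: "fps_const (sum f K) = (\<Sum>k\<in>K. fps_const (f k))" for f :: "'x \<Rightarrow> 'z::calgebra_1" and K
    by (induction K rule: infinite_finite_induct) (simp_all flip: fps_const_add)
  show ?thesis
    by (simp add: vec_eq_iff scalar_matrix_def matrix_matrix_mult_def cvec.scale_sum_left sum mult_scaleC_left scaleC_scaleC)
qed

lemma scalar_matrix_mat_1: "scalar_matrix (mat 1) = mat 1"
  by (simp add: vec_eq_iff scalar_matrix_def mat_def scaleC_one)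

lemma in_basis_inverse:
  "scalar_matrix basis_matrix ** in_basis M ** scalar_matrix (matrix_inv basis_matrix) = M"
proof -
  have "scalar_matrix basis_matrix ** in_basis M ** scalar_matrix (matrix_inv basis_matrix) =
      (scalar_matrix basis_matrix ** scalar_matrix (matrix_inv basis_matrix)) ** M **
      (scalar_matrix basis_matrix ** scalar_matrix (matrix_inv basis_matrix))"
    by (simp only: in_basis_def matrix_mul_assoc)
  then show ?thesis
    by (simp add: scalar_matrix_mult matrix_inv_basis_matrix basis_matrix_inverse scalar_matrix_mat_1)
qed

lemma series_in_matrix_mult:
  assumes "subalgebra H" "\<And>i j. series_in H (A $ i $ j)" "\<And>i j. series_in H (B $ i $ j)"
  shows "series_in H ((A ** B) $ i $ j)"
  unfolding matrix_matrix_mult_def by (simp add: series_in_simps[OF assms(1)] assms(2,3))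

lemma series_in_scalar_matrix: "subalgebra H \<Longrightarrow> series_in H (scalar_matrix A $ i $ j)"
  by (simp add: scalar_matrix_def series_in_simps subalgebra_closed)

lemma series_in_in_basis:
  assumes "subalgebra H" "\<And>p q. series_in H (M $ p $ q)"
  shows "series_in H (in_basis M $ i $ j)"
  unfolding in_basis_def by (intro series_in_matrix_mult series_in_scalar_matrix assms)

locale twisted_embedding =
  fixes \<phi> :: "xso4_tw \<Rightarrow> (y2_tw, y2_tw) tensor"
  assumes hom: "calg_hom \<phi>" and inj: "inj \<phi>"
    and S: "map_matrix (fps_map \<phi>) S_xso4_tw =
      in_basis (map_matrix (at_affine 1 (- 1 / 2)) S_circ ** map_matrix (at_affine 1 (- 1 / 2)) S_bullet)"
begin

text \<open>The change of basis and the shift by 1/2 are both invertible with scalar coefficients,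
  so they can be undone inside the image.\<close>

lemma S_prod_in_range: "series_in (range \<phi>) (S_prod i j k l)"
proof -
  let ?M = "map_matrix (at_affine 1 (- 1 / 2)) S_circ ** map_matrix (at_affine 1 (- 1 / 2)) S_bullet"
  note H = subalgebra_range[OF hom]
  have "series_in (range \<phi>) (in_basis ?M $ p $ q)" for p q
    unfolding S[symmetric] by (simp add: series_in_def)
  then have "series_in (range \<phi>) ((scalar_matrix basis_matrix ** in_basis ?M ** scalar_matrix (matrix_inv basis_matrix)) $ (i, k) $ (j, l))"
    by (intro series_in_matrix_mult[OF H] series_in_scalar_matrix[OF H])
  then have "series_in (range \<phi>) (at_affine 1 (- 1 / 2) (S_prod i j k l))"
    unfolding in_basis_inverse by (simp only: S_circ_bullet_nth one_neq_zero not_False_eq_True)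
  then show ?thesis
    using series_in_at_affine_iff[OF H, of 1 "- 1 / 2"] by simp
qed

lemma range_subset:
  assumes H: "subalgebra H" and prod: "\<And>i j k l. series_in H (S_prod i j k l)"
  shows "\<phi> x \<in> H"
proof -
  let ?M = "map_matrix (at_affine 1 (- 1 / 2)) S_circ ** map_matrix (at_affine 1 (- 1 / 2)) S_bullet"
  have "series_in H (?M $ p $ q)" for p q
    by (cases p; cases q) (simp only: S_circ_bullet_nth one_neq_zero not_False_eq_True series_in_simps(7)[OF H prod])
  then have "series_in H (in_basis ?M $ i $ j)" for i j
    by (rule series_in_in_basis[OF H])
  then have "series_in H (map_matrix (fps_map \<phi>) S_xso4_tw $ i $ j)" for i j
    by (simp only: S)
  then have "series_in (\<phi> -` H) (S_xso4_tw $ i $ j)" for i j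
    by (simp add: series_in_def)
  then have "x \<in> \<phi> -` H"
    by (rule xso4_tw_generated[OF subalgebra_vimage[OF hom H]])
  then show ?thesis by simp
qed

end

section \<open>Surjectivity of the two compositions\<close>

lemma surj_if_pure_in_range:
  fixes f :: "'c::calgebra_1 \<Rightarrow> ('a::calgebra_1, 'b::calgebra_1) tensor"
  assumes "calg_hom f" "\<And>a. a \<otimes> 1 \<in> range f" "\<And>b. 1 \<otimes> b \<in> range f"
  shows "surj f"
proof -
  note H = subalgebra_range[OF assms(1)]
  have "t \<in> range f" for t
  proof (induction t rule: tensor_induct)
    case (tens a b)
    show ?case using subalgebra_closed(4)[OF H assms(2,3)] by (simp add: tens_simps)
  next
    case (add x y)
    then show ?case by (rule subalgebra_closed(3)[OF H])
  qed
  then show ?thesis by blast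
qed

lemma fps_map_fps_map: "fps_map g (fps_map f s) = fps_map (g \<circ> f) s"
  by (simp add: fps_eq_iff)

lemma calg_hom_id: "calg_hom id"
  by (simp add: calg_hom_def)

lemma Pr_hom: "calg_hom Pr1" "calg_hom Pr2"
  unfolding Pr1_def Pr2_def by (intro calg_hom_tensor_map calg_hom_proj_tw calg_hom_id)+

lemma Pr_tens: "Pr1 (a \<otimes> b) = proj_tw a \<otimes> b" "Pr2 (a \<otimes> b) = a \<otimes> proj_tw b"
  by (simp_all add: Pr1_def Pr2_def tensor_map_tens calg_hom_proj_tw calg_hom_id)

lemma Pr_S_prod:
  "fps_map Pr1 (S_prod i j k l) = fps_map (\<lambda>a. a \<otimes> 1) (S_sy2_tw $ i $ j) * fps_map (\<lambda>a. 1 \<otimes> a) (S_y2_tw $ k $ l)"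
  "fps_map Pr2 (S_prod i j k l) = fps_map (\<lambda>a. a \<otimes> 1) (S_y2_tw $ i $ j) * fps_map (\<lambda>a. 1 \<otimes> a) (S_sy2_tw $ k $ l)"
  by (simp_all add: S_prod_def fps_map_hom Pr_hom fps_map_fps_map S_sy2_tw_def o_def Pr_tens
      calg_homD[OF calg_hom_proj_tw])

context twisted_embedding
begin

lemma surj_Pr1: "surj (Pr1 \<circ> \<phi>)"
proof (rule surj_if_pure_in_range)
  let ?H = "range (Pr1 \<circ> \<phi>)"
  let ?a = "map_matrix (fps_map (\<lambda>x. x \<otimes> 1)) S_sy2_tw :: (sy2_tw, y2_tw) tensor fps^ix2^ix2"
  let ?b = "map_matrix (fps_map (\<lambda>x. 1 \<otimes> x)) S_y2_tw :: (sy2_tw, y2_tw) tensor fps^ix2^ix2"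
  show hom': "calg_hom (Pr1 \<circ> \<phi>)" by (rule calg_hom_comp[OF hom Pr_hom(1)])
  note H = subalgebra_range[OF hom']
  note u = unital_ring_hom_fps_map[OF calg_hom_tens_left]
  have prod: "series_in ?H (?a $ i $ j * ?b $ k $ l)" for i j k l
    unfolding nth_map_matrix Pr_S_prod(1)[symmetric] image_comp[symmetric]
    using S_prod_in_range[of i j k l] by (simp add: series_in_def)
  have even: "at_affine (- 1) 0 (?a $ Neg $ Neg + ?a $ Pos $ Pos) = ?a $ Neg $ Neg + ?a $ Pos $ Pos"
    using arg_cong[OF S_sy2_tw_even, of "fps_map (\<lambda>x. x \<otimes> 1)"] by (simp add: fps_map_hom[OF calg_hom_tens_left])
  have inv: "?a ** map_matrix (at_affine (- 1) (- 1)) ?a = mat 1"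
    using arg_cong[OF S_sy2_tw_inverse, of "map_matrix (fps_map (\<lambda>x. x \<otimes> 1))"]
    by (simp only: map_matrix_mult[OF u] map_matrix_mat_1[OF u] map_matrix_at_affine_hom[OF calg_hom_tens_left])
  note factors = kronecker_factors_in_subalgebra[OF H _ _ _ even inv prod]
  note simps = tens_commute S_sy2_tw_0 S_y2_tw_0 tens_one calg_homD[OF calg_hom_tens_left] calg_homD[OF calg_hom_tens_right]
  have "series_in ?H (?a $ i $ j)" for i j
    by (rule factors(1); simp add: simps)
  moreover have "series_in ?H (?b $ i $ j)" for i j
    by (rule factors(2); simp add: simps)
  ultimately have "series_in ((\<lambda>x. x \<otimes> 1) -` ?H) (S_sy2_tw $ i $ j)" "series_in ((\<lambda>x. 1 \<otimes> x) -` ?H) (S_y2_tw $ i $ j)" for i j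
    by (simp_all only: series_in_def nth_map_matrix fps_map_nth vimage_eq simp_thms)
  then show "a \<otimes> 1 \<in> ?H" "1 \<otimes> b \<in> ?H" for a b
    using sy2_tw_generated[OF subalgebra_vimage[OF calg_hom_tens_left H]]
      y2_tw_generated[OF subalgebra_vimage[OF calg_hom_tens_right H]] by blast+
qed

lemma surj_Pr2: "surj (Pr2 \<circ> \<phi>)"
proof (rule surj_if_pure_in_range)
  let ?H = "range (Pr2 \<circ> \<phi>)"
  \<comment> \<open>The factor of determinant one again plays the part of \<open>a\<close>, now from
    the second tensor slot.\<close>
  let ?a = "map_matrix (fps_map (\<lambda>x. 1 \<otimes> x)) S_sy2_tw :: (y2_tw, sy2_tw) tensor fps^ix2^ix2"
  let ?b = "map_matrix (fps_map (\<lambda>x. x \<otimes> 1)) S_y2_tw :: (y2_tw, sy2_tw) tensor fps^ix2^ix2"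
  show hom': "calg_hom (Pr2 \<circ> \<phi>)" by (rule calg_hom_comp[OF hom Pr_hom(2)])
  note H = subalgebra_range[OF hom']
  note u = unital_ring_hom_fps_map[OF calg_hom_tens_right]
  have "?a $ i $ j * ?b $ k $ l = ?b $ k $ l * ?a $ i $ j" for i j k l
    by (rule fps_mult_commute_coeffs) (simp add: tens_commute)
  then have "?a $ i $ j * ?b $ k $ l = fps_map Pr2 (S_prod k l i j)" for i j k l
    by (simp add: Pr_S_prod)
  then have prod: "series_in ?H (?a $ i $ j * ?b $ k $ l)" for i j k l
    unfolding image_comp[symmetric] using S_prod_in_range[of k l i j] by (simp add: series_in_def)
  have even: "at_affine (- 1) 0 (?a $ Neg $ Neg + ?a $ Pos $ Pos) = ?a $ Neg $ Neg + ?a $ Pos $ Pos"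
    using arg_cong[OF S_sy2_tw_even, of "fps_map (\<lambda>x. 1 \<otimes> x)"] by (simp add: fps_map_hom[OF calg_hom_tens_right])
  have inv: "?a ** map_matrix (at_affine (- 1) (- 1)) ?a = mat 1"
    using arg_cong[OF S_sy2_tw_inverse, of "map_matrix (fps_map (\<lambda>x. 1 \<otimes> x))"]
    by (simp only: map_matrix_mult[OF u] map_matrix_mat_1[OF u] map_matrix_at_affine_hom[OF calg_hom_tens_right])
  note factors = kronecker_factors_in_subalgebra[OF H _ _ _ even inv prod]
  note simps = tens_commute S_sy2_tw_0 S_y2_tw_0 tens_one calg_homD[OF calg_hom_tens_left] calg_homD[OF calg_hom_tens_right]
  have "series_in ?H (?a $ i $ j)" for i j
    by (rule factors(1); simp add: simps)
  moreover have "series_in ?H (?b $ i $ j)" for i j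
    by (rule factors(2); simp add: simps)
  ultimately have "series_in ((\<lambda>x. 1 \<otimes> x) -` ?H) (S_sy2_tw $ i $ j)" "series_in ((\<lambda>x. x \<otimes> 1) -` ?H) (S_y2_tw $ i $ j)" for i j
    by (simp_all only: series_in_def nth_map_matrix fps_map_nth vimage_eq simp_thms)
  then show "a \<otimes> 1 \<in> ?H" "1 \<otimes> b \<in> ?H" for a b
    using sy2_tw_generated[OF subalgebra_vimage[OF calg_hom_tens_right H]]
      y2_tw_generated[OF subalgebra_vimage[OF calg_hom_tens_left H]] by blast+
qed

end

section \<open>Rescaling by a central series\<close>

definition central_series :: "'a::ring_1 fps \<Rightarrow> bool" where
  "central_series z \<longleftrightarrow> (\<forall>n x. fps_nth z n * x = x * fps_nth z n)"

lemma central_series_iff: "central_series z \<longleftrightarrow> series_in {x. \<forall>y\<in>UNIV. x * y = y * x} z"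
  by (simp add: central_series_def series_in_def)

lemma central_series_commute: "central_series z \<Longrightarrow> f * z = z * f"
  by (rule fps_mult_commute_coeffs) (simp add: central_series_def)

lemma central_series_left_commute: "central_series z \<Longrightarrow> f * (z * g) = z * (f * g)"
  by (metis central_series_commute mult.assoc)

lemma central_series_at_affine: "central_series z \<Longrightarrow> central_series (at_affine \<alpha> \<beta> z)"
  unfolding central_series_iff by (rule series_in_simps(7)[OF subalgebra_centralizer])

lemma central_series_unit_inverse: "central_series (z :: 'a::calgebra_1 fps) \<Longrightarrow> central_series (fps_unit_inverse z)"
  unfolding central_series_iff by (rule series_in_unit_inverse[OF subalgebra_centralizer])

lemma central_series_shift_root: "central_series z \<Longrightarrow> central_series (shift_root z)"
  unfolding central_series_iff by (rule series_in_shift_root[OF subalgebra_centralizer])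

lemma S_minus_central_mult:
  assumes z: "central_series z"
  shows "S_minus (\<chi> i j. z * T $ i $ j) $ i $ j = z * at_affine (- 1) 0 z * S_minus T $ i $ j"
proof -
  let ?z = "at_affine (- 1) 0 z"
  have 1: "at_affine (- 1) 0 (z * f) = ?z * at_affine (- 1) 0 f" for f
    by (simp add: at_affine_simps)
  have 2: "z * f * (?z * g) = z * ?z * (f * g)" for f g
    by (simp only: mult.assoc central_series_left_commute[OF central_series_at_affine[OF z], of f])
  show ?thesis
    by (cases j) (simp_all add: S_minus_def transpose_minus_def matrix_matrix_mult_def sum_ix2 1 2 distrib_left right_diff_distrib)
qed

lemma qdet_central_mult:
  assumes z: "central_series z"
  shows "qdet (\<chi> i j. z * T $ i $ j) = at_affine 1 (- 1) z * z * qdet T"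
proof -
  have 2: "at_affine 1 (- 1) z * f * (z * g) = at_affine 1 (- 1) z * z * (f * g)" for f g
    by (simp only: mult.assoc central_series_left_commute[OF z, of f])
  show ?thesis by (simp add: qdet_def at_affine_simps 2 right_diff_distrib)
qed

definition qdet_root :: "y2 fps" where
  "qdet_root = shift_root (qdet T_y2)"

lemma qdet_root:
  "central_series qdet_root" "fps_nth qdet_root 0 = 1"
  "qdet (\<chi> i j. fps_unit_inverse qdet_root * T_y2 $ i $ j) = 1"
proof -
  let ?d = qdet_root and ?e = "fps_unit_inverse qdet_root"
  have "central_series (qdet T_y2)" by (simp add: central_series_def qdet_T_y2_central)
  then show c: "central_series ?d" unfolding qdet_root_def by (rule central_series_shift_root)
  show d0: "fps_nth ?d 0 = 1" by (simp add: qdet_root_def)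
  note e = fps_unit_inverse[OF d0]
  have q: "qdet T_y2 = at_affine 1 (- 1) ?d * ?d"
    unfolding qdet_root_def by (rule shift_root[symmetric]) (rule qdet_0[OF rtt_matrix_T_y2])
  have "at_affine 1 (- 1) ?e * at_affine 1 (- 1) ?d = 1"
    by (simp add: e(2) at_affine_0_1 flip: at_affine_simps(4))
  then have "at_affine 1 (- 1) ?e * ?e * (at_affine 1 (- 1) ?d * ?d) = ?e * ?d"
    by (simp add: central_series_left_commute[OF central_series_at_affine[OF c], of "?e"] mult.assoc)
      (simp flip: mult.assoc)
  then show "qdet (\<chi> i j. ?e * T_y2 $ i $ j) = 1"
    by (simp add: qdet_central_mult[OF central_series_unit_inverse[OF c]] q e(2))
qed

type_synonym y2_y2 = "(y2, y2) tensor"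

abbreviation left :: "y2 \<Rightarrow> y2_y2" where "left \<equiv> \<lambda>x. x \<otimes> 1"
abbreviation right :: "y2 \<Rightarrow> y2_y2" where "right \<equiv> \<lambda>x. 1 \<otimes> x"

lemma central_series_tens:
  assumes "central_series z"
  shows "central_series (fps_map left z)" "central_series (fps_map right z)"
  using assms by (simp_all add: central_series_def tens_left_central tens_right_central)

text \<open>The scaling series are central in the whole tensor product and may come from either
  slot, so the images need not lie in separate slots. Commutation is obtained by passing to
  generators twice, first for \<open>l\<close> against the left slot, then for \<open>k\<close>
  against the image of \<open>l\<close>.\<close>

lemma rescaled_homs:
  assumes z: "central_series z" "fps_nth z 0 = 1" and w: "central_series w" "fps_nth w 0 = 1"
  obtains k l :: "y2 \<Rightarrow> y2_y2" where "calg_hom k"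
    "map_matrix (fps_map k) T_y2 = (\<chi> i j. z * map_matrix (fps_map left) T_y2 $ i $ j)" "calg_hom l"
    "map_matrix (fps_map l) T_y2 = (\<chi> i j. w * map_matrix (fps_map right) T_y2 $ i $ j)"
    "\<forall>x y. k x * l y = l y * k x"
proof -
  obtain k where k: "calg_hom k"
    "map_matrix (fps_map k) T_y2 = (\<chi> i j. z * map_matrix (fps_map left) T_y2 $ i $ j)"
    using y2_hom[OF rtt_matrix_central_mult[OF rtt_matrix_hom[OF rtt_matrix_T_y2 calg_hom_tens_left]], of z] z
    unfolding central_series_def by metis
  obtain l where l: "calg_hom l"
    "map_matrix (fps_map l) T_y2 = (\<chi> i j. w * map_matrix (fps_map right) T_y2 $ i $ j)"
    using y2_hom[OF rtt_matrix_central_mult[OF rtt_matrix_hom[OF rtt_matrix_T_y2 calg_hom_tens_right]], of w] w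
    unfolding central_series_def by metis
  have kT: "fps_map k (T_y2 $ i $ j) = z * fps_map left (T_y2 $ i $ j)" for i j
    using arg_cong[OF k(2), of "\<lambda>M. M $ i $ j"] by simp
  have lT: "fps_map l (T_y2 $ i $ j) = w * fps_map right (T_y2 $ i $ j)" for i j
    using arg_cong[OF l(2), of "\<lambda>M. M $ i $ j"] by simp
  have l_left: "l y \<in> {e. \<forall>f\<in>range left. e * f = f * e}" for y
  proof -
    let ?C = "{e. \<forall>f\<in>range left. e * f = f * e}"
    have C: "subalgebra ?C" by (rule subalgebra_centralizer)
    have "series_in ?C w" using w(1) by (simp add: series_in_def central_series_def)
    moreover have "series_in ?C (fps_map right (T_y2 $ i $ j))" for i j
      by (simp add: series_in_def tens_commute)
    ultimately have "series_in ?C (fps_map l (T_y2 $ i $ j))" for i j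
      unfolding lT by (rule series_in_simps(5)[OF C])
    then have "series_in (l -` ?C) (T_y2 $ i $ j)" for i j
      by (simp only: series_in_def fps_map_nth vimage_eq simp_thms)
    then have "y \<in> l -` ?C" by (rule y2_generated[OF subalgebra_vimage[OF l(1) C]])
    then show ?thesis by simp
  qed
  have "k x \<in> {e. \<forall>f\<in>range l. e * f = f * e}" for x
  proof -
    let ?C = "{e. \<forall>f\<in>range l. e * f = f * e}"
    have C: "subalgebra ?C" by (rule subalgebra_centralizer)
    have "series_in ?C z" using z(1) by (simp add: series_in_def central_series_def)
    moreover have "series_in ?C (fps_map left (T_y2 $ i $ j))" for i j
      using l_left by (simp add: series_in_def)
    ultimately have "series_in ?C (fps_map k (T_y2 $ i $ j))" for i j
      unfolding kT by (rule series_in_simps(5)[OF C])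
    then have "series_in (k -` ?C) (T_y2 $ i $ j)" for i j
      by (simp only: series_in_def fps_map_nth vimage_eq simp_thms)
    then have "x \<in> k -` ?C" by (rule y2_generated[OF subalgebra_vimage[OF k(1) C]])
    then show ?thesis by simp
  qed
  then show thesis using that k l by blast
qed

lemma factor_through_sy2:
  fixes k :: "y2 \<Rightarrow> 'c::calgebra_1"
  assumes k: "calg_hom k" and q: "qdet (map_matrix (fps_map k) T_y2) = 1"
  obtains h where "calg_hom h" "\<forall>x. h (abs_sy2 x) = k x"
proof -
  have "fps_map k (qdet T_y2 - 1) = 0"
    by (simp add: fps_map_hom[OF k] fps_map_qdet[OF k] q)
  then have "k (fps_nth (qdet T_y2 - 1) n) = 0" for n by (metis fps_map_nth fps_zero_nth)
  then have rel: "k r = 0" if "r \<in> range (fps_nth (qdet T_y2 - 1))" for r using that by blast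
  have "k x = 0" if "abs_sy2 x = 0" for x
    by (rule ideal_gen_subset_kernel[OF k rel]) (use that in \<open>simp_all add: abs_sy2_eq_0_iff\<close>)
  then show thesis using calg_hom_factor[OF calg_hom_abs_sy2 surj_abs_sy2 k] that by blast
qed

lemma qdet_rescaled:
  assumes "calg_hom h"
  shows "qdet (\<chi> i j. fps_map h (fps_unit_inverse qdet_root) * map_matrix (fps_map h) T_y2 $ i $ j) = 1"
proof -
  have "(\<chi> i j. fps_map h (fps_unit_inverse qdet_root) * map_matrix (fps_map h) T_y2 $ i $ j) =
      map_matrix (fps_map h) (\<chi> i j. fps_unit_inverse qdet_root * T_y2 $ i $ j)"
    by (simp add: vec_eq_iff fps_map_hom[OF assms])
  then show ?thesis
    by (simp only: fps_map_qdet[OF assms, symmetric] qdet_root(3) fps_map_hom[OF assms])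
qed

section \<open>Injectivity of the two compositions\<close>

context twisted_embedding
begin

text \<open>
  The central factors \<open>z(u) z(- u)\<close> and \<open>w(u) w(- u)\<close> of the rescaled matrices cancel in every product
  of an entry of the first with an entry of the second one.
\<close>

lemma rescaled_inj:
  assumes z: "central_series z" and w: "central_series w" and zw: "z * w = 1"
    and k: "calg_hom k" "map_matrix (fps_map k) T_y2 = (\<chi> i j. z * map_matrix (fps_map left) T_y2 $ i $ j)"
    and l: "calg_hom l" "map_matrix (fps_map l) T_y2 = (\<chi> i j. w * map_matrix (fps_map right) T_y2 $ i $ j)"
    and F: "calg_hom F" "\<And>a b. F (a \<otimes> b) = k (Rep_y2_tw a) * l (Rep_y2_tw b)"
  shows "inj (F \<circ> \<phi>)"
proof -
  let ?J = "tensor_map Rep_y2_tw Rep_y2_tw"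
  let ?t = "at_affine (- 1) 0"
  note R = calg_hom_Rep_y2_tw
  have J: "calg_hom ?J" by (rule calg_hom_tensor_map[OF R R])
  have J_tens: "?J (a \<otimes> b) = left (Rep_y2_tw a) * right (Rep_y2_tw b)" for a b
    by (simp add: tensor_map_tens[OF R R] tens_simps)
  have RS: "fps_map Rep_y2_tw (S_y2_tw $ i $ j) = S_minus T_y2 $ i $ j" for i j
    by (metis fps_map_Rep_S_y2_tw nth_map_matrix)
  have S_hom: "fps_map h (S_minus T_y2 $ i $ j) = S_minus (map_matrix (fps_map h) T_y2) $ i $ j"
    if "calg_hom h" for h :: "y2 \<Rightarrow> y2_y2" and i j
    by (metis S_minus_hom[OF that] nth_map_matrix)
  have tzw: "?t z * ?t w = 1" using arg_cong[OF zw, of ?t] by (simp add: at_affine_simps at_affine_0_1)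
  have "fps_map F (S_prod i j m n) = fps_map ?J (S_prod i j m n)" for i j m n
  proof -
    let ?A = "S_minus (map_matrix (fps_map left) T_y2) $ i $ j" and ?B = "S_minus (map_matrix (fps_map right) T_y2) $ m $ n"
    have "fps_map F (S_prod i j m n) =
        fps_map k (fps_map Rep_y2_tw (S_y2_tw $ i $ j)) * fps_map l (fps_map Rep_y2_tw (S_y2_tw $ m $ n))"
      by (simp add: S_prod_def fps_map_hom[OF F(1)] fps_map_fps_map o_def F(2) calg_homD[OF R] calg_homD[OF k(1)] calg_homD[OF l(1)])
    also have "\<dots> = (z * ?t z * ?A) * (w * ?t w * ?B)"
      by (simp only: RS S_hom[OF k(1)] S_hom[OF l(1)] k(2) l(2) S_minus_central_mult[OF z] S_minus_central_mult[OF w])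
    also have "\<dots> = (z * w) * (?t z * ?t w) * (?A * ?B)"
      by (simp only: mult.assoc central_series_left_commute[OF w, of "?A"] central_series_left_commute[OF w, of "?t z"]
          central_series_left_commute[OF central_series_at_affine[OF w], of "?A"])
    also have "\<dots> = ?A * ?B" by (simp add: zw tzw)
    also have "\<dots> = fps_map ?J (S_prod i j m n)"
      by (simp add: S_prod_def fps_map_hom[OF J] fps_map_fps_map o_def J_tens calg_homD[OF R] tens_one
          S_hom[OF calg_hom_tens_left, symmetric] S_hom[OF calg_hom_tens_right, symmetric] RS[symmetric])
    finally show ?thesis .
  qed
  then have "F (fps_nth (S_prod i j m n) r) = ?J (fps_nth (S_prod i j m n) r)" for i j m n r
    by (metis fps_map_nth)
  then have "\<phi> x \<in> {t. F t = ?J t}" for x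
    by (intro range_subset subalgebra_equalizer F(1) J) (simp add: series_in_def)
  then have "F \<circ> \<phi> = ?J \<circ> \<phi>" by (simp add: fun_eq_iff)
  then show ?thesis
    using inj_tensor_map[OF R inj_Rep_tw(1) R inj_Rep_tw(1)] inj by (simp add: inj_compose)
qed

lemma inj_Pr1: "inj (Pr1 \<circ> \<phi>)"
proof -
  let ?e = "fps_unit_inverse qdet_root"
  let ?z = "fps_map left ?e" and ?w = "fps_map left qdet_root"
  note c = qdet_root(1) and e = fps_unit_inverse[OF qdet_root(2)]
  have z: "central_series ?z" "fps_nth ?z 0 = 1" and w: "central_series ?w" "fps_nth ?w 0 = 1"
    by (simp_all add: central_series_tens c central_series_unit_inverse e qdet_root(2) tens_one)
  have zw: "?z * ?w = 1"
    by (simp add: e fps_map_hom[OF calg_hom_tens_left] flip: fps_map_hom(5)[OF calg_hom_tens_left])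
  obtain k l where k: "calg_hom k" "map_matrix (fps_map k) T_y2 = (\<chi> i j. ?z * map_matrix (fps_map left) T_y2 $ i $ j)"
    and l: "calg_hom l" "map_matrix (fps_map l) T_y2 = (\<chi> i j. ?w * map_matrix (fps_map right) T_y2 $ i $ j)"
    and kl: "\<forall>x y. k x * l y = l y * k x"
    by (rule rescaled_homs[OF z w])
  have "qdet (map_matrix (fps_map k) T_y2) = 1"
    unfolding k(2) by (rule qdet_rescaled[OF calg_hom_tens_left])
  then obtain h where h: "calg_hom h" "\<forall>x. h (abs_sy2 x) = k x"
    by (rule factor_through_sy2[OF k(1)])
  have hl: "h x * l y = l y * h x" for x y
    using surj_abs_sy2 kl h(2) by (metis surjD)
  obtain G where G: "calg_hom G" "\<And>a b. G (a \<otimes> b) = (h \<circ> Rep_sy2_tw) a * (l \<circ> Rep_y2_tw) b"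
    by (rule tensor_hom_lift[OF calg_hom_comp[OF calg_hom_Rep_sy2_tw h(1)] calg_hom_comp[OF calg_hom_Rep_y2_tw l(1)]])
      (simp_all add: hl)
  \<comment> \<open>\<open>G\<close> undoes the projection up to rescaling, and injectivity after a
    further map \<open>G\<close> implies injectivity before it.\<close>
  have "inj ((G \<circ> Pr1) \<circ> \<phi>)"
    by (rule rescaled_inj[OF z(1) w(1) zw k l calg_hom_comp[OF Pr_hom(1) G(1)]])
      (simp add: Pr_tens G(2) Rep_proj_tw h(2))
  then show ?thesis by (metis comp_assoc inj_on_imageI2)
qed

lemma inj_Pr2: "inj (Pr2 \<circ> \<phi>)"
proof -
  let ?e = "fps_unit_inverse qdet_root"
  \<comment> \<open>Mirror image of the first case: the determinant of the second copy is
    normalised, and its root is moved onto the first copy.\<close>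
  let ?z = "fps_map right qdet_root" and ?w = "fps_map right ?e"
  note c = qdet_root(1) and e = fps_unit_inverse[OF qdet_root(2)]
  have z: "central_series ?z" "fps_nth ?z 0 = 1" and w: "central_series ?w" "fps_nth ?w 0 = 1"
    by (simp_all add: central_series_tens c central_series_unit_inverse e qdet_root(2) tens_one)
  have zw: "?z * ?w = 1"
    by (simp add: e fps_map_hom[OF calg_hom_tens_right] flip: fps_map_hom(5)[OF calg_hom_tens_right])
  obtain k l where k: "calg_hom k" "map_matrix (fps_map k) T_y2 = (\<chi> i j. ?z * map_matrix (fps_map left) T_y2 $ i $ j)"
    and l: "calg_hom l" "map_matrix (fps_map l) T_y2 = (\<chi> i j. ?w * map_matrix (fps_map right) T_y2 $ i $ j)"
    and kl: "\<forall>x y. k x * l y = l y * k x"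
    by (rule rescaled_homs[OF z w])
  have "qdet (map_matrix (fps_map l) T_y2) = 1"
    unfolding l(2) by (rule qdet_rescaled[OF calg_hom_tens_right])
  then obtain h where h: "calg_hom h" "\<forall>x. h (abs_sy2 x) = l x"
    by (rule factor_through_sy2[OF l(1)])
  have kh: "k x * h y = h y * k x" for x y
    using surj_abs_sy2 kl h(2) by (metis surjD)
  obtain G where G: "calg_hom G" "\<And>a b. G (a \<otimes> b) = (k \<circ> Rep_y2_tw) a * (h \<circ> Rep_sy2_tw) b"
    by (rule tensor_hom_lift[OF calg_hom_comp[OF calg_hom_Rep_y2_tw k(1)] calg_hom_comp[OF calg_hom_Rep_sy2_tw h(1)]])
      (simp_all add: kh)
  have "inj ((G \<circ> Pr2) \<circ> \<phi>)"
    by (rule rescaled_inj[OF z(1) w(1) zw k l calg_hom_comp[OF Pr_hom(2) G(1)]])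
      (simp add: Pr_tens G(2) Rep_proj_tw h(2))
  then show ?thesis by (metis comp_assoc inj_on_imageI2)
qed

end

theorem corollary4p13:
  fixes \<phi>\<^sub>1 :: "xso4_tw \<Rightarrow> (y2_tw, y2_tw) tensor"
  assumes "calg_hom \<phi>\<^sub>1"
    and "inj \<phi>\<^sub>1"
    and "map_matrix (fps_map \<phi>\<^sub>1) S_xso4_tw =
      in_basis (map_matrix (at_affine 1 (- 1 / 2)) S_circ ** map_matrix (at_affine 1 (- 1 / 2)) S_bullet)"
  shows "calg_iso (Pr1 \<circ> \<phi>\<^sub>1) \<and> calg_iso (Pr2 \<circ> \<phi>\<^sub>1)"
proof -
  interpret twisted_embedding \<phi>\<^sub>1 by unfold_locales (fact assms)+
  show ?thesis
    unfolding calg_iso_def bij_def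
    by (intro conjI calg_hom_comp[OF hom] Pr_hom surj_Pr1 surj_Pr2 inj_Pr1 inj_Pr2)
qed

end
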